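(* Let $k$ be a finite field of characteristic $p$, let $G$ be a profinite group, let $U$ be an indecomposable finitely generated profinite $k[[G]]$-module, and let $Q,R$ be vertices of $U$. Then there exists $x\in G$ such that $Q=xRx^{-1}$.
   Context: Conventions: $k[[G]]=\varprojlim_{N} k[G/N]$ ($N$ over open normal subgroups of $G$) is the completed group algebra. Modules are profinite left modules; homomorphisms and direct sum decompositions are continuous. For a closed subgroup $H\le G$, a profinite $k[[G]]$-module $U$ is relatively $H$-projective if for every continuous epimorphism $\beta:V\twoheadrightarrow W$ and continuous homomorphism $\varphi:U\to W$ of profinite $k[[G]]$-modules, there exists a continuous $k[[G]]$-homomorphism $\rho:U\to V$ with $\beta\rho=\varphi$ provided there is a continuous $k[[H]]$-homomorphism with this property. A vertex of a finitely generated indecomposable profinite $k[[G]]$-module $U$ is a closed subgroup $Q$ of $G$ such that $U$ is relatively $Q$-projective but $U$ is not relatively projective with respect to any proper closed subgroup of $Q$. *)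

theory Defs
  imports "HOL-Analysis.Analysis" "HOL-Algebra.Module" "HOL-Algebra.Multiplicative_Group"
begin

section \<open>Profinite spaces and profinite groups\<close>

definition totally_disconnected_space :: "'a topology \<Rightarrow> bool" where
  "totally_disconnected_space X \<longleftrightarrow> (\<forall>S. connectedin X S \<longrightarrow> (\<exists>a. S \<subseteq> {a}))"

definition profinite_space :: "'a topology \<Rightarrow> bool" where
  "profinite_space X \<longleftrightarrow> compact_space X \<and> Hausdorff_space X \<and> totally_disconnected_space X"

record 'g top_group = "'g monoid" +
  gtopology :: "'g topology"

locale profinite_group = group G for G :: "('g, 'b) top_group_scheme" (structure) +
  assumes topspace_gtopology: "topspace (gtopology G) = carrier G"
    and continuous_mult:
      "continuous_map (prod_topology (gtopology G) (gtopology G)) (gtopology G) (\<lambda>(x, y). x \<otimes> y)"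
    and continuous_inv: "continuous_map (gtopology G) (gtopology G) (\<lambda>x. inv x)"
    and profinite_topology: "profinite_space (gtopology G)"

definition sub_top_group :: "('g, 'b) top_group_scheme \<Rightarrow> 'g set \<Rightarrow> ('g, 'b) top_group_scheme" where
  "sub_top_group G H = G\<lparr>carrier := H, gtopology := subtopology (gtopology G) H\<rparr>"

definition closed_subgroup :: "'g set \<Rightarrow> ('g, 'b) top_group_scheme \<Rightarrow> bool" where
  "closed_subgroup H G \<longleftrightarrow> subgroup H G \<and> closedin (gtopology G) H"

definition open_normal_subgroups :: "('g, 'b) top_group_scheme \<Rightarrow> 'g set set" where
  "open_normal_subgroups G = {N. N \<lhd> G \<and> openin (gtopology G) N}"


section \<open>Completed group algebras\<close>

definition ring_char :: "('k, 'a) ring_scheme \<Rightarrow> nat" where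
  "ring_char k = group.ord (add_monoid k) \<one>\<^bsub>k\<^esub>"

definition group_algebra ::
    "('k, 'a) ring_scheme \<Rightarrow> ('h, 'b) monoid_scheme \<Rightarrow> ('h \<Rightarrow> 'k) ring" where
  "group_algebra k G =
    \<lparr>carrier = {f \<in> carrier G \<rightarrow>\<^sub>E carrier k. finite {x \<in> carrier G. f x \<noteq> \<zero>\<^bsub>k\<^esub>}},
     mult = (\<lambda>f h. \<lambda>x\<in>carrier G.
       \<Oplus>\<^bsub>k\<^esub>y\<in>{y \<in> carrier G. f y \<noteq> \<zero>\<^bsub>k\<^esub>}. f y \<otimes>\<^bsub>k\<^esub> h (inv\<^bsub>G\<^esub> y \<otimes>\<^bsub>G\<^esub> x)),
     one = (\<lambda>x\<in>carrier G. if x = \<one>\<^bsub>G\<^esub> then \<one>\<^bsub>k\<^esub> else \<zero>\<^bsub>k\<^esub>),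
     zero = (\<lambda>x\<in>carrier G. \<zero>\<^bsub>k\<^esub>),
     add = (\<lambda>f h. \<lambda>x\<in>carrier G. f x \<oplus>\<^bsub>k\<^esub> h x)\<rparr>"

text \<open>If every member of the finite set of cosets \<open>A\<close> is contained in exactly one member of the
  set of cosets \<open>B\<close>, then \<open>coset_push k A B\<close> is the \<open>k\<close>-linear extension of the map \<open>A \<rightarrow> B\<close>
  sending a coset to the one containing it.  For \<open>N \<subseteq> M\<close> this is the canonical map
  \<open>k[G/N] \<rightarrow> k[G/M]\<close>; for a subgroup \<open>H\<close> of \<open>G\<close> it is \<open>k[H/(H \<inter> N)] \<rightarrow> k[G/N]\<close>.\<close>

definition coset_push ::
    "('k, 'a) ring_scheme \<Rightarrow> 'g set set \<Rightarrow> 'g set set \<Rightarrow> ('g set \<Rightarrow> 'k) \<Rightarrow> 'g set \<Rightarrow> 'k" where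
  "coset_push k A B a = (\<lambda>C\<in>B. \<Oplus>\<^bsub>k\<^esub>D\<in>{D \<in> A. D \<subseteq> C}. a D)"

record 'r top_ring = "'r ring" +
  rtopology :: "'r topology"

type_synonym ('g, 'k) cga = "'g set \<Rightarrow> 'g set \<Rightarrow> 'k"

definition cga_carrier ::
    "('k, 'a) ring_scheme \<Rightarrow> ('g, 'b) top_group_scheme \<Rightarrow> ('g, 'k) cga set" where
  "cga_carrier k G =
    {a \<in> (\<Pi>\<^sub>E N\<in>open_normal_subgroups G. carrier (group_algebra k (G Mod N))).
      \<forall>N\<in>open_normal_subgroups G. \<forall>M\<in>open_normal_subgroups G. N \<subseteq> M \<longrightarrow>
        a M = coset_push k (carrier (G Mod N)) (carrier (G Mod M)) (a N)}"

text \<open>The topology is that of an inverse limit of discrete spaces, which is the intended one for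
  finite \<open>k\<close>.\<close>

definition completed_group_algebra ::
    "('k, 'a) ring_scheme \<Rightarrow> ('g, 'b) top_group_scheme \<Rightarrow> ('g, 'k) cga top_ring" where
  "completed_group_algebra k G =
    \<lparr>carrier = cga_carrier k G,
     mult = (\<lambda>a b. \<lambda>N\<in>open_normal_subgroups G. a N \<otimes>\<^bsub>group_algebra k (G Mod N)\<^esub> b N),
     one = (\<lambda>N\<in>open_normal_subgroups G. \<one>\<^bsub>group_algebra k (G Mod N)\<^esub>),
     zero = (\<lambda>N\<in>open_normal_subgroups G. \<zero>\<^bsub>group_algebra k (G Mod N)\<^esub>),
     add = (\<lambda>a b. \<lambda>N\<in>open_normal_subgroups G. a N \<oplus>\<^bsub>group_algebra k (G Mod N)\<^esub> b N),
     rtopology = subtopology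
       (product_topology (\<lambda>N. discrete_topology (carrier (group_algebra k (G Mod N))))
         (open_normal_subgroups G))
       (cga_carrier k G)\<rparr>"

text \<open>The canonical map \<open>k[[H]] \<rightarrow> k[[G]]\<close> for a closed subgroup \<open>H\<close> of \<open>G\<close>.\<close>

definition cga_incl ::
    "('k, 'a) ring_scheme \<Rightarrow> ('g, 'b) top_group_scheme \<Rightarrow> 'g set \<Rightarrow> ('g, 'k) cga \<Rightarrow> ('g, 'k) cga" where
  "cga_incl k G H b = (\<lambda>N\<in>open_normal_subgroups G.
     coset_push k (carrier (sub_top_group G H Mod (H \<inter> N))) (carrier (G Mod N)) (b (H \<inter> N)))"


section \<open>Profinite modules\<close>

text \<open>The locale \<open>module\<close> of HOL-Algebra is restricted to commutative rings, so left modules over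
  arbitrary rings are introduced here, with the same axioms.\<close>

locale left_module = R?: ring R + M?: abelian_group M
    for R :: "('r, 'a) ring_scheme" (structure) and M :: "('r, 'm, 'b) module_scheme" (structure) +
  assumes smult_closed [simp, intro]:
      "\<lbrakk>a \<in> carrier R; x \<in> carrier M\<rbrakk> \<Longrightarrow> a \<odot>\<^bsub>M\<^esub> x \<in> carrier M"
    and smult_l_distr:
      "\<lbrakk>a \<in> carrier R; b \<in> carrier R; x \<in> carrier M\<rbrakk> \<Longrightarrow>
        (a \<oplus>\<^bsub>R\<^esub> b) \<odot>\<^bsub>M\<^esub> x = a \<odot>\<^bsub>M\<^esub> x \<oplus>\<^bsub>M\<^esub> b \<odot>\<^bsub>M\<^esub> x"
    and smult_r_distr:
      "\<lbrakk>a \<in> carrier R; x \<in> carrier M; y \<in> carrier M\<rbrakk> \<Longrightarrow>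
        a \<odot>\<^bsub>M\<^esub> (x \<oplus>\<^bsub>M\<^esub> y) = a \<odot>\<^bsub>M\<^esub> x \<oplus>\<^bsub>M\<^esub> a \<odot>\<^bsub>M\<^esub> y"
    and smult_assoc1:
      "\<lbrakk>a \<in> carrier R; b \<in> carrier R; x \<in> carrier M\<rbrakk> \<Longrightarrow>
        (a \<otimes>\<^bsub>R\<^esub> b) \<odot>\<^bsub>M\<^esub> x = a \<odot>\<^bsub>M\<^esub> (b \<odot>\<^bsub>M\<^esub> x)"
    and smult_one [simp]: "x \<in> carrier M \<Longrightarrow> \<one>\<^bsub>R\<^esub> \<odot>\<^bsub>M\<^esub> x = x"

record ('r, 'm) top_module = "('r, 'm) module" +
  mtopology :: "'m topology"

locale profinite_module = left_module R M
    for R :: "('r, 'a) top_ring_scheme" (structure)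
      and M :: "('r, 'm, 'b) top_module_scheme" (structure) +
  assumes topspace_mtopology: "topspace (mtopology M) = carrier M"
    and continuous_add:
      "continuous_map (prod_topology (mtopology M) (mtopology M)) (mtopology M)
        (\<lambda>(x, y). x \<oplus>\<^bsub>M\<^esub> y)"
    and continuous_smult:
      "continuous_map (prod_topology (rtopology R) (mtopology M)) (mtopology M)
        (\<lambda>(r, x). r \<odot>\<^bsub>M\<^esub> x)"
    and profinite_topology: "profinite_space (mtopology M)"

definition continuous_hom ::
    "('r, 'a) ring_scheme \<Rightarrow> ('r, 'm, 'b) top_module_scheme \<Rightarrow> ('r, 'n, 'c) top_module_scheme
      \<Rightarrow> ('m \<Rightarrow> 'n) set" where
  "continuous_hom R M N =
    {f \<in> carrier M \<rightarrow> carrier N.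
      (\<forall>x\<in>carrier M. \<forall>y\<in>carrier M. f (x \<oplus>\<^bsub>M\<^esub> y) = f x \<oplus>\<^bsub>N\<^esub> f y) \<and>
      (\<forall>r\<in>carrier R. \<forall>x\<in>carrier M. f (r \<odot>\<^bsub>M\<^esub> x) = r \<odot>\<^bsub>N\<^esub> f x) \<and>
      continuous_map (mtopology M) (mtopology N) f}"

definition continuous_epi ::
    "('r, 'a) ring_scheme \<Rightarrow> ('r, 'm, 'b) top_module_scheme \<Rightarrow> ('r, 'n, 'c) top_module_scheme
      \<Rightarrow> ('m \<Rightarrow> 'n) set" where
  "continuous_epi R M N = {f \<in> continuous_hom R M N. f ` carrier M = carrier N}"

definition restrict_scalars ::
    "('r \<Rightarrow> 'r) \<Rightarrow> ('r, 'm, 'b) top_module_scheme \<Rightarrow> ('r, 'm, 'b) top_module_scheme" where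
  "restrict_scalars \<theta> M = M\<lparr>smult := (\<lambda>r x. \<theta> r \<odot>\<^bsub>M\<^esub> x)\<rparr>"

text \<open>Generation of profinite modules is topological.\<close>

definition finitely_generated_module ::
    "('r, 'a) ring_scheme \<Rightarrow> ('r, 'm, 'b) top_module_scheme \<Rightarrow> bool" where
  "finitely_generated_module R M \<longleftrightarrow>
    (\<exists>X. finite X \<and> X \<subseteq> carrier M \<and>
      (\<forall>N. submodule N R M \<and> closedin (mtopology M) N \<and> X \<subseteq> N \<longrightarrow> N = carrier M))"

definition direct_sum_decomposition ::
    "('r, 'a) ring_scheme \<Rightarrow> ('r, 'm, 'b) top_module_scheme \<Rightarrow> 'm set \<Rightarrow> 'm set \<Rightarrow> bool" where
  "direct_sum_decomposition R M A B \<longleftrightarrow>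
    submodule A R M \<and> submodule B R M \<and>
    homeomorphic_map
      (prod_topology (subtopology (mtopology M) A) (subtopology (mtopology M) B))
      (mtopology M) (\<lambda>(x, y). x \<oplus>\<^bsub>M\<^esub> y)"

definition indecomposable_module ::
    "('r, 'a) ring_scheme \<Rightarrow> ('r, 'm, 'b) top_module_scheme \<Rightarrow> bool" where
  "indecomposable_module R M \<longleftrightarrow>
    carrier M \<noteq> {\<zero>\<^bsub>M\<^esub>} \<and>
    (\<forall>A B. direct_sum_decomposition R M A B \<longrightarrow> A = {\<zero>\<^bsub>M\<^esub>} \<or> B = {\<zero>\<^bsub>M\<^esub>})"


section \<open>Relative projectivity and vertices\<close>

definition relative_lifting ::
    "('k, 'a) ring_scheme \<Rightarrow> ('g, 'b) top_group_scheme \<Rightarrow> 'g set \<Rightarrow>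
      (('g, 'k) cga, 'u) top_module \<Rightarrow> (('g, 'k) cga, 'v) top_module \<Rightarrow>
      (('g, 'k) cga, 'w) top_module \<Rightarrow> bool" where
  "relative_lifting k G H U V W \<longleftrightarrow>
    (\<forall>\<beta>\<in>continuous_epi (completed_group_algebra k G) V W.
     \<forall>\<phi>\<in>continuous_hom (completed_group_algebra k G) U W.
       (\<exists>\<psi>\<in>continuous_hom (completed_group_algebra k (sub_top_group G H))
             (restrict_scalars (cga_incl k G H) U) (restrict_scalars (cga_incl k G H) V).
          \<forall>u\<in>carrier U. \<beta> (\<psi> u) = \<phi> u) \<longrightarrow>
       (\<exists>\<rho>\<in>continuous_hom (completed_group_algebra k G) U V.
          \<forall>u\<in>carrier U. \<beta> (\<rho> u) = \<phi> u))"

text \<open>HOL cannot quantify over all types inside a definition, so the test modules \<open>V\<close> and \<open>W\<close>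
  range over the profinite modules carried by subsets of the type \<open>test_universe\<close> below.  This is
  no restriction: by \<open>relatively_projective_lifting\<close> the lifting property then
  holds for profinite modules \<open>V\<close> and \<open>W\<close> carried by arbitrary types.\<close>

type_synonym ('g, 'k, 'u) test_universe = "(('g, 'k) cga \<times> 'u) list set set"

definition relatively_projective ::
    "('k, 'a) ring_scheme \<Rightarrow> ('g, 'b) top_group_scheme \<Rightarrow> 'g set \<Rightarrow>
      (('g, 'k) cga, 'u) top_module \<Rightarrow> bool" where
  "relatively_projective k G H U \<longleftrightarrow>
    (\<forall>(V :: (('g, 'k) cga, ('g, 'k, 'u) test_universe) top_module)
      (W :: (('g, 'k) cga, ('g, 'k, 'u) test_universe) top_module).
        profinite_module (completed_group_algebra k G) V \<and>
        profinite_module (completed_group_algebra k G) W \<longrightarrow>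
        relative_lifting k G H U V W)"

definition is_vertex ::
    "('k, 'a) ring_scheme \<Rightarrow> ('g, 'b) top_group_scheme \<Rightarrow>
      (('g, 'k) cga, 'u) top_module \<Rightarrow> 'g set \<Rightarrow> bool" where
  "is_vertex k G U Q \<longleftrightarrow>
    closed_subgroup Q G \<and> relatively_projective k G Q U \<and>
    (\<forall>Q'. closed_subgroup Q' G \<and> Q' \<subset> Q \<longrightarrow> \<not> relatively_projective k G Q' U)"


section \<open>Independence of the test universe\<close>

lemma profinite_space_homeomorphic:
  assumes h: "homeomorphic_map X Y f" and Y: "profinite_space Y"
  shows "profinite_space X"
proof -
  have sp: "X homeomorphic_space Y"
    by (rule homeomorphic_map_imp_homeomorphic_space[OF h])
  have "totally_disconnected_space X"
    unfolding totally_disconnected_space_def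
  proof (intro allI impI)
    fix S assume S: "connectedin X S"
    then have "connectedin Y (f ` S)"
      by (rule connectedin_continuous_map_image[OF homeomorphic_imp_continuous_map[OF h]])
    then obtain a where "f ` S \<subseteq> {a}"
      using Y unfolding profinite_space_def totally_disconnected_space_def by blast
    moreover have "inj_on f S"
      using h S inj_on_subset by (auto simp: homeomorphic_map_def connectedin_def)
    ultimately have eq: "x = y" if "x \<in> S" "y \<in> S" for x y
      using that by (auto simp: inj_on_def image_subset_iff)
    show "\<exists>a. S \<subseteq> {a}"
    proof (cases "S = {}")
      case False
      then obtain x where "x \<in> S" by blast
      then have "S \<subseteq> {x}" using eq by blast
      then show ?thesis by blast
    qed simp
  qed
  then show ?thesis
    using Y homeomorphic_compact_space[OF sp] homeomorphic_Hausdorff_space[OF sp]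
    by (simp add: profinite_space_def)
qed

lemma profinite_space_closed_subtopology:
  assumes "profinite_space X" "closedin X S"
  shows "profinite_space (subtopology X S)"
  using assms unfolding profinite_space_def totally_disconnected_space_def
  by (auto simp: connectedin_subtopology Hausdorff_space_subtopology
      closedin_compact_space compact_space_subtopology)

definition transport_module ::
    "('m \<Rightarrow> 'n) \<Rightarrow> 'm set \<Rightarrow> ('r, 'm, 'b) top_module_scheme \<Rightarrow> ('r, 'n) top_module" where
  "transport_module i N M =
    \<lparr>carrier = i ` N, mult = undefined, one = undefined, zero = i \<zero>\<^bsub>M\<^esub>,
     add = (\<lambda>x y. i (inv_into N i x \<oplus>\<^bsub>M\<^esub> inv_into N i y)),
     smult = (\<lambda>r x. i (r \<odot>\<^bsub>M\<^esub> inv_into N i x)),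
     mtopology = pullback_topology (i ` N) (inv_into N i) (mtopology M)\<rparr>"

lemma submodule_facts:
  assumes N: "submodule N R M"
  shows "N \<subseteq> carrier M" "\<zero>\<^bsub>M\<^esub> \<in> N"
    "\<And>x y. \<lbrakk>x \<in> N; y \<in> N\<rbrakk> \<Longrightarrow> x \<oplus>\<^bsub>M\<^esub> y \<in> N"
    "\<And>x. x \<in> N \<Longrightarrow> \<ominus>\<^bsub>M\<^esub> x \<in> N"
    "\<And>r x. \<lbrakk>r \<in> carrier R; x \<in> N\<rbrakk> \<Longrightarrow> r \<odot>\<^bsub>M\<^esub> x \<in> N"
proof -
  interpret S: submodule N R M by (fact N)
  show "N \<subseteq> carrier M" using S.subset by simp
  show "\<zero>\<^bsub>M\<^esub> \<in> N" using S.one_closed by simp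
  show "\<And>x y. \<lbrakk>x \<in> N; y \<in> N\<rbrakk> \<Longrightarrow> x \<oplus>\<^bsub>M\<^esub> y \<in> N" using S.m_closed by simp
  show "\<And>x. x \<in> N \<Longrightarrow> \<ominus>\<^bsub>M\<^esub> x \<in> N" using S.m_inv_closed by (simp add: a_inv_def)
  show "\<And>r x. \<lbrakk>r \<in> carrier R; x \<in> N\<rbrakk> \<Longrightarrow> r \<odot>\<^bsub>M\<^esub> x \<in> N" using S.smult_closed by simp
qed

context
  fixes R :: "('r, 'a) top_ring_scheme" and M :: "('r, 'm, 'b) top_module_scheme"
    and N :: "'m set" and i :: "'m \<Rightarrow> 'n"
  assumes M: "profinite_module R M" and N: "submodule N R M"
    and cl: "closedin (mtopology M) N" and inj: "inj_on i N"
begin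

interpretation M: profinite_module R M by (fact M)

lemmas transported_facts = submodule_facts[OF N]

lemma transport_homeomorphic:
  "homeomorphic_map (mtopology (transport_module i N M)) (subtopology (mtopology M) N)
     (inv_into N i)"
proof -
  let ?j = "inv_into N i" and ?T = "mtopology (transport_module i N M)"
  have T: "?T = pullback_topology (i ` N) ?j (mtopology M)"
    by (simp add: transport_module_def)
  have j: "?j (i x) = x" if "x \<in> N" for x using that inj by simp
  have top: "topspace ?T = i ` N"
    using transported_facts(1) M.topspace_mtopology
    by (auto simp: T topspace_pullback_topology j)
  have c1: "continuous_map ?T (mtopology M) ?j"
  proof -
    have "continuous_map ?T (mtopology M) (id \<circ> ?j)"
      unfolding T by (rule continuous_map_pullback) simp
    then show ?thesis by simp
  qed
  have c2: "continuous_map (subtopology (mtopology M) N) ?T i"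
    unfolding T
  proof (rule continuous_map_pullback')
    show "continuous_map (subtopology (mtopology M) N) (mtopology M) (?j \<circ> i)"
      by (rule continuous_map_eq[of _ _ id]) (auto simp: j continuous_map_from_subtopology)
    show "topspace (subtopology (mtopology M) N) \<subseteq> i -` i ` N" by auto
  qed
  have "homeomorphic_maps ?T (subtopology (mtopology M) N) ?j i"
    unfolding homeomorphic_maps_def
    using c1 c2 top j transported_facts(1)
    by (auto simp: continuous_map_in_subtopology)
  then show ?thesis using homeomorphic_maps_map by blast
qed

lemma continuous_into_transport:
  assumes f: "continuous_map X (mtopology M) f" and im: "\<And>x. x \<in> topspace X \<Longrightarrow> f x \<in> N"
  shows "continuous_map X (mtopology (transport_module i N M)) (\<lambda>x. i (f x))"
proof -
  have "continuous_map X (pullback_topology (i ` N) (inv_into N i) (mtopology M)) (\<lambda>x. i (f x))"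
  proof (rule continuous_map_pullback')
    show "continuous_map X (mtopology M) (inv_into N i \<circ> (\<lambda>x. i (f x)))"
      by (rule continuous_map_eq[OF f]) (use im inj in auto)
    show "topspace X \<subseteq> (\<lambda>x. i (f x)) -` i ` N" using im by auto
  qed
  then show ?thesis by (simp add: transport_module_def)
qed

lemma transport_inv_hom:
  "inv_into N i \<in> continuous_hom R (transport_module i N M) M"
proof -
  have "continuous_map (mtopology (transport_module i N M)) (mtopology M) (inv_into N i)"
    using transport_homeomorphic homeomorphic_imp_continuous_map
    by (metis continuous_map_in_subtopology)
  then show ?thesis
    using transported_facts inj
    by (auto simp: continuous_hom_def transport_module_def)
qed

lemma continuous_hom_into_transport:
  assumes f: "f \<in> continuous_hom R' X (restrict_scalars \<theta> M)"
    and X: "topspace (mtopology X) = carrier X"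
    and im: "\<And>x. x \<in> carrier X \<Longrightarrow> f x \<in> N"
  shows "(\<lambda>x. i (f x)) \<in> continuous_hom R' X (restrict_scalars \<theta> (transport_module i N M))"
proof -
  have "continuous_map (mtopology X) (mtopology M) f"
    using f by (simp add: continuous_hom_def restrict_scalars_def)
  then have "continuous_map (mtopology X) (mtopology (transport_module i N M)) (\<lambda>x. i (f x))"
    by (rule continuous_into_transport) (use X im in simp)
  then show ?thesis
    using f im inj by (simp add: continuous_hom_def restrict_scalars_def transport_module_def)
qed

lemma transport_profinite:
  assumes topR: "topspace (rtopology R) = carrier R"
  shows "profinite_module R (transport_module i N M)"
proof -
  let ?j = "inv_into N i" and ?M = "transport_module i N M"
  have j: "?j (i x) = x" if "x \<in> N" for x using that inj by simp
  have inN: "x \<in> carrier M" if "x \<in> N" for x using transported_facts(1) that by blast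
  have top: "topspace (mtopology ?M) = carrier ?M"
    using transported_facts(1) M.topspace_mtopology
    by (auto simp: transport_module_def topspace_pullback_topology j)
  have cj: "continuous_map (mtopology ?M) (mtopology M) ?j"
    using transport_inv_hom by (simp add: continuous_hom_def)
  have jN: "?j x \<in> N" if "x \<in> carrier ?M" for x
    using that by (auto simp: transport_module_def j)
  have "abelian_group ?M"
  proof (rule abelian_groupI)
    show "\<exists>y\<in>carrier ?M. y \<oplus>\<^bsub>?M\<^esub> x = \<zero>\<^bsub>?M\<^esub>" if "x \<in> carrier ?M" for x
    proof -
      obtain y where y: "y \<in> N" "x = i y" using \<open>x \<in> carrier ?M\<close>
        by (auto simp: transport_module_def)
      have "i (\<ominus>\<^bsub>M\<^esub> y) \<oplus>\<^bsub>?M\<^esub> x = \<zero>\<^bsub>?M\<^esub>" "i (\<ominus>\<^bsub>M\<^esub> y) \<in> carrier ?M"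
        using y transported_facts inN by (auto simp: transport_module_def j M.l_neg)
      then show ?thesis by blast
    qed
  qed (use transported_facts inN in \<open>auto simp: transport_module_def j M.a_ac\<close>)
  moreover have "ring R" by (rule M.R.ring_axioms)
  moreover have "left_module_axioms R ?M"
    by unfold_locales
      (use transported_facts inN in \<open>auto simp: transport_module_def j M.smult_l_distr M.smult_r_distr
         M.smult_assoc1\<close>)
  moreover have "profinite_module_axioms R ?M"
  proof
    show "topspace (mtopology ?M) = carrier ?M" by (fact top)
    show "profinite_space (mtopology ?M)"
      using transport_homeomorphic profinite_space_closed_subtopology[OF M.profinite_topology cl]
        profinite_space_homeomorphic by blast
    have "continuous_map (prod_topology (mtopology ?M) (mtopology ?M)) (mtopology M)
        ((\<lambda>(x, y). x \<oplus>\<^bsub>M\<^esub> y) \<circ> (\<lambda>(x, y). (?j x, ?j y)))"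
      by (rule continuous_map_compose[OF _ M.continuous_add])
        (use cj in \<open>simp add: continuous_map_prod_top\<close>)
    then have "continuous_map (prod_topology (mtopology ?M) (mtopology ?M)) (mtopology M)
        (\<lambda>z. ?j (fst z) \<oplus>\<^bsub>M\<^esub> ?j (snd z))"
      by (simp add: o_def case_prod_beta)
    from continuous_into_transport[OF this]
    show "continuous_map (prod_topology (mtopology ?M) (mtopology ?M)) (mtopology ?M)
        (\<lambda>(x, y). x \<oplus>\<^bsub>?M\<^esub> y)"
      using transported_facts jN top by (simp add: case_prod_unfold transport_module_def mem_Times_iff)
    have "continuous_map (prod_topology (rtopology R) (mtopology ?M)) (mtopology M)
        ((\<lambda>(x, y). x \<odot>\<^bsub>M\<^esub> y) \<circ> (\<lambda>(x, y). (id x, ?j y)))"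
      by (rule continuous_map_compose[OF _ M.continuous_smult])
        (use cj in \<open>simp add: continuous_map_prod_top\<close>)
    then have "continuous_map (prod_topology (rtopology R) (mtopology ?M)) (mtopology M)
        (\<lambda>z. fst z \<odot>\<^bsub>M\<^esub> ?j (snd z))"
      by (simp add: o_def case_prod_beta)
    from continuous_into_transport[OF this]
    show "continuous_map (prod_topology (rtopology R) (mtopology ?M)) (mtopology ?M)
        (\<lambda>(r, x). r \<odot>\<^bsub>?M\<^esub> x)"
      using transported_facts jN top topR by (simp add: case_prod_unfold transport_module_def mem_Times_iff)
  qed
  ultimately show ?thesis
    by (simp add: profinite_module_def left_module_def)
qed

end


lemma (in abelian_group) add_idem_zero:
  assumes "x \<in> carrier G" "x \<oplus> x = x"
  shows "x = \<zero>"
  using assms by (metis add.inv_solve_left' a_inv_closed add.r_inv_ex a_assoc r_zero r_neg)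

lemma (in left_module) smult_minus_one:
  assumes "x \<in> carrier M"
  shows "(\<ominus>\<^bsub>R\<^esub> \<one>\<^bsub>R\<^esub>) \<odot>\<^bsub>M\<^esub> x = \<ominus>\<^bsub>M\<^esub> x"
proof -
  have "\<zero>\<^bsub>R\<^esub> \<odot>\<^bsub>M\<^esub> x \<oplus>\<^bsub>M\<^esub> \<zero>\<^bsub>R\<^esub> \<odot>\<^bsub>M\<^esub> x = \<zero>\<^bsub>R\<^esub> \<odot>\<^bsub>M\<^esub> x"
    using assms by (simp flip: smult_l_distr)
  then have z: "\<zero>\<^bsub>R\<^esub> \<odot>\<^bsub>M\<^esub> x = \<zero>\<^bsub>M\<^esub>"
    using assms by (intro M.add_idem_zero) auto
  have "(\<ominus>\<^bsub>R\<^esub> \<one>\<^bsub>R\<^esub>) \<odot>\<^bsub>M\<^esub> x \<oplus>\<^bsub>M\<^esub> x = (\<ominus>\<^bsub>R\<^esub> \<one>\<^bsub>R\<^esub> \<oplus>\<^bsub>R\<^esub> \<one>\<^bsub>R\<^esub>) \<odot>\<^bsub>M\<^esub> x"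
    using assms by (subst smult_l_distr) auto
  also have "\<dots> = \<zero>\<^bsub>M\<^esub>" using z by (simp add: R.l_neg)
  finally show ?thesis using assms by (metis M.minus_equality R.a_inv_closed R.one_closed smult_closed)
qed

lemma (in left_module) left_submoduleI:
  assumes "H \<subseteq> carrier M" "\<zero>\<^bsub>M\<^esub> \<in> H"
    and "\<And>x y. \<lbrakk>x \<in> H; y \<in> H\<rbrakk> \<Longrightarrow> x \<oplus>\<^bsub>M\<^esub> y \<in> H"
    and sm: "\<And>r x. \<lbrakk>r \<in> carrier R; x \<in> H\<rbrakk> \<Longrightarrow> r \<odot>\<^bsub>M\<^esub> x \<in> H"
  shows "submodule H R M"
proof -
  have "\<ominus>\<^bsub>M\<^esub> x \<in> H" if "x \<in> H" for x
    using sm[of "\<ominus>\<^bsub>R\<^esub> \<one>\<^bsub>R\<^esub>" x] that assms(1) by (auto simp: smult_minus_one)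
  then show ?thesis
    using assms by (auto intro!: submodule.intro subgroup.intro submodule_axioms.intro simp flip: a_inv_def)
qed

definition lin_comb ::
    "('r, 'm, 'b) module_scheme \<Rightarrow> ('u \<Rightarrow> 'm) \<Rightarrow> ('r \<times> 'u) list \<Rightarrow> 'm" where
  "lin_comb M f l = foldr (\<lambda>(r, u) s. r \<odot>\<^bsub>M\<^esub> f u \<oplus>\<^bsub>M\<^esub> s) l \<zero>\<^bsub>M\<^esub>"

context profinite_module
begin

lemma submodule_closure:
  assumes S: "S \<subseteq> carrier M" "\<zero>\<^bsub>M\<^esub> \<in> S"
    and add: "\<And>x y. \<lbrakk>x \<in> S; y \<in> S\<rbrakk> \<Longrightarrow> x \<oplus>\<^bsub>M\<^esub> y \<in> S"
    and sm: "\<And>r x. \<lbrakk>r \<in> carrier R; x \<in> S\<rbrakk> \<Longrightarrow> r \<odot>\<^bsub>M\<^esub> x \<in> S"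
    and topR: "topspace (rtopology R) = carrier R"
  shows "submodule (Abstract_Topology.closure_of (mtopology M) S) R M"
proof (rule left_submoduleI)
  let ?T = "mtopology M"
  let ?C = "Abstract_Topology.closure_of ?T S"
  show "?C \<subseteq> carrier M" using closure_of_subset_topspace topspace_mtopology by metis
  show "\<zero>\<^bsub>M\<^esub> \<in> ?C" using S closure_of_subset topspace_mtopology by (metis subsetD)
  show "x \<oplus>\<^bsub>M\<^esub> y \<in> ?C" if "x \<in> ?C" "y \<in> ?C" for x y
  proof -
    have "(x, y) \<in> Abstract_Topology.closure_of (prod_topology ?T ?T) (S \<times> S)"
      using that by (simp add: closure_of_Times)
    then have "x \<oplus>\<^bsub>M\<^esub> y \<in> (\<lambda>(x, y). x \<oplus>\<^bsub>M\<^esub> y) ` Abstract_Topology.closure_of (prod_topology ?T ?T) (S \<times> S)"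
      by force
    then have "x \<oplus>\<^bsub>M\<^esub> y \<in> Abstract_Topology.closure_of ?T ((\<lambda>(x, y). x \<oplus>\<^bsub>M\<^esub> y) ` (S \<times> S))"
      using continuous_map_image_closure_subset[OF continuous_add] by blast
    moreover have "(\<lambda>(x, y). x \<oplus>\<^bsub>M\<^esub> y) ` (S \<times> S) \<subseteq> S" using add by auto
    ultimately show ?thesis using closure_of_mono by blast
  qed
  show "r \<odot>\<^bsub>M\<^esub> x \<in> ?C" if "r \<in> carrier R" "x \<in> ?C" for r x
  proof -
    have "continuous_map ?T ?T ((\<lambda>(r, x). r \<odot>\<^bsub>M\<^esub> x) \<circ> (\<lambda>x. (r, x)))"
      by (rule continuous_map_compose[OF _ continuous_smult])
        (use that topR in \<open>simp add: continuous_map_pairedI\<close>)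
    then have "continuous_map ?T ?T (\<lambda>x. r \<odot>\<^bsub>M\<^esub> x)" by (simp add: o_def)
    from continuous_map_image_closure_subset[OF this, of S]
    have "r \<odot>\<^bsub>M\<^esub> x \<in> Abstract_Topology.closure_of ?T ((\<lambda>x. r \<odot>\<^bsub>M\<^esub> x) ` S)" using that by blast
    moreover have "(\<lambda>x. r \<odot>\<^bsub>M\<^esub> x) ` S \<subseteq> S" using sm that by auto
    ultimately show ?thesis using closure_of_mono by blast
  qed
qed

lemma lin_comb_props:
  assumes f: "f \<in> A \<rightarrow> carrier M"
  defines "L \<equiv> lists (carrier R \<times> A)"
  shows "l \<in> L \<Longrightarrow> lin_comb M f l \<in> carrier M"
    and "l \<in> L \<Longrightarrow> l' \<in> L \<Longrightarrow>
      lin_comb M f (l @ l') = lin_comb M f l \<oplus>\<^bsub>M\<^esub> lin_comb M f l'"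
    and "l \<in> L \<Longrightarrow> r \<in> carrier R \<Longrightarrow>
      lin_comb M f (map (\<lambda>(s, u). (r \<otimes>\<^bsub>R\<^esub> s, u)) l) = r \<odot>\<^bsub>M\<^esub> lin_comb M f l"
    and "u \<in> A \<Longrightarrow> lin_comb M f [(\<one>\<^bsub>R\<^esub>, u)] = f u"
proof -
  have cl: "lin_comb M f l \<in> carrier M" if "l \<in> L" for l
    using that f unfolding L_def by (induction l) (auto simp: lin_comb_def)
  then show "l \<in> L \<Longrightarrow> lin_comb M f l \<in> carrier M" .
  show "lin_comb M f (l @ l') = lin_comb M f l \<oplus>\<^bsub>M\<^esub> lin_comb M f l'" if "l \<in> L" "l' \<in> L"
    using that(1)
  proof (induction l)
    case Nil
    then show ?case using cl[OF that(2)] by (simp add: lin_comb_def)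
  next
    case (Cons a l)
    then have "l \<in> L" "fst a \<in> carrier R" "snd a \<in> A" by (auto simp: L_def)
    moreover from this f have "fst a \<odot>\<^bsub>M\<^esub> f (snd a) \<in> carrier M" by auto
    ultimately show ?case using Cons cl[OF that(2)] cl[of l]
      by (simp add: lin_comb_def case_prod_beta M.a_assoc)
  qed
  show "lin_comb M f (map (\<lambda>(s, u). (r \<otimes>\<^bsub>R\<^esub> s, u)) l) = r \<odot>\<^bsub>M\<^esub> lin_comb M f l"
    if "l \<in> L" "r \<in> carrier R"
    using that(1)
  proof (induction l)
    case Nil
    have "r \<odot>\<^bsub>M\<^esub> \<zero>\<^bsub>M\<^esub> \<oplus>\<^bsub>M\<^esub> r \<odot>\<^bsub>M\<^esub> \<zero>\<^bsub>M\<^esub> = r \<odot>\<^bsub>M\<^esub> \<zero>\<^bsub>M\<^esub>"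
      using that(2) by (simp flip: smult_r_distr)
    then have "r \<odot>\<^bsub>M\<^esub> \<zero>\<^bsub>M\<^esub> = \<zero>\<^bsub>M\<^esub>"
      using that(2) by (intro M.add_idem_zero) auto
    then show ?case by (simp add: lin_comb_def)
  next
    case (Cons a l)
    then have "l \<in> L" "fst a \<in> carrier R" "snd a \<in> A" by (auto simp: L_def)
    with Cons cl[of l] f that(2) show ?case
      by (auto simp: lin_comb_def case_prod_beta smult_r_distr smult_assoc1 Pi_iff)
  qed
  show "u \<in> A \<Longrightarrow> lin_comb M f [(\<one>\<^bsub>R\<^esub>, u)] = f u"
    using f by (simp add: lin_comb_def Pi_iff)
qed

text \<open>A profinite module topologically generated by the image of \<open>f\<close> has at most as many elements
  as there are families of sets of formal linear combinations: a point is determined by the traces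
  of its neighbourhoods on a dense subset.\<close>

lemma small_closed_submodule:
  fixes f :: "'u \<Rightarrow> 'm"
  assumes f: "f \<in> A \<rightarrow> carrier M" and topR: "topspace (rtopology R) = carrier R"
  obtains N and i :: "'m \<Rightarrow> ('r \<times> 'u) list set set"
  where "submodule N R M" "closedin (mtopology M) N" "f ` A \<subseteq> N" "inj_on i N"
proof -
  let ?T = "mtopology M"
  define L where "L = lists (carrier R \<times> A)"
  define S where "S = lin_comb M f ` L"
  define N where "N = Abstract_Topology.closure_of ?T S"
  define i where "i x = {{l \<in> L. lin_comb M f l \<in> Z} | Z. openin ?T Z \<and> x \<in> Z}" for x
  note lc = lin_comb_props[OF f, folded L_def]
  have SM: "S \<subseteq> carrier M" using lc(1) by (auto simp: S_def)
  have sub: "submodule N R M"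
    unfolding N_def
  proof (rule submodule_closure[OF SM _ _ _ topR])
    show "\<zero>\<^bsub>M\<^esub> \<in> S" unfolding S_def
      by (rule image_eqI[of _ _ "[]"]) (auto simp: lin_comb_def L_def)
    show "x \<oplus>\<^bsub>M\<^esub> y \<in> S" if "x \<in> S" "y \<in> S" for x y
    proof -
      obtain l l' where l: "l \<in> L" "l' \<in> L" "x = lin_comb M f l" "y = lin_comb M f l'"
        using \<open>x \<in> S\<close> \<open>y \<in> S\<close> by (auto simp: S_def)
      then have "l @ l' \<in> L" by (auto simp: L_def)
      then show ?thesis using lc(2)[OF l(1,2)] l(3,4) by (metis S_def image_eqI)
    qed
    show "r \<odot>\<^bsub>M\<^esub> x \<in> S" if r: "r \<in> carrier R" and "x \<in> S" for r x
    proof -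
      obtain l where l: "l \<in> L" "x = lin_comb M f l"
        using \<open>x \<in> S\<close> by (auto simp: S_def)
      then have "map (\<lambda>(s, u). (r \<otimes>\<^bsub>R\<^esub> s, u)) l \<in> L" using r
        by (auto simp: L_def in_lists_conv_set dest!: bspec)
      then show ?thesis using lc(3)[OF l(1) r] l(2) by (metis S_def image_eqI)
    qed
  qed
  have inS: "f ` A \<subseteq> S"
  proof
    fix x assume "x \<in> f ` A"
    then obtain u where "u \<in> A" "x = f u" by auto
    then show "x \<in> S" unfolding S_def
      by (intro image_eqI[of _ _ "[(\<one>\<^bsub>R\<^esub>, u)]"]) (auto simp: lc(4) L_def)
  qed
  have "S \<subseteq> N" unfolding N_def
    by (rule closure_of_subset) (use SM topspace_mtopology in simp)
  have "inj_on i N"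
  proof (rule inj_onI, rule ccontr)
    fix x y assume xy: "x \<in> N" "y \<in> N" "i x = i y" "x \<noteq> y"
    have "x \<in> topspace ?T" "y \<in> topspace ?T"
      using xy unfolding N_def by (meson in_closure_of)+
    then obtain X Y where XY: "openin ?T X" "openin ?T Y" "x \<in> X" "y \<in> Y" "disjnt X Y"
      using profinite_topology xy(4) unfolding profinite_space_def Hausdorff_space_def by metis
    have "{l \<in> L. lin_comb M f l \<in> X} \<in> i x"
      using XY(1,3) unfolding i_def by blast
    then have "{l \<in> L. lin_comb M f l \<in> X} \<in> i y" using xy(3) by simp
    then obtain Z where Z: "openin ?T Z" "y \<in> Z"
      "{l \<in> L. lin_comb M f l \<in> X} = {l \<in> L. lin_comb M f l \<in> Z}"
      unfolding i_def by blast
    have "openin ?T (Y \<inter> Z)" "y \<in> Y \<inter> Z" using XY Z by auto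
    then obtain s where "s \<in> S" "s \<in> Y \<inter> Z"
      using xy(2) unfolding N_def in_closure_of by blast
    then obtain l where "l \<in> L" "lin_comb M f l \<in> Y \<inter> Z" by (auto simp: S_def)
    with Z(3) have "lin_comb M f l \<in> X" by blast
    with \<open>lin_comb M f l \<in> Y \<inter> Z\<close> XY(5) show False by (auto simp: disjnt_def)
  qed
  moreover have "closedin ?T N" by (simp add: N_def)
  ultimately show thesis using that[of N i] sub inS \<open>S \<subseteq> N\<close> by blast
qed

end

lemma topspace_completed_group_algebra:
  "topspace (rtopology (completed_group_algebra k G)) = carrier (completed_group_algebra k G)"
  by (auto simp: completed_group_algebra_def cga_carrier_def)

theorem relatively_projective_lifting:
  fixes V :: "(('g, 'k) cga, 'v) top_module" and W :: "(('g, 'k) cga, 'w) top_module"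
    and U :: "(('g, 'k) cga, 'u) top_module"
  assumes proj: "relatively_projective k G H U"
    and U: "profinite_module (completed_group_algebra k G) U"
    and V: "profinite_module (completed_group_algebra k G) V"
    and W: "profinite_module (completed_group_algebra k G) W"
  shows "relative_lifting k G H U V W"
  unfolding relative_lifting_def
proof (intro ballI impI)
  let ?R = "completed_group_algebra k G"
  let ?RH = "completed_group_algebra k (sub_top_group G H)"
  let ?res = "\<lambda>M. restrict_scalars (cga_incl k G H) M"
  interpret U: profinite_module ?R U by (fact U)
  interpret V: profinite_module ?R V by (fact V)
  interpret W: profinite_module ?R W by (fact W)
  note topR = topspace_completed_group_algebra[of k G]
  fix \<beta> \<phi>
  assume \<beta>: "\<beta> \<in> continuous_epi ?R V W" and \<phi>: "\<phi> \<in> continuous_hom ?R U W"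
    and ex: "\<exists>\<psi>\<in>continuous_hom ?RH (?res U) (restrict_scalars (cga_incl k G H) V). \<forall>u\<in>carrier U. \<beta> (\<psi> u) = \<phi> u"
  obtain \<psi> where \<psi>: "\<psi> \<in> continuous_hom ?RH (?res U) (restrict_scalars (cga_incl k G H) V)"
    and \<psi>\<phi>: "\<And>u. u \<in> carrier U \<Longrightarrow> \<beta> (\<psi> u) = \<phi> u" using ex by blast
  have \<psi>_in: "\<psi> \<in> carrier U \<rightarrow> carrier V"
    using \<psi> by (auto simp: continuous_hom_def restrict_scalars_def)
  have \<beta>h: "\<beta> \<in> continuous_hom ?R V W" using \<beta> by (simp add: continuous_epi_def)
  obtain N and i :: "'v \<Rightarrow> ('g, 'k, 'u) test_universe"
    where N: "submodule N ?R V" "closedin (mtopology V) N" "\<psi> ` carrier U \<subseteq> N" "inj_on i N"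
    using V.small_closed_submodule[OF \<psi>_in topR] by blast
  note Nf = submodule_facts[OF N(1)]
  define P where "P = \<beta> ` N"
  define j where "j w = i (inv_into N \<beta> w)" for w
  have P: "submodule P ?R W"
  proof (rule W.left_submoduleI)
    show "P \<subseteq> carrier W" using \<beta>h Nf(1) by (auto simp: P_def continuous_hom_def)
    have "\<beta> \<zero>\<^bsub>V\<^esub> \<in> carrier W"
      using \<beta>h V.M.zero_closed by (simp add: continuous_hom_def Pi_iff)
    moreover have "\<beta> (\<zero>\<^bsub>V\<^esub> \<oplus>\<^bsub>V\<^esub> \<zero>\<^bsub>V\<^esub>) = \<beta> \<zero>\<^bsub>V\<^esub> \<oplus>\<^bsub>W\<^esub> \<beta> \<zero>\<^bsub>V\<^esub>"
      using \<beta>h V.M.zero_closed by (simp add: continuous_hom_def del: V.M.l_zero V.M.r_zero)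
    then have "\<beta> \<zero>\<^bsub>V\<^esub> \<oplus>\<^bsub>W\<^esub> \<beta> \<zero>\<^bsub>V\<^esub> = \<beta> \<zero>\<^bsub>V\<^esub>"
      using V.M.l_zero[OF V.M.zero_closed] by simp
    ultimately have "\<beta> \<zero>\<^bsub>V\<^esub> = \<zero>\<^bsub>W\<^esub>"
      by (intro W.M.add_idem_zero)
    then show "\<zero>\<^bsub>W\<^esub> \<in> P" using Nf(2) unfolding P_def by (metis image_eqI)
    show "x \<oplus>\<^bsub>W\<^esub> y \<in> P" if "x \<in> P" "y \<in> P" for x y
    proof -
      obtain a b where ab: "a \<in> N" "b \<in> N" "x = \<beta> a" "y = \<beta> b" using \<open>x \<in> P\<close> \<open>y \<in> P\<close> by (auto simp: P_def)
      then have "x \<oplus>\<^bsub>W\<^esub> y = \<beta> (a \<oplus>\<^bsub>V\<^esub> b)" using \<beta>h Nf(1) by (auto simp: continuous_hom_def subset_iff)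
      then show ?thesis using ab Nf(3) by (auto simp: P_def)
    qed
    show "r \<odot>\<^bsub>W\<^esub> x \<in> P" if "r \<in> carrier ?R" "x \<in> P" for r x
    proof -
      obtain a where a: "a \<in> N" "x = \<beta> a" using \<open>x \<in> P\<close> by (auto simp: P_def)
      then have "r \<odot>\<^bsub>W\<^esub> x = \<beta> (r \<odot>\<^bsub>V\<^esub> a)" using \<beta>h Nf(1) that by (auto simp: continuous_hom_def subset_iff)
      then show ?thesis using a that Nf(5) by (auto simp: P_def)
    qed
  qed
  have Pcl: "closedin (mtopology W) P"
  proof -
    have "compactin (mtopology V) N"
      using N(2) V.profinite_topology by (simp add: profinite_space_def closedin_compact_space)
    then have "compactin (mtopology W) P" unfolding P_def
      using \<beta>h image_compactin by (fastforce simp: continuous_hom_def)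
    then show ?thesis
      using W.profinite_topology compactin_imp_closedin by (auto simp: profinite_space_def)
  qed
  have jinj: "inj_on j P"
  proof (rule inj_onI)
    fix x y assume xy: "x \<in> P" "y \<in> P" "j x = j y"
    then have "inv_into N \<beta> x = inv_into N \<beta> y"
      using N(4) unfolding j_def P_def by (meson inj_onD inv_into_into)
    then show "x = y" using xy unfolding P_def by (metis f_inv_into_f)
  qed
  note Pf = submodule_facts[OF P]
  let ?V = "transport_module i N V" and ?W = "transport_module j P W"
  note tV = transport_inv_hom[OF V N(1,2,4)] and intoV = continuous_hom_into_transport[OF V N(1,2,4)]
  note tW = transport_inv_hom[OF W P Pcl jinj] and intoW = continuous_hom_into_transport[OF W P Pcl jinj]
  have V': "profinite_module ?R ?V" by (rule transport_profinite[OF V N(1,2,4) topR])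
  have W': "profinite_module ?R ?W" by (rule transport_profinite[OF W P Pcl jinj topR])
  have lift: "relative_lifting k G H U ?V ?W"
    using proj V' W' unfolding relatively_projective_def by blast
  define \<beta>' where "\<beta>' x = j (\<beta> (inv_into N i x))" for x
  have cV: "carrier ?V = i ` N" and cW: "carrier ?W = j ` P" by (simp_all add: transport_module_def)
  have iN: "inv_into N i (i x) = x" if "x \<in> N" for x using that N(4) by simp
  have \<beta>i: "(\<lambda>x. \<beta> (inv_into N i x)) \<in> continuous_hom ?R ?V W"
    using tV \<beta>h continuous_map_compose[of "mtopology ?V" "mtopology V" "inv_into N i" "mtopology W" \<beta>]
    by (auto simp: continuous_hom_def Pi_iff o_def)
  have \<beta>'h: "\<beta>' \<in> continuous_hom ?R ?V ?W"
    unfolding \<beta>'_def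
    using intoW[of _ ?R ?V id] \<beta>i profinite_module.topspace_mtopology[OF V']
    by (simp add: restrict_scalars_def cV P_def iN) (use iN in force)
  have "\<beta>' ` carrier ?V = carrier ?W"
    unfolding cV cW \<beta>'_def unfolding P_def using iN by (simp add: image_image cong: image_cong)
  with \<beta>'h have \<beta>': "\<beta>' \<in> continuous_epi ?R ?V ?W" by (simp add: continuous_epi_def)
  have \<phi>P: "\<phi> u \<in> P" if "u \<in> carrier U" for u
    using that \<psi>\<phi>[OF that] N(3) unfolding P_def by (metis image_subset_iff imageI)
  have \<phi>': "(\<lambda>u. j (\<phi> u)) \<in> continuous_hom ?R U ?W"
    using intoW[of \<phi> ?R U id] \<phi> U.topspace_mtopology \<phi>P by (simp add: restrict_scalars_def)
  have \<psi>': "(\<lambda>u. i (\<psi> u)) \<in> continuous_hom ?RH (?res U) (restrict_scalars (cga_incl k G H) ?V)"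
    by (rule intoV[OF \<psi>]) (use U.topspace_mtopology N(3) in \<open>auto simp: restrict_scalars_def\<close>)
  have "\<forall>u\<in>carrier U. \<beta>' (i (\<psi> u)) = j (\<phi> u)"
    using N(3) iN \<psi>\<phi> unfolding \<beta>'_def by (simp add: image_subset_iff)
  then have "\<exists>\<psi>\<in>continuous_hom ?RH (?res U) (restrict_scalars (cga_incl k G H) ?V).
      \<forall>u\<in>carrier U. \<beta>' (\<psi> u) = j (\<phi> u)"
    by (intro bexI[OF _ \<psi>'])
  with lift[unfolded relative_lifting_def, rule_format, OF \<beta>' \<phi>']
  obtain \<rho> where \<rho>: "\<rho> \<in> continuous_hom ?R U ?V" "\<And>u. u \<in> carrier U \<Longrightarrow> \<beta>' (\<rho> u) = j (\<phi> u)"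
    by auto
  show "\<exists>\<rho>\<in>continuous_hom ?R U V. \<forall>u\<in>carrier U. \<beta> (\<rho> u) = \<phi> u"
  proof (intro bexI ballI)
    show "(\<lambda>u. inv_into N i (\<rho> u)) \<in> continuous_hom ?R U V"
      using tV \<rho>(1) continuous_map_compose[of "mtopology U" "mtopology ?V" \<rho> "mtopology V" "inv_into N i"]
      by (auto simp: continuous_hom_def Pi_iff o_def)
    fix u assume u: "u \<in> carrier U"
    then have "\<rho> u \<in> i ` N" using \<rho>(1) cV by (auto simp: continuous_hom_def)
    then have "\<beta> (inv_into N i (\<rho> u)) \<in> P" by (auto simp: P_def iN)
    moreover have "j (\<beta> (inv_into N i (\<rho> u))) = j (\<phi> u)" using \<rho>(2)[OF u] by (simp add: \<beta>'_def)
    ultimately show "\<beta> (inv_into N i (\<rho> u)) = \<phi> u" using jinj \<phi>P[OF u] by (meson inj_onD)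
  qed
qed

end

theory Submission
  imports Defs "HOL-Algebra.Zassenhaus"
begin

text \<open>By Higman's criterion, \<open>U\<close> is relatively projective with respect to an open subgroup \<open>H\<close> if and
  only if the identity of \<open>U\<close> is the sum of an equivariant family of continuous maps indexed by \<open>G/H\<close>.  For
  open subgroups \<open>H \<supseteq> Q\<close> and \<open>K \<supseteq> R\<close>, composing two such families gives one indexed by \<open>G/H \<times> G/K\<close>.
  The endomorphism ring of \<open>U\<close> is local, hence a single orbit suffices; its stabilizers are conjugate to
  \<open>H \<inter> z K z\<^sup>-\<^sup>1\<close> for some \<open>z\<close>, so that \<open>U\<close> is relatively projective with respect to this intersection.  By
  compactness of \<open>G\<close> one \<open>z\<close> works for all \<open>H = N Q\<close> and \<open>K = N R\<close> with \<open>N\<close> open normal, and by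
  compactness of spaces of maps relative projectivity passes to the intersection \<open>Q \<inter> z R z\<^sup>-\<^sup>1\<close>.
  Minimality of the vertices \<open>Q\<close> and \<open>z R z\<^sup>-\<^sup>1\<close> gives \<open>Q = z R z\<^sup>-\<^sup>1\<close>.

  The endomorphism ring is local because the open fully invariant submodules \<open>L\<close> of the finitely generated
  module \<open>U\<close> form a base of neighbourhoods of zero: for an endomorphism \<open>\<theta>\<close> the maps \<open>\<theta>\<^bsup>n!\<^esup>\<close> are
  eventually constant and idempotent on the finite quotient \<open>U/L\<close>, so they converge to an idempotent
  endomorphism of \<open>U\<close>, which is \<open>0\<close> or \<open>1\<close>.\<close>

section \<open>Topological preliminaries\<close>

lemma openin_forall_compactin:
  assumes f: "continuous_map (prod_topology X Y) Z f" and K: "compactin Y K" and D: "openin Z D"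
  shows "openin X {x \<in> topspace X. \<forall>y\<in>K. f (x, y) \<in> D}"
proof (subst openin_subopen, intro ballI)
  fix x assume x: "x \<in> {x \<in> topspace X. \<forall>y\<in>K. f (x, y) \<in> D}"
  define W where "W = {p \<in> topspace (prod_topology X Y). f p \<in> D}"
  have W: "openin (prod_topology X Y) W"
    unfolding W_def by (rule openin_continuous_map_preimage[OF f D])
  have "{x} \<times> K \<subseteq> W" using x compactin_subset_topspace[OF K] by (auto simp: W_def)
  then obtain A B where AB: "openin X A" "openin Y B" "x \<in> A" "K \<subseteq> B" "A \<times> B \<subseteq> W"
    using tube_lemma_right[OF W K, of x] x by blast
  have "A \<subseteq> {x \<in> topspace X. \<forall>y\<in>K. f (x, y) \<in> D}"
    using AB openin_subset[OF AB(1)] by (auto simp: W_def)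
  with AB show "\<exists>T. openin X T \<and> x \<in> T \<and> T \<subseteq> {x \<in> topspace X. \<forall>y\<in>K. f (x, y) \<in> D}" by blast
qed

lemma finite_directed_lower_bound:
  assumes "finite J" "J \<subseteq> I" "I \<noteq> {}" and "\<And>i j. i \<in> I \<Longrightarrow> j \<in> I \<Longrightarrow> \<exists>l\<in>I. C l \<subseteq> C i \<inter> C j"
  shows "\<exists>l\<in>I. C l \<subseteq> (\<Inter>j\<in>J. C j)"
  using assms(1,2)
proof (induction J)
  case empty
  then show ?case using assms(3) by auto
next
  case (insert i J)
  then obtain l where "l \<in> I" "C l \<subseteq> (\<Inter>j\<in>J. C j)" by auto
  moreover obtain m where "m \<in> I" "C m \<subseteq> C i \<inter> C l" using assms(4)[of i l] insert.prems \<open>l \<in> I\<close> by auto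
  ultimately show ?case by (intro bexI[of _ m]) auto
qed

lemma compact_space_directed_Inter:
  assumes X: "compact_space X" and I: "I \<noteq> {}"
    and closed: "\<And>i. i \<in> I \<Longrightarrow> closedin X (C i)" and nonempty: "\<And>i. i \<in> I \<Longrightarrow> C i \<noteq> {}"
    and directed: "\<And>i j. i \<in> I \<Longrightarrow> j \<in> I \<Longrightarrow> \<exists>l\<in>I. C l \<subseteq> C i \<inter> C j"
  shows "(\<Inter>i\<in>I. C i) \<noteq> {}"
proof (rule compact_space_fip[THEN iffD1, OF X, rule_format], intro conjI ballI allI impI)
  show "closedin X D" if "D \<in> C ` I" for D using that closed by auto
  fix \<F> assume "finite \<F> \<and> \<F> \<subseteq> C ` I"
  then obtain J where J: "J \<subseteq> I" "finite J" "\<F> = C ` J" by (meson finite_subset_image)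
  then obtain l where "l \<in> I" "C l \<subseteq> \<Inter>\<F>"
    using finite_directed_lower_bound[OF J(2,1) I directed] by auto
  then show "\<Inter>\<F> \<noteq> {}" using nonempty by blast
qed

lemma compact_space_directed_subset:
  assumes X: "compact_space X" and I: "I \<noteq> {}" and closed: "\<And>i. i \<in> I \<Longrightarrow> closedin X (C i)"
    and directed: "\<And>i j. i \<in> I \<Longrightarrow> j \<in> I \<Longrightarrow> \<exists>l\<in>I. C l \<subseteq> C i \<inter> C j"
    and A: "openin X A" "(\<Inter>i\<in>I. C i) \<subseteq> A"
  shows "\<exists>i\<in>I. C i \<subseteq> A"
proof (rule ccontr)
  assume no: "\<not> (\<exists>i\<in>I. C i \<subseteq> A)"
  have "(\<Inter>i\<in>I. C i - A) \<noteq> {}"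
  proof (rule compact_space_directed_Inter[OF X I])
    show "closedin X (C i - A)" if "i \<in> I" for i by (rule closedin_diff[OF closed[OF that] A(1)])
    show "C i - A \<noteq> {}" if "i \<in> I" for i using no that by blast
    show "\<exists>l\<in>I. C l - A \<subseteq> (C i - A) \<inter> (C j - A)" if "i \<in> I" "j \<in> I" for i j
      using directed[OF that] by blast
  qed
  then show False using A(2) I by blast
qed

lemma closedin_Collect_ball:
  assumes "\<And>i. i \<in> I \<Longrightarrow> closedin X {x \<in> topspace X. P i x}"
  shows "closedin X {x \<in> topspace X. \<forall>i\<in>I. P i x}"
proof -
  have "{x \<in> topspace X. \<forall>i\<in>I. P i x} = \<Inter>(insert (topspace X) ((\<lambda>i. {x \<in> topspace X. P i x}) ` I))"
    by auto
  moreover have "closedin X \<dots>" by (rule closedin_Inter) (use assms in auto)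
  ultimately show ?thesis by simp
qed

lemma closedin_Collect_conj:
  assumes "closedin X {x \<in> topspace X. P x}" "closedin X {x \<in> topspace X. Q x}"
  shows "closedin X {x \<in> topspace X. P x \<and> Q x}"
  using closedin_Int[OF assms] by (simp add: Collect_conj_eq inf_sup_aci)

lemma product_topology_cong:
  assumes "\<And>i. i \<in> I \<Longrightarrow> T i = S i"
  shows "product_topology T I = product_topology S I"
proof -
  have "finite {i \<in> I. U i \<noteq> topspace (T i)} \<longleftrightarrow> finite {i \<in> I. U i \<noteq> topspace (S i)}"
    "(\<forall>i\<in>I. openin (T i) (U i)) \<longleftrightarrow> (\<forall>i\<in>I. openin (S i) (U i))" for U
    using assms by (auto cong: conj_cong)
  then show ?thesis unfolding topology_eq openin_product_topology_alt by simp
qed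

lemma profinite_space_clopen_neighbourhood:
  assumes X: "profinite_space X" and D: "openin X D" and x: "x \<in> D"
  obtains C where "openin X C" "closedin X C" "x \<in> C" "C \<subseteq> D"
proof -
  have tX: "x \<in> topspace X" using D x openin_subset by blast
  have "separated_between X {x} (topspace X - D)"
  proof (rule cut_wire_fence_theorem)
    show "compact_space X" "Hausdorff_space X" using X by (simp_all add: profinite_space_def)
    then show "closedin X {x}" using closedin_Hausdorff_singleton tX by metis
    show "closedin X (topspace X - D)" using D by blast
    show "disjnt C {x} \<or> disjnt C (topspace X - D)" if "connectedin X C" for C
      using X that x unfolding profinite_space_def totally_disconnected_space_def
      by (metis DiffE disjnt_iff insertE singletonD singletonI subsetD)
  qed
  then obtain U V where UV: "openin X U" "openin X V" "U \<union> V = topspace X" "disjnt U V"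
    "{x} \<subseteq> U" "topspace X - D \<subseteq> V" by (auto simp: separated_between_def)
  then have "U = topspace X - V" by (auto simp: disjnt_iff dest: openin_subset)
  with UV show thesis by (intro that[of U]) (auto simp: disjnt_iff)
qed

lemma profinite_space_product_topology:
  assumes "\<And>i. i \<in> I \<Longrightarrow> profinite_space (X i)"
  shows "profinite_space (product_topology X I)"
proof -
  have "x = a" if S: "connectedin (product_topology X I) S" and xa: "x \<in> S" "a \<in> S" for S x a
  proof (rule PiE_ext)
    have "S \<subseteq> (\<Pi>\<^sub>E i\<in>I. topspace (X i))" using S connectedin_subset_topspace by fastforce
    then show "x \<in> (\<Pi>\<^sub>E i\<in>I. topspace (X i))" "a \<in> (\<Pi>\<^sub>E i\<in>I. topspace (X i))" using xa by auto
    fix i assume i: "i \<in> I"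
    have "connectedin (X i) ((\<lambda>x. x i) ` S)"
      by (rule connectedin_continuous_map_image[OF continuous_map_product_projection[OF i] S])
    then show "x i = a i" using assms[OF i] xa
      unfolding profinite_space_def totally_disconnected_space_def by blast
  qed
  then have "totally_disconnected_space (product_topology X I)"
    unfolding totally_disconnected_space_def by blast
  then show ?thesis using assms
    by (simp add: profinite_space_def compact_space_product_topology Hausdorff_space_product_topology)
qed

lemma compact_space_finite_open_partition:
  assumes X: "compact_space X" and cover: "\<Union>\<P> = topspace X" and disj: "pairwise disjnt \<P>"
    and op: "\<And>P. P \<in> \<P> \<Longrightarrow> openin X P" and ne: "\<And>P. P \<in> \<P> \<Longrightarrow> P \<noteq> {}"
  shows "finite \<P>"
proof -
  obtain \<F> where F: "finite \<F>" "\<F> \<subseteq> \<P>" "topspace X \<subseteq> \<Union>\<F>"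
    using X op cover unfolding compact_space_alt by (metis order_refl)
  have "\<P> \<subseteq> \<F>"
  proof
    fix P assume P: "P \<in> \<P>"
    obtain x where x: "x \<in> P" using ne[OF P] by blast
    obtain D where D: "D \<in> \<F>" "x \<in> D" using F(3) P x unfolding cover[symmetric] by blast
    then have "P = D" using pairwiseD[OF disj P, of D] F(2) x by (auto simp: disjnt_iff)
    then show "P \<in> \<F>" using D(1) by simp
  qed
  then show ?thesis by (rule finite_subset[OF _ F(1)])
qed

lemma closedin_open_partition:
  assumes "\<Union>\<P> = topspace X" "pairwise disjnt \<P>" "\<And>P. P \<in> \<P> \<Longrightarrow> openin X P" "P \<in> \<P>"
  shows "closedin X P"
proof -
  have "topspace X - P = \<Union>(\<P> - {P})"
    using assms(1,2,4) by (auto simp: pairwise_def disjnt_iff)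
  moreover have "openin X (\<Union>(\<P> - {P}))" using assms(3) by (intro openin_Union) auto
  ultimately show ?thesis using assms(1,4) by (auto simp: closedin_def)
qed

lemma continuous_map_fst_snd: "continuous_map (prod_topology X (prod_topology Y Z)) Y (\<lambda>p. fst (snd p))"
  and continuous_map_snd_snd: "continuous_map (prod_topology X (prod_topology Y Z)) Z (\<lambda>p. snd (snd p))"
  using continuous_map_compose[OF continuous_map_snd continuous_map_fst, of X Y Z]
    continuous_map_compose[OF continuous_map_snd continuous_map_snd, of X Y Z]
  by (simp_all add: o_def)

section \<open>Abelian groups\<close>

lemma (in abelian_monoid) finsum_Times:
  assumes "finite A" "finite B" "\<And>a b. a \<in> A \<Longrightarrow> b \<in> B \<Longrightarrow> f (a, b) \<in> carrier G"
  shows "(\<Oplus>p\<in>A \<times> B. f p) = (\<Oplus>b\<in>B. \<Oplus>a\<in>A. f (a, b))"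
proof -
  have "A \<times> B = (\<Union>b\<in>B. (\<lambda>a. (a, b)) ` A)" by auto
  moreover have "(\<Oplus>p\<in>(\<Union>b\<in>B. (\<lambda>a. (a, b)) ` A). f p) = (\<Oplus>b\<in>B. \<Oplus>p\<in>(\<lambda>a. (a, b)) ` A. f p)"
    by (rule add.finprod_UN_disjoint) (use assms in \<open>auto simp: pairwise_def disjnt_iff\<close>)
  moreover have "\<dots> = (\<Oplus>b\<in>B. \<Oplus>a\<in>A. f (a, b))"
  proof (rule finsum_cong')
    show "(\<lambda>b. \<Oplus>a\<in>A. f (a, b)) \<in> B \<rightarrow> carrier G" using assms(3) by (auto intro!: finsum_closed)
    show "(\<Oplus>p\<in>(\<lambda>a. (a, b)) ` A. f p) = (\<Oplus>a\<in>A. f (a, b))" if "b \<in> B" for b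
      by (rule finsum_reindex) (use assms(3) that in \<open>auto simp: inj_on_def\<close>)
  qed simp
  ultimately show ?thesis by simp
qed

context abelian_group
begin

lemma minus_eq_zero_iff:
  assumes "x \<in> carrier G" "y \<in> carrier G"
  shows "x \<ominus> y = \<zero> \<longleftrightarrow> x = y"
  using assms by (metis a_minus_def add.inv_closed add.inv_inv minus_equality r_neg)

lemma minus_add_cancel:
  assumes "x \<in> carrier G" "y \<in> carrier G"
  shows "(x \<ominus> y) \<oplus> y = x"
  using assms by (simp add: a_minus_def a_assoc l_neg)

lemma add_minus_cancel_left:
  assumes "x \<in> carrier G" "y \<in> carrier G"
  shows "(x \<oplus> y) \<ominus> x = y"
  using assms by (simp add: a_minus_def a_comm[of x] a_assoc r_neg)

lemma minus_minus_cancel: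
  assumes "x \<in> carrier G" "y \<in> carrier G"
  shows "x \<ominus> (x \<ominus> y) = y"
  using add_minus_cancel_left[of "x \<ominus> y" y] minus_add_cancel[of x y] assms by simp

lemma minus_add_minus:
  assumes "x \<in> carrier G" "y \<in> carrier G" "z \<in> carrier G"
  shows "(x \<ominus> y) \<oplus> (y \<ominus> z) = x \<ominus> z"
  using assms by (simp add: a_minus_def a_assoc r_neg1)

lemma add_minus_add_eq:
  assumes "a \<in> carrier G" "b \<in> carrier G" "c \<in> carrier G" "d \<in> carrier G"
  shows "(a \<oplus> b) \<ominus> (c \<oplus> d) = (a \<ominus> c) \<oplus> (b \<ominus> d)"
  using assms by (simp add: a_minus_def minus_add a_ac)

end

context abelian_group_hom
begin

lemma hom_minus: "x \<in> carrier G \<Longrightarrow> y \<in> carrier G \<Longrightarrow> h (x \<ominus>\<^bsub>G\<^esub> y) = h x \<ominus>\<^bsub>H\<^esub> h y"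
  by (simp add: a_minus_def)

lemma hom_finsum:
  "u \<in> I \<rightarrow> carrier G \<Longrightarrow> h (\<Oplus>\<^bsub>G\<^esub>i\<in>I. u i) = (\<Oplus>\<^bsub>H\<^esub>i\<in>I. h (u i))"
  by (induction I rule: infinite_finite_induct)
    (simp_all add: G.finsum_infinite H.finsum_infinite G.finsum_insert H.finsum_insert Pi_iff)

lemma inj_on_if_trivial_kernel:
  assumes "\<And>x. x \<in> carrier G \<Longrightarrow> h x = \<zero>\<^bsub>H\<^esub> \<Longrightarrow> x = \<zero>\<^bsub>G\<^esub>"
  shows "inj_on h (carrier G)"
proof (rule inj_onI)
  fix x y assume "x \<in> carrier G" "y \<in> carrier G" "h x = h y"
  then show "x = y"
    using assms[of "x \<ominus>\<^bsub>G\<^esub> y"] hom_minus G.minus_eq_zero_iff H.minus_eq_zero_iff by simp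
qed

end

lemma additive_imp_abelian_group_hom:
  assumes "abelian_group G" "abelian_group H" "h \<in> carrier G \<rightarrow> carrier H"
    and "\<And>x y. x \<in> carrier G \<Longrightarrow> y \<in> carrier G \<Longrightarrow> h (x \<oplus>\<^bsub>G\<^esub> y) = h x \<oplus>\<^bsub>H\<^esub> h y"
  shows "abelian_group_hom G H h"
  using assms
  by (intro abelian_group_homI)
    (auto intro!: group_hom.intro group_hom_axioms.intro simp: hom_def abelian_group.a_group)

context abelian_subgroup
begin

lemma a_rcos_eq_iff:
  assumes "x \<in> carrier G" "y \<in> carrier G"
  shows "H +> x = H +> y \<longleftrightarrow> x \<ominus> y \<in> H"
  using a_rcos_module[of y x] a_repr_independence'[of x y] a_rcos_self[of x] assms
  by (auto simp: a_minus_def)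

lemma a_rcos_eq_self_iff:
  assumes "x \<in> carrier G"
  shows "H +> x = H \<longleftrightarrow> x \<in> H"
  using a_rcos_self[OF assms] a_rcos_const by blast

lemma a_rcos_add_cong:
  assumes "x \<in> carrier G" "x' \<in> carrier G" "y \<in> carrier G" "y' \<in> carrier G"
    and "H +> x = H +> x'" "H +> y = H +> y'"
  shows "H +> (x \<oplus> y) = H +> (x' \<oplus> y')"
  using assms by (simp flip: a_rcos_sum)

lemma a_rcos_finsum_cong:
  "u \<in> I \<rightarrow> carrier G \<Longrightarrow> v \<in> I \<rightarrow> carrier G \<Longrightarrow> (\<And>i. i \<in> I \<Longrightarrow> H +> u i = H +> v i) \<Longrightarrow>
    H +> (\<Oplus>i\<in>I. u i) = H +> (\<Oplus>i\<in>I. v i)"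
proof (induction I rule: infinite_finite_induct)
  case (insert j I)
  then show ?case by (simp add: finsum_insert Pi_iff) (intro a_rcos_add_cong; simp add: Pi_iff)
qed (simp_all add: finsum_infinite)

lemma a_rcos_mono:
  assumes "abelian_subgroup K G" "H \<subseteq> K" "x \<in> carrier G" "y \<in> carrier G" "H +> x = H +> y"
  shows "K +> x = K +> y"
  using assms by (auto simp: a_rcos_eq_iff abelian_subgroup.a_rcos_eq_iff)

end

section \<open>Finite images and iterated maps\<close>

lemma finite_image_if_factors:
  assumes "finite (g ` A)" "\<And>x y. x \<in> A \<Longrightarrow> y \<in> A \<Longrightarrow> g x = g y \<Longrightarrow> f x = f y"
  shows "finite (f ` A)"
proof -
  have "f x = f (inv_into A g (g x))" if "x \<in> A" for x
    using assms(2)[OF that, of "inv_into A g (g x)"] that by (simp add: inv_into_into f_inv_into_f)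
  then have "f ` A \<subseteq> (\<lambda>v. f (inv_into A g v)) ` g ` A" by blast
  then show ?thesis using assms(1) finite_surj by blast
qed

lemma funpow_fibres_eventually_periodic:
  assumes f: "f \<in> A \<rightarrow> A" and x: "x \<in> A" and fin: "finite (\<pi> ` A)"
    and compat: "\<And>y z. y \<in> A \<Longrightarrow> z \<in> A \<Longrightarrow> \<pi> y = \<pi> z \<Longrightarrow> \<pi> (f y) = \<pi> (f z)"
  obtains i d where "1 \<le> d" "i + d \<le> card (\<pi> ` A)"
    "\<And>a t. i \<le> a \<Longrightarrow> \<pi> ((f ^^ (a + t * d)) x) = \<pi> ((f ^^ a) x)"
proof -
  have closed: "(f ^^ n) y \<in> A" if "y \<in> A" for n y using that f by (induction n) auto
  have cong: "\<pi> ((f ^^ n) y) = \<pi> ((f ^^ n) z)" if "y \<in> A" "z \<in> A" "\<pi> y = \<pi> z" for n y z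
    by (induction n) (use that closed compat in auto)
  let ?orbit = "\<lambda>n. \<pi> ((f ^^ n) x)"
  have "card (?orbit ` {..card (\<pi> ` A)}) \<le> card (\<pi> ` A)"
    using closed[OF x] by (intro card_mono fin) auto
  then have "\<not> inj_on ?orbit {..card (\<pi> ` A)}" by (auto dest: card_image)
  then obtain i j where "i < j" "j \<le> card (\<pi> ` A)" and eq: "?orbit i = ?orbit j"
    unfolding inj_on_def by (metis atMost_iff linorder_neqE_nat)
  define d where "d = j - i"
  have shift: "?orbit (a + d) = ?orbit a" if "i \<le> a" for a
  proof -
    obtain b where "a = b + i" using \<open>i \<le> a\<close> by (metis le_add_diff_inverse2)
    moreover from this have "a + d = b + j" using \<open>i < j\<close> by (simp add: d_def)
    moreover have "?orbit (b + j) = ?orbit (b + i)"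
      using cong[OF closed[OF x] closed[OF x] eq[symmetric], of b] by (simp add: funpow_add)
    ultimately show ?thesis by (simp only:)
  qed
  have "?orbit (a + t * d) = ?orbit a" if "i \<le> a" for a t
  proof (induction t)
    case (Suc t)
    have "?orbit (a + Suc t * d) = ?orbit ((a + t * d) + d)" by (simp add: add_ac)
    also have "\<dots> = ?orbit a" using shift[of "a + t * d"] that Suc by simp
    finally show ?case .
  qed simp
  then show thesis using that[of d i] \<open>i < j\<close> \<open>j \<le> card (\<pi> ` A)\<close> by (simp add: d_def)
qed

lemma funpow_fact_fibres_stable:
  assumes f: "f \<in> A \<rightarrow> A" and x: "x \<in> A" and fin: "finite (\<pi> ` A)"
    and compat: "\<And>y z. y \<in> A \<Longrightarrow> z \<in> A \<Longrightarrow> \<pi> y = \<pi> z \<Longrightarrow> \<pi> (f y) = \<pi> (f z)"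
    and n: "card (\<pi> ` A) \<le> n"
  shows "\<pi> ((f ^^ fact n) x) = \<pi> ((f ^^ fact (card (\<pi> ` A))) x)"
    and "\<pi> ((f ^^ fact n) ((f ^^ fact n) x)) = \<pi> ((f ^^ fact n) x)"
proof -
  obtain i d where d: "1 \<le> d" "i + d \<le> card (\<pi> ` A)"
    and per: "\<And>a t. i \<le> a \<Longrightarrow> \<pi> ((f ^^ (a + t * d)) x) = \<pi> ((f ^^ a) x)"
    by (rule funpow_fibres_eventually_periodic[OF f x fin compat]) (assumption | rule that)+
  have i: "i \<le> fact m" and dvd: "d dvd fact m" if "card (\<pi> ` A) \<le> m" for m
    using that d fact_ge_self[of m] by (auto intro: dvd_fact)
  have mono: "(fact (card (\<pi> ` A)) :: nat) \<le> fact n" using n by (rule fact_mono)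
  then have "d dvd fact n - fact (card (\<pi> ` A))" using dvd n by (simp add: dvd_diff_nat)
  then obtain t where "fact n - fact (card (\<pi> ` A)) = t * d" by (metis dvdE mult.commute)
  then have "fact n = fact (card (\<pi> ` A)) + t * d" using mono by simp
  then show "\<pi> ((f ^^ fact n) x) = \<pi> ((f ^^ fact (card (\<pi> ` A))) x)"
    using per[OF i[OF order_refl]] by simp
  obtain s where "fact n = s * d" using dvd[OF n] by (metis dvdE mult.commute)
  then show "\<pi> ((f ^^ fact n) ((f ^^ fact n) x)) = \<pi> ((f ^^ fact n) x)"
    using per[OF i[OF n], of s] by (simp add: funpow_add)
qed

section \<open>Profinite modules over a compact ring\<close>

lemmas submodule_subset = submodule_facts(1)
  and submodule_zero_closed = submodule_facts(2)
  and submodule_smult_closed = submodule_facts(5)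

context left_module
begin

lemma smult_r_null [simp]: "a \<in> carrier R \<Longrightarrow> a \<odot>\<^bsub>M\<^esub> \<zero>\<^bsub>M\<^esub> = \<zero>\<^bsub>M\<^esub>"
  by (rule M.add_idem_zero) (simp_all flip: smult_r_distr)

lemma smult_l_null [simp]: "x \<in> carrier M \<Longrightarrow> \<zero>\<^bsub>R\<^esub> \<odot>\<^bsub>M\<^esub> x = \<zero>\<^bsub>M\<^esub>"
  by (rule M.add_idem_zero) (simp_all flip: smult_l_distr)

lemma smult_abelian_group_hom: "a \<in> carrier R \<Longrightarrow> abelian_group_hom M M (\<lambda>x. a \<odot>\<^bsub>M\<^esub> x)"
  by (rule additive_imp_abelian_group_hom) (auto simp: smult_r_distr M.abelian_group_axioms)

lemmas smult_r_minus = abelian_group_hom.hom_minus[OF smult_abelian_group_hom]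
  and smult_finsum = abelian_group_hom.hom_finsum[OF smult_abelian_group_hom]

lemma submodule_abelian_subgroup: "submodule L R M \<Longrightarrow> abelian_subgroup L M"
  by (intro abelian_subgroupI3 additive_subgroup.intro submodule.axioms(1) M.abelian_group_axioms)

lemma submodule_minus_closed: "submodule L R M \<Longrightarrow> x \<in> L \<Longrightarrow> y \<in> L \<Longrightarrow> x \<ominus>\<^bsub>M\<^esub> y \<in> L"
  unfolding a_minus_def by (intro submodule_facts(3)[of L] submodule_facts(4)[of L])

lemma submodule_carrier: "submodule (carrier M) R M"
  by (rule left_submoduleI) auto

lemma submodule_zero: "submodule {\<zero>\<^bsub>M\<^esub>} R M"
  by (rule left_submoduleI) auto

lemma submodule_Int: "submodule K R M \<Longrightarrow> submodule L R M \<Longrightarrow> submodule (K \<inter> L) R M"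
  by (rule left_submoduleI) (auto simp: submodule_facts dest: submodule_subset)

lemma rcos_smult_cong:
  assumes "submodule L R M" "a \<in> carrier R" "x \<in> carrier M" "y \<in> carrier M"
    and "L +>\<^bsub>M\<^esub> x = L +>\<^bsub>M\<^esub> y"
  shows "L +>\<^bsub>M\<^esub> (a \<odot>\<^bsub>M\<^esub> x) = L +>\<^bsub>M\<^esub> (a \<odot>\<^bsub>M\<^esub> y)"
proof -
  interpret L: abelian_subgroup L M by (rule submodule_abelian_subgroup[OF assms(1)])
  show ?thesis using assms submodule_smult_closed[OF assms(1,2), of "x \<ominus>\<^bsub>M\<^esub> y"]
    by (simp add: L.a_rcos_eq_iff smult_r_minus)
qed

definition translation_stabilizer :: "'m set \<Rightarrow> 'm set" where
  "translation_stabilizer C =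
    {x \<in> carrier M. \<forall>(r, v)\<in>carrier R \<times> C. r \<odot>\<^bsub>M\<^esub> x \<oplus>\<^bsub>M\<^esub> v \<in> C}"

lemma submodule_translation_stabilizer:
  assumes C: "C \<subseteq> carrier M"
  shows "submodule (translation_stabilizer C) R M"
proof (rule left_submoduleI)
  show "\<zero>\<^bsub>M\<^esub> \<in> translation_stabilizer C"
    using C by (auto simp: translation_stabilizer_def subset_iff)
  show "x \<oplus>\<^bsub>M\<^esub> y \<in> translation_stabilizer C"
    if "x \<in> translation_stabilizer C" "y \<in> translation_stabilizer C" for x y
  proof -
    have "r \<odot>\<^bsub>M\<^esub> (x \<oplus>\<^bsub>M\<^esub> y) \<oplus>\<^bsub>M\<^esub> v = r \<odot>\<^bsub>M\<^esub> x \<oplus>\<^bsub>M\<^esub> (r \<odot>\<^bsub>M\<^esub> y \<oplus>\<^bsub>M\<^esub> v)"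
      if "r \<in> carrier R" "v \<in> C" for r v
      using that C \<open>x \<in> _\<close> \<open>y \<in> _\<close>
      by (auto simp: translation_stabilizer_def smult_r_distr M.a_assoc)
    with that show ?thesis by (auto simp: translation_stabilizer_def)
  qed
  show "s \<odot>\<^bsub>M\<^esub> x \<in> translation_stabilizer C"
    if "s \<in> carrier R" "x \<in> translation_stabilizer C" for s x
    using that by (auto simp: translation_stabilizer_def simp flip: smult_assoc1)
qed (auto simp: translation_stabilizer_def)

lemma translation_stabilizer_subset: "\<zero>\<^bsub>M\<^esub> \<in> C \<Longrightarrow> translation_stabilizer C \<subseteq> C"
  by (force simp: translation_stabilizer_def dest: bspec[of _ _ "(\<one>\<^bsub>R\<^esub>, \<zero>\<^bsub>M\<^esub>)"])

end

lemma continuous_homD: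
  assumes "f \<in> continuous_hom R M N"
  shows continuous_hom_closed: "x \<in> carrier M \<Longrightarrow> f x \<in> carrier N"
    and continuous_hom_add: "x \<in> carrier M \<Longrightarrow> y \<in> carrier M \<Longrightarrow> f (x \<oplus>\<^bsub>M\<^esub> y) = f x \<oplus>\<^bsub>N\<^esub> f y"
    and continuous_hom_smult: "r \<in> carrier R \<Longrightarrow> x \<in> carrier M \<Longrightarrow> f (r \<odot>\<^bsub>M\<^esub> x) = r \<odot>\<^bsub>N\<^esub> f x"
    and continuous_hom_continuous: "continuous_map (mtopology M) (mtopology N) f"
  using assms by (auto simp: continuous_hom_def)

lemma continuous_hom_id: "(\<lambda>x. x) \<in> continuous_hom R M M"
  using continuous_map_id[of "mtopology M"] by (auto simp: continuous_hom_def id_def)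

lemma continuous_hom_compose:
  assumes "f \<in> continuous_hom R M N" "g \<in> continuous_hom R N P"
  shows "(\<lambda>x. g (f x)) \<in> continuous_hom R M P"
  using continuous_homD[OF assms(1)] continuous_homD[OF assms(2)]
    continuous_map_compose[of "mtopology M" "mtopology N" f "mtopology P" g]
  by (auto simp: continuous_hom_def o_def)

lemma continuous_hom_abelian_group_hom:
  "left_module R M \<Longrightarrow> left_module R N \<Longrightarrow> f \<in> continuous_hom R M N \<Longrightarrow> abelian_group_hom M N f"
  by (intro additive_imp_abelian_group_hom) (auto simp: left_module_def continuous_homD)

locale compact_ring_module = profinite_module R M
  for R :: "('r, 'a) top_ring_scheme" (structure) and M :: "('r, 'm, 'b) top_module_scheme" (structure) +
  assumes topspace_rtopology: "topspace (rtopology R) = carrier R"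
    and compact_ring: "compact_space (rtopology R)"
begin

abbreviation "Mtop \<equiv> mtopology M"
abbreviation "Rtop \<equiv> rtopology R"
abbreviation "End \<equiv> continuous_hom R M M"

lemma compact_M: "compact_space Mtop" and Hausdorff_M: "Hausdorff_space Mtop"
  using profinite_topology by (simp_all add: profinite_space_def)

lemma continuous_map_add:
  assumes "continuous_map X Mtop f" "continuous_map X Mtop g"
  shows "continuous_map X Mtop (\<lambda>x. f x \<oplus>\<^bsub>M\<^esub> g x)"
  using continuous_map_compose[OF continuous_map_pairedI[OF assms] continuous_add] by (simp add: o_def)

lemma continuous_map_smult:
  assumes "continuous_map X Rtop f" "continuous_map X Mtop g"
  shows "continuous_map X Mtop (\<lambda>x. f x \<odot>\<^bsub>M\<^esub> g x)"
  using continuous_map_compose[OF continuous_map_pairedI[OF assms] continuous_smult] by (simp add: o_def)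

lemma continuous_map_smult_const:
  "r \<in> carrier R \<Longrightarrow> continuous_map X Mtop f \<Longrightarrow> continuous_map X Mtop (\<lambda>x. r \<odot>\<^bsub>M\<^esub> f x)"
  by (intro continuous_map_smult) (simp_all add: topspace_rtopology)

lemma continuous_map_minus:
  assumes f: "continuous_map X Mtop f" and g: "continuous_map X Mtop g"
  shows "continuous_map X Mtop (\<lambda>x. f x \<ominus>\<^bsub>M\<^esub> g x)"
proof (rule continuous_map_eq)
  show "continuous_map X Mtop (\<lambda>x. f x \<oplus>\<^bsub>M\<^esub> (\<ominus>\<^bsub>R\<^esub> \<one>\<^bsub>R\<^esub>) \<odot>\<^bsub>M\<^esub> g x)"
    by (intro continuous_map_add f continuous_map_smult_const g) simp
  show "f x \<oplus>\<^bsub>M\<^esub> (\<ominus>\<^bsub>R\<^esub> \<one>\<^bsub>R\<^esub>) \<odot>\<^bsub>M\<^esub> g x = f x \<ominus>\<^bsub>M\<^esub> g x" if "x \<in> topspace X" for x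
    using funcset_mem[OF continuous_map_funspace[OF g] that]
    by (simp add: a_minus_def smult_minus_one topspace_mtopology)
qed

lemma continuous_map_finsum:
  assumes "finite I" "\<And>i. i \<in> I \<Longrightarrow> continuous_map X Mtop (f i)"
  shows "continuous_map X Mtop (\<lambda>x. \<Oplus>\<^bsub>M\<^esub>i\<in>I. f i x)"
  using assms
proof (induction I)
  case empty
  then show ?case by (simp add: topspace_mtopology)
next
  case (insert j I)
  show ?case
  proof (rule continuous_map_eq)
    show "continuous_map X Mtop (\<lambda>x. f j x \<oplus>\<^bsub>M\<^esub> (\<Oplus>\<^bsub>M\<^esub>i\<in>I. f i x))"
      using insert by (intro continuous_map_add) auto
    fix x assume "x \<in> topspace X"
    then have "f i x \<in> carrier M" if "i \<in> insert j I" for i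
      using continuous_map_funspace[OF insert.prems[OF that]] by (auto simp: topspace_mtopology)
    then show "f j x \<oplus>\<^bsub>M\<^esub> (\<Oplus>\<^bsub>M\<^esub>i\<in>I. f i x) = (\<Oplus>\<^bsub>M\<^esub>i\<in>insert j I. f i x)"
      using insert.hyps by (simp add: M.finsum_insert Pi_iff)
  qed
qed

lemma closedin_zero: "closedin Mtop {\<zero>\<^bsub>M\<^esub>}"
  using closedin_Hausdorff_singleton[OF Hausdorff_M] by (simp add: topspace_mtopology)

lemma rcos_eq_vimage:
  assumes "submodule L R M" "x \<in> carrier M"
  shows "L +>\<^bsub>M\<^esub> x = {u \<in> topspace Mtop. u \<ominus>\<^bsub>M\<^esub> x \<in> L}"
proof -
  interpret L: abelian_subgroup L M by (rule submodule_abelian_subgroup[OF assms(1)])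
  have "u \<in> L +>\<^bsub>M\<^esub> x \<longleftrightarrow> u \<in> carrier M \<and> u \<ominus>\<^bsub>M\<^esub> x \<in> L" for u
    using L.a_rcos_module[OF assms(2), of u] L.a_elemrcos_carrier[OF assms(2), of u]
    unfolding a_minus_def by blast
  then show ?thesis by (auto simp: topspace_mtopology)
qed

lemma continuous_map_minus_const:
  "x \<in> carrier M \<Longrightarrow> continuous_map Mtop Mtop (\<lambda>u. u \<ominus>\<^bsub>M\<^esub> x)"
  using continuous_map_id[of Mtop]
  by (intro continuous_map_minus) (simp_all add: topspace_mtopology id_def)

lemma openin_rcos: "submodule L R M \<Longrightarrow> openin Mtop L \<Longrightarrow> x \<in> carrier M \<Longrightarrow> openin Mtop (L +>\<^bsub>M\<^esub> x)"
  and closedin_rcos: "submodule L R M \<Longrightarrow> closedin Mtop L \<Longrightarrow> x \<in> carrier M \<Longrightarrow> closedin Mtop (L +>\<^bsub>M\<^esub> x)"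
  unfolding rcos_eq_vimage
  by (rule openin_continuous_map_preimage closedin_continuous_map_preimage,
      erule continuous_map_minus_const, assumption)+

lemma open_submodule_inside:
  assumes D: "openin Mtop D" and z: "\<zero>\<^bsub>M\<^esub> \<in> D"
  obtains L where "submodule L R M" "openin Mtop L" "L \<subseteq> D"
proof -
  obtain C where C: "openin Mtop C" "closedin Mtop C" "\<zero>\<^bsub>M\<^esub> \<in> C" "C \<subseteq> D"
    using profinite_space_clopen_neighbourhood[OF profinite_topology D z] by blast
  have CM: "C \<subseteq> carrier M" using openin_subset[OF C(1)] by (simp add: topspace_mtopology)
  have "compactin (prod_topology Rtop Mtop) (carrier R \<times> C)"
    using closedin_compact_space[OF compact_M C(2)] compact_ring topspace_rtopology
    by (simp add: compactin_Times compact_space_def)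
  moreover have "continuous_map (prod_topology Mtop (prod_topology Rtop Mtop)) Mtop
      (\<lambda>(x, r, v). r \<odot>\<^bsub>M\<^esub> x \<oplus>\<^bsub>M\<^esub> v)"
    unfolding case_prod_beta
    by (intro continuous_map_add continuous_map_smult continuous_map_fst
        continuous_map_fst_snd continuous_map_snd_snd)
  ultimately have "openin Mtop {x \<in> topspace Mtop. \<forall>p\<in>carrier R \<times> C.
      (\<lambda>(x, r, v). r \<odot>\<^bsub>M\<^esub> x \<oplus>\<^bsub>M\<^esub> v) (x, p) \<in> C}" (is "openin _ ?W")
    by (intro openin_forall_compactin[OF _ _ C(1)])
  also have "?W = translation_stabilizer C"
    by (auto simp: translation_stabilizer_def topspace_mtopology)
  finally have "openin Mtop (translation_stabilizer C)" .
  then show thesis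
    using that submodule_translation_stabilizer[OF CM] translation_stabilizer_subset[OF C(3)] C(4)
    by blast
qed

lemma rcosets_open_partition:
  assumes L: "submodule L R M" "openin Mtop L"
  shows finite_rcosets_open_submodule: "finite (a_rcosets\<^bsub>M\<^esub> L)"
    and closedin_open_submodule: "closedin Mtop L"
proof -
  interpret L: abelian_subgroup L M by (rule submodule_abelian_subgroup[OF L(1)])
  have part: "\<Union>(a_rcosets\<^bsub>M\<^esub> L) = topspace Mtop" "pairwise disjnt (a_rcosets\<^bsub>M\<^esub> L)"
    using L.a_rcosets_part_G L.a_rcos_disjoint by (simp_all add: topspace_mtopology)
  have op: "openin Mtop C" and ne: "C \<noteq> {}" if "C \<in> a_rcosets\<^bsub>M\<^esub> L" for C
    using that openin_rcos[OF L] L.a_rcos_self by (auto simp: A_RCOSETS_def')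
  show "finite (a_rcosets\<^bsub>M\<^esub> L)"
    by (rule compact_space_finite_open_partition[OF compact_M part op ne])
  show "closedin Mtop L"
    by (rule closedin_open_partition[OF part op L.a_subgroup_in_rcosets])
qed

lemma eq_if_rcos_eq:
  assumes xy: "x \<in> carrier M" "y \<in> carrier M"
    and eq: "\<And>L. submodule L R M \<Longrightarrow> openin Mtop L \<Longrightarrow> L +>\<^bsub>M\<^esub> x = L +>\<^bsub>M\<^esub> y"
  shows "x = y"
proof (rule ccontr)
  assume "x \<noteq> y"
  then have "x \<ominus>\<^bsub>M\<^esub> y \<noteq> \<zero>\<^bsub>M\<^esub>" using xy by (simp add: M.minus_eq_zero_iff)
  moreover have "openin Mtop (topspace Mtop - {x \<ominus>\<^bsub>M\<^esub> y})"
    using closedin_Hausdorff_singleton[OF Hausdorff_M, of "x \<ominus>\<^bsub>M\<^esub> y"] xy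
    by (intro openin_diff openin_topspace) (simp add: topspace_mtopology)
  ultimately obtain L where L: "submodule L R M" "openin Mtop L" "L \<subseteq> topspace Mtop - {x \<ominus>\<^bsub>M\<^esub> y}"
    using open_submodule_inside[of "topspace Mtop - {x \<ominus>\<^bsub>M\<^esub> y}"] by (auto simp: topspace_mtopology)
  interpret L: abelian_subgroup L M by (rule submodule_abelian_subgroup[OF L(1)])
  show False using eq[OF L(1,2)] L(3) xy by (auto simp: L.a_rcos_eq_iff)
qed

lemma submodule_vimage:
  fixes N :: "('r, 'n, 'c) top_module_scheme"
  assumes f: "f \<in> continuous_hom R M N" and N: "left_module R N" and L: "submodule L R N"
  shows "submodule {x \<in> carrier M. f x \<in> L} R M"
proof -
  interpret f: abelian_group_hom M N f
    by (rule continuous_hom_abelian_group_hom[OF left_module_axioms N f])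
  show ?thesis
    by (rule left_submoduleI)
      (use L in \<open>auto simp: continuous_hom_smult[OF f] submodule_facts\<close>)
qed

end

section \<open>Finitely generated profinite modules\<close>

locale fg_profinite_module = compact_ring_module R M
  for R :: "('r, 'a) top_ring_scheme" (structure) and M :: "('r, 'm, 'b) top_module_scheme" (structure) +
  assumes finitely_generated: "finitely_generated_module R M"

context compact_ring_module
begin

lemma continuous_map_linear_combination:
  assumes "finite X" "f \<in> X \<rightarrow> carrier M"
  shows "continuous_map (product_topology (\<lambda>_. Rtop) X) Mtop (\<lambda>r. \<Oplus>\<^bsub>M\<^esub>x\<in>X. r x \<odot>\<^bsub>M\<^esub> f x)"
  using assms
  by (intro continuous_map_finsum continuous_map_smult continuous_map_product_projection)
    (auto simp: topspace_mtopology)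

lemma submodule_linear_combinations:
  assumes X: "finite X" "X \<subseteq> carrier M"
  shows "submodule ((\<lambda>r. \<Oplus>\<^bsub>M\<^esub>x\<in>X. r x \<odot>\<^bsub>M\<^esub> x) ` (X \<rightarrow>\<^sub>E carrier R)) R M"
    (is "submodule (?f ` ?A) R M")
proof (rule left_submoduleI)
  have closed: "r x \<odot>\<^bsub>M\<^esub> x \<in> carrier M" if "r \<in> ?A" "x \<in> X" for r x
    using that X by (auto intro!: smult_closed)
  show "?f ` ?A \<subseteq> carrier M" using closed by (auto intro!: M.finsum_closed)
  have "?f (\<lambda>x\<in>X. \<zero>) = (\<Oplus>\<^bsub>M\<^esub>x\<in>X. \<zero>\<^bsub>M\<^esub>)"
    by (rule M.finsum_cong') (use X in \<open>auto simp: subset_iff\<close>)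
  then show "\<zero>\<^bsub>M\<^esub> \<in> ?f ` ?A" by (intro image_eqI[of _ _ "\<lambda>x\<in>X. \<zero>"]) auto
  fix u assume "u \<in> ?f ` ?A"
  then obtain r where r: "r \<in> ?A" "u = ?f r" by blast
  show "u \<oplus>\<^bsub>M\<^esub> v \<in> ?f ` ?A" if "v \<in> ?f ` ?A" for v
  proof -
    obtain s where s: "s \<in> ?A" "v = ?f s" using \<open>v \<in> ?f ` ?A\<close> by blast
    have "?f (\<lambda>x\<in>X. r x \<oplus> s x) = (\<Oplus>\<^bsub>M\<^esub>x\<in>X. r x \<odot>\<^bsub>M\<^esub> x \<oplus>\<^bsub>M\<^esub> s x \<odot>\<^bsub>M\<^esub> x)"
      by (rule M.finsum_cong') (use X r s closed in \<open>auto intro!: smult_l_distr\<close>)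
    also have "\<dots> = u \<oplus>\<^bsub>M\<^esub> v" unfolding r(2) s(2) using closed r s by (intro M.finsum_addf) auto
    finally show ?thesis using r s by (intro image_eqI[of _ _ "\<lambda>x\<in>X. r x \<oplus> s x"]) auto
  qed
  show "a \<odot>\<^bsub>M\<^esub> u \<in> ?f ` ?A" if a: "a \<in> carrier R" for a
  proof -
    have "?f (\<lambda>x\<in>X. a \<otimes> r x) = (\<Oplus>\<^bsub>M\<^esub>x\<in>X. a \<odot>\<^bsub>M\<^esub> (r x \<odot>\<^bsub>M\<^esub> x))"
      by (rule M.finsum_cong') (use X r a closed in \<open>auto intro!: smult_assoc1\<close>)
    also have "\<dots> = a \<odot>\<^bsub>M\<^esub> u" unfolding r(2) using closed r by (intro smult_finsum[symmetric] a) auto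
    finally show ?thesis using r a by (intro image_eqI[of _ _ "\<lambda>x\<in>X. a \<otimes> r x"]) auto
  qed
qed

end

context fg_profinite_module
begin

lemma finite_spanning_set:
  obtains X where "finite X" "X \<subseteq> carrier M"
    "(\<lambda>r. \<Oplus>\<^bsub>M\<^esub>x\<in>X. r x \<odot>\<^bsub>M\<^esub> x) ` (X \<rightarrow>\<^sub>E carrier R) = carrier M"
proof -
  obtain X where X: "finite X" "X \<subseteq> carrier M"
    "\<And>N. submodule N R M \<Longrightarrow> closedin Mtop N \<Longrightarrow> X \<subseteq> N \<Longrightarrow> N = carrier M"
    using finitely_generated unfolding finitely_generated_module_def by blast
  let ?f = "\<lambda>r. \<Oplus>\<^bsub>M\<^esub>x\<in>X. r x \<odot>\<^bsub>M\<^esub> x" and ?P = "product_topology (\<lambda>_. Rtop) X"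
  have "compactin Mtop (?f ` topspace ?P)"
    by (rule image_compactin[OF _ continuous_map_linear_combination])
      (use X compact_ring in \<open>auto simp: compact_space_product_topology simp flip: compact_space_def
          topspace_product_topology\<close>)
  then have "closedin Mtop (?f ` (X \<rightarrow>\<^sub>E carrier R))"
    using compactin_imp_closedin[OF Hausdorff_M] by (simp add: topspace_rtopology)
  moreover have "x \<in> ?f ` (X \<rightarrow>\<^sub>E carrier R)" if x: "x \<in> X" for x
  proof (rule image_eqI)
    have "?f (\<lambda>y\<in>X. if x = y then \<one> else \<zero>) = (\<Oplus>\<^bsub>M\<^esub>y\<in>X. if x = y then y else \<zero>\<^bsub>M\<^esub>)"
      by (rule M.finsum_cong') (use X in \<open>auto simp: subset_iff\<close>)
    also have "\<dots> = x" by (rule M.finsum_singleton[OF x X(1)]) (use X in auto)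
    finally show "x = ?f (\<lambda>y\<in>X. if x = y then \<one> else \<zero>)" by simp
  qed auto
  ultimately have "?f ` (X \<rightarrow>\<^sub>E carrier R) = carrier M"
    by (intro X(3) submodule_linear_combinations X(1,2) subsetI)
  then show thesis by (rule that[OF X(1,2)])
qed

lemma linear_imp_continuous:
  fixes N :: "('r, 'n, 'c) top_module_scheme"
  assumes N: "compact_ring_module R N" and f: "f \<in> carrier M \<rightarrow> carrier N"
    and add: "\<And>x y. x \<in> carrier M \<Longrightarrow> y \<in> carrier M \<Longrightarrow> f (x \<oplus>\<^bsub>M\<^esub> y) = f x \<oplus>\<^bsub>N\<^esub> f y"
    and smult: "\<And>r x. r \<in> carrier R \<Longrightarrow> x \<in> carrier M \<Longrightarrow> f (r \<odot>\<^bsub>M\<^esub> x) = r \<odot>\<^bsub>N\<^esub> f x"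
  shows "f \<in> continuous_hom R M N"
proof -
  interpret N: compact_ring_module R N by fact
  interpret f: abelian_group_hom M N f
    by (rule additive_imp_abelian_group_hom[OF M.abelian_group_axioms N.M.abelian_group_axioms f add])
  obtain X where X: "finite X" "X \<subseteq> carrier M"
    and span: "(\<lambda>r. \<Oplus>\<^bsub>M\<^esub>x\<in>X. r x \<odot>\<^bsub>M\<^esub> x) ` (X \<rightarrow>\<^sub>E carrier R) = carrier M"
    by (rule finite_spanning_set)
  let ?P = "product_topology (\<lambda>_. Rtop) X" and ?\<pi> = "\<lambda>r. \<Oplus>\<^bsub>M\<^esub>x\<in>X. r x \<odot>\<^bsub>M\<^esub> x"
  have "quotient_map ?P Mtop ?\<pi>"
    by (rule continuous_imp_quotient_map[OF continuous_map_linear_combination])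
      (use X span compact_ring Hausdorff_M in
        \<open>auto simp: compact_space_product_topology topspace_rtopology topspace_mtopology\<close>)
  moreover have "continuous_map ?P N.Mtop (f \<circ> ?\<pi>)"
  proof (rule continuous_map_eq)
    show "continuous_map ?P N.Mtop (\<lambda>r. \<Oplus>\<^bsub>N\<^esub>x\<in>X. r x \<odot>\<^bsub>N\<^esub> f x)"
      by (rule N.continuous_map_linear_combination) (use X in auto)
    fix r assume r: "r \<in> topspace ?P"
    then have closed: "r x \<in> carrier R" if "x \<in> X" for x using that by (auto simp: topspace_rtopology)
    have "f (?\<pi> r) = (\<Oplus>\<^bsub>N\<^esub>x\<in>X. f (r x \<odot>\<^bsub>M\<^esub> x))"
      by (rule f.hom_finsum) (use closed X in auto)
    also have "\<dots> = (\<Oplus>\<^bsub>N\<^esub>x\<in>X. r x \<odot>\<^bsub>N\<^esub> f x)"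
      by (rule N.M.finsum_cong') (use closed X smult in auto)
    finally show "(\<Oplus>\<^bsub>N\<^esub>x\<in>X. r x \<odot>\<^bsub>N\<^esub> f x) = (f \<circ> ?\<pi>) r" by simp
  qed
  ultimately have "continuous_map Mtop N.Mtop f" by (rule continuous_compose_quotient_map)
  then show ?thesis using f add smult by (simp add: continuous_hom_def)
qed

lemma EndI:
  assumes "\<And>x. x \<in> carrier M \<Longrightarrow> \<theta> x \<in> carrier M"
    "\<And>x y. x \<in> carrier M \<Longrightarrow> y \<in> carrier M \<Longrightarrow> \<theta> (x \<oplus>\<^bsub>M\<^esub> y) = \<theta> x \<oplus>\<^bsub>M\<^esub> \<theta> y"
    "\<And>r x. r \<in> carrier R \<Longrightarrow> x \<in> carrier M \<Longrightarrow> \<theta> (r \<odot>\<^bsub>M\<^esub> x) = r \<odot>\<^bsub>M\<^esub> \<theta> x"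
  shows "\<theta> \<in> End"
  using assms by (intro linear_imp_continuous compact_ring_module_axioms) auto

end

section \<open>Endomorphisms of finitely generated profinite modules\<close>

context fg_profinite_module
begin

lemma End_abelian_group_hom: "\<theta> \<in> End \<Longrightarrow> abelian_group_hom M M \<theta>"
  by (rule continuous_hom_abelian_group_hom[OF left_module_axioms left_module_axioms])

lemmas End_zero = abelian_group_hom.hom_zero[OF End_abelian_group_hom]
  and End_minus = abelian_group_hom.hom_minus[OF End_abelian_group_hom]

lemma End_add: "\<theta> \<in> End \<Longrightarrow> \<eta> \<in> End \<Longrightarrow> (\<lambda>x. \<theta> x \<oplus>\<^bsub>M\<^esub> \<eta> x) \<in> End"
  by (rule EndI) (simp_all add: continuous_homD M.a_ac smult_r_distr)

lemma End_id_minus: "\<theta> \<in> End \<Longrightarrow> (\<lambda>x. x \<ominus>\<^bsub>M\<^esub> \<theta> x) \<in> End"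
  by (rule EndI) (simp_all add: continuous_homD M.add_minus_add_eq smult_r_minus)

lemma End_finsum:
  assumes "finite I" "\<And>i. i \<in> I \<Longrightarrow> \<theta> i \<in> End"
  shows "(\<lambda>x. \<Oplus>\<^bsub>M\<^esub>i\<in>I. \<theta> i x) \<in> End"
  using assms
proof (induction I)
  case empty
  show ?case by (rule EndI) simp_all
next
  case (insert j I)
  have "(\<lambda>x. \<theta> j x \<oplus>\<^bsub>M\<^esub> (\<Oplus>\<^bsub>M\<^esub>i\<in>I. \<theta> i x)) \<in> End"
    using insert by (intro End_add) auto
  moreover have "(\<Oplus>\<^bsub>M\<^esub>i\<in>insert j I. \<theta> i x) = \<theta> j x \<oplus>\<^bsub>M\<^esub> (\<Oplus>\<^bsub>M\<^esub>i\<in>I. \<theta> i x)" if "x \<in> carrier M" for x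
    using that insert.hyps continuous_hom_closed[OF insert.prems] by (intro M.finsum_insert) auto
  ultimately show ?case
    using continuous_homD[of "\<lambda>x. \<theta> j x \<oplus>\<^bsub>M\<^esub> (\<Oplus>\<^bsub>M\<^esub>i\<in>I. \<theta> i x)" R M M] by (intro EndI) simp_all
qed

lemma End_funpow: "\<theta> \<in> End \<Longrightarrow> \<theta> ^^ n \<in> End"
proof (induction n)
  case 0
  show ?case using continuous_hom_id by (simp add: id_def)
next
  case (Suc n)
  then show ?case using continuous_hom_compose[of "\<theta> ^^ n" R M M \<theta> M] by (simp add: o_def)
qed

definition fully_invariant :: "'m set \<Rightarrow> bool" where
  "fully_invariant L \<longleftrightarrow> submodule L R M \<and> openin Mtop L \<and> (\<forall>\<theta>\<in>End. \<forall>x\<in>L. \<theta> x \<in> L)"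

lemma fully_invariantD:
  assumes "fully_invariant L"
  shows fully_invariant_submodule: "submodule L R M"
    and fully_invariant_open: "openin Mtop L"
    and fully_invariant_image: "\<theta> \<in> End \<Longrightarrow> x \<in> L \<Longrightarrow> \<theta> x \<in> L"
    and fully_invariant_abelian_subgroup: "abelian_subgroup L M"
  using assms submodule_abelian_subgroup by (auto simp: fully_invariant_def)

lemma End_rcos_eq_if_eq_on_generators:
  assumes W: "submodule W R M" and \<theta>: "\<theta> \<in> End" and \<eta>: "\<eta> \<in> End"
    and X: "X \<subseteq> carrier M" and r: "r \<in> X \<rightarrow> carrier R"
    and eq: "\<And>x. x \<in> X \<Longrightarrow> W +>\<^bsub>M\<^esub> \<theta> x = W +>\<^bsub>M\<^esub> \<eta> x"
  shows "W +>\<^bsub>M\<^esub> \<theta> (\<Oplus>\<^bsub>M\<^esub>x\<in>X. r x \<odot>\<^bsub>M\<^esub> x) = W +>\<^bsub>M\<^esub> \<eta> (\<Oplus>\<^bsub>M\<^esub>x\<in>X. r x \<odot>\<^bsub>M\<^esub> x)"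
proof -
  interpret W: abelian_subgroup W M by (rule submodule_abelian_subgroup[OF W])
  interpret \<theta>: abelian_group_hom M M \<theta> by (rule End_abelian_group_hom[OF \<theta>])
  interpret \<eta>: abelian_group_hom M M \<eta> by (rule End_abelian_group_hom[OF \<eta>])
  have rX: "r x \<in> carrier R" "x \<in> carrier M" if "x \<in> X" for x using r X that by auto
  have "W +>\<^bsub>M\<^esub> (\<Oplus>\<^bsub>M\<^esub>x\<in>X. \<theta> (r x \<odot>\<^bsub>M\<^esub> x)) = W +>\<^bsub>M\<^esub> (\<Oplus>\<^bsub>M\<^esub>x\<in>X. \<eta> (r x \<odot>\<^bsub>M\<^esub> x))"
  proof (rule W.a_rcos_finsum_cong)
    show "W +>\<^bsub>M\<^esub> \<theta> (r x \<odot>\<^bsub>M\<^esub> x) = W +>\<^bsub>M\<^esub> \<eta> (r x \<odot>\<^bsub>M\<^esub> x)" if "x \<in> X" for x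
      using rcos_smult_cong[OF W] eq[OF that] rX[OF that] continuous_homD[OF \<theta>] continuous_homD[OF \<eta>]
      by simp
  qed (use rX in auto)
  moreover have "(\<lambda>x. r x \<odot>\<^bsub>M\<^esub> x) \<in> X \<rightarrow> carrier M" using rX by auto
  ultimately show ?thesis by (simp only: \<theta>.hom_finsum \<eta>.hom_finsum)
qed

text \<open>An endomorphism is determined modulo \<open>W\<close> by its values on a finite spanning set, so only finitely
  many different preimages of \<open>W\<close> occur.\<close>

lemma finite_End_vimages:
  assumes W: "submodule W R M" "openin Mtop W"
  shows "finite ((\<lambda>\<theta>. {x \<in> carrier M. \<theta> x \<in> W}) ` End)"
proof -
  interpret W: abelian_subgroup W M by (rule submodule_abelian_subgroup[OF W(1)])
  obtain X where X: "finite X" "X \<subseteq> carrier M"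
    and span: "(\<lambda>r. \<Oplus>\<^bsub>M\<^esub>x\<in>X. r x \<odot>\<^bsub>M\<^esub> x) ` (X \<rightarrow>\<^sub>E carrier R) = carrier M"
    by (rule finite_spanning_set)
  let ?values = "\<lambda>\<theta>. \<lambda>x\<in>X. W +>\<^bsub>M\<^esub> \<theta> x"
  have "finite (?values ` End)"
  proof (rule finite_subset)
    have "W +>\<^bsub>M\<^esub> \<theta> x \<in> a_rcosets\<^bsub>M\<^esub> W" if "\<theta> \<in> End" "x \<in> X" for \<theta> x
      using that X by (intro M.a_rcosetsI W.a_subset continuous_hom_closed[OF that(1)]) auto
    then show "?values ` End \<subseteq> X \<rightarrow>\<^sub>E a_rcosets\<^bsub>M\<^esub> W" by auto
    show "finite (X \<rightarrow>\<^sub>E a_rcosets\<^bsub>M\<^esub> W)"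
      using X finite_rcosets_open_submodule[OF W] by (simp add: finite_PiE)
  qed
  moreover have "{x \<in> carrier M. \<theta> x \<in> W} = {x \<in> carrier M. \<eta> x \<in> W}"
    if "\<theta> \<in> End" "\<eta> \<in> End" "?values \<theta> = ?values \<eta>" for \<theta> \<eta>
  proof (intro Collect_cong conj_cong refl)
    fix y assume y: "y \<in> carrier M"
    then have "y \<in> (\<lambda>r. \<Oplus>\<^bsub>M\<^esub>x\<in>X. r x \<odot>\<^bsub>M\<^esub> x) ` (X \<rightarrow>\<^sub>E carrier R)" by (simp only: span)
    then obtain r where r: "r \<in> X \<rightarrow>\<^sub>E carrier R" "y = (\<Oplus>\<^bsub>M\<^esub>x\<in>X. r x \<odot>\<^bsub>M\<^esub> x)" by blast
    have "W +>\<^bsub>M\<^esub> \<theta> x = W +>\<^bsub>M\<^esub> \<eta> x" if "x \<in> X" for x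
      using fun_cong[OF \<open>?values \<theta> = ?values \<eta>\<close>, of x] that by simp
    then have "W +>\<^bsub>M\<^esub> \<theta> y = W +>\<^bsub>M\<^esub> \<eta> y"
      unfolding r(2) using r(1)
      by (intro End_rcos_eq_if_eq_on_generators[OF W(1) that(1,2) X(2)]) auto
    then show "\<theta> y \<in> W \<longleftrightarrow> \<eta> y \<in> W"
      using y W.a_rcos_eq_self_iff[of "\<theta> y"] W.a_rcos_eq_self_iff[of "\<eta> y"]
        continuous_hom_closed[OF that(1)] continuous_hom_closed[OF that(2)] by simp
  qed
  ultimately show ?thesis by (rule finite_image_if_factors)
qed

lemma fully_invariant_inside:
  assumes D: "openin Mtop D" "\<zero>\<^bsub>M\<^esub> \<in> D"
  obtains L where "fully_invariant L" "L \<subseteq> D"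
proof -
  obtain W where W: "submodule W R M" "openin Mtop W" "W \<subseteq> D" by (rule open_submodule_inside[OF D])
  define L where "L = (\<Inter>\<theta>\<in>End. {x \<in> carrier M. \<theta> x \<in> W})"
  have id: "(\<lambda>x. x) \<in> End" by (rule continuous_hom_id)
  have "L \<subseteq> W" using id by (auto simp: L_def)
  moreover have "fully_invariant L"
    unfolding fully_invariant_def
  proof (intro conjI ballI)
    have preim: "submodule {x \<in> carrier M. \<theta> x \<in> W} R M" if "\<theta> \<in> End" for \<theta>
      by (rule submodule_vimage[OF that left_module_axioms W(1)])
    show "submodule L R M"
      by (rule left_submoduleI)
        (use id submodule_facts[OF preim] in \<open>auto simp: L_def\<close>)
    have "openin Mtop {x \<in> carrier M. \<theta> x \<in> W}" if "\<theta> \<in> End" for \<theta>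
      using openin_continuous_map_preimage[OF continuous_hom_continuous[OF that] W(2)]
      by (simp add: topspace_mtopology)
    then show "openin Mtop L"
      unfolding L_def using id by (intro openin_Inter finite_End_vimages W(1,2)) auto
    fix \<theta> x assume "\<theta> \<in> End" "x \<in> L"
    then show "\<theta> x \<in> L"
      using continuous_hom_compose[of \<theta> R M M _ M] continuous_hom_closed[of \<theta> R M M]
      by (auto simp: L_def)
  qed
  ultimately show thesis using that W(3) by blast
qed

lemma fully_invariant_carrier: "fully_invariant (carrier M)"
  using submodule_carrier openin_topspace[of Mtop]
  by (auto simp: fully_invariant_def topspace_mtopology continuous_hom_closed)

lemma fully_invariant_Int: "fully_invariant K \<Longrightarrow> fully_invariant L \<Longrightarrow> fully_invariant (K \<inter> L)"
  by (simp add: fully_invariant_def submodule_Int openin_Int)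

lemma fully_invariant_Inter_nonempty:
  assumes "\<And>L. fully_invariant L \<Longrightarrow> closedin Mtop (C L)" "\<And>L. fully_invariant L \<Longrightarrow> C L \<noteq> {}"
    and mono: "\<And>K L. fully_invariant K \<Longrightarrow> fully_invariant L \<Longrightarrow> K \<subseteq> L \<Longrightarrow> C K \<subseteq> C L"
  shows "\<exists>x. \<forall>L. fully_invariant L \<longrightarrow> x \<in> C L"
proof -
  have "(\<Inter>L\<in>Collect fully_invariant. C L) \<noteq> {}"
  proof (rule compact_space_directed_Inter[OF compact_M])
    show "Collect fully_invariant \<noteq> {}" using fully_invariant_carrier by blast
    fix K L assume "K \<in> Collect fully_invariant" "L \<in> Collect fully_invariant"
    then have "fully_invariant (K \<inter> L)" "C (K \<inter> L) \<subseteq> C K \<inter> C L"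
      using mono[of "K \<inter> L"] fully_invariant_Int by auto
    then show "\<exists>N\<in>Collect fully_invariant. C N \<subseteq> C K \<inter> C L" by blast
  qed (use assms in auto)
  then show ?thesis by blast
qed

lemma fully_invariant_rcos_mono:
  assumes "fully_invariant K" "fully_invariant L" "K \<subseteq> L" "x \<in> carrier M" "y \<in> carrier M"
    and "K +>\<^bsub>M\<^esub> x = K +>\<^bsub>M\<^esub> y"
  shows "L +>\<^bsub>M\<^esub> x = L +>\<^bsub>M\<^esub> y"
  using abelian_subgroup.a_rcos_mono[OF fully_invariant_abelian_subgroup[OF assms(1)]
      fully_invariant_abelian_subgroup[OF assms(2)] assms(3-6)] .

lemma eq_if_fully_invariant_rcos_eq:
  assumes xy: "x \<in> carrier M" "y \<in> carrier M"
    and eq: "\<And>L. fully_invariant L \<Longrightarrow> L +>\<^bsub>M\<^esub> x = L +>\<^bsub>M\<^esub> y"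
  shows "x = y"
proof (rule eq_if_rcos_eq[OF xy])
  fix W assume W: "submodule W R M" "openin Mtop W"
  then obtain L where L: "fully_invariant L" "L \<subseteq> W"
    using fully_invariant_inside submodule_zero_closed by metis
  then show "W +>\<^bsub>M\<^esub> x = W +>\<^bsub>M\<^esub> y"
    using abelian_subgroup.a_rcos_mono[OF _ submodule_abelian_subgroup[OF W(1)] L(2) xy] eq
      fully_invariant_abelian_subgroup by blast
qed

lemma zero_if_fully_invariant:
  assumes "x \<in> carrier M" "\<And>L. fully_invariant L \<Longrightarrow> x \<in> L"
  shows "x = \<zero>\<^bsub>M\<^esub>"
proof (rule eq_if_fully_invariant_rcos_eq[OF assms(1) M.zero_closed])
  fix L assume L: "fully_invariant L"
  interpret L: abelian_subgroup L M by (rule fully_invariant_abelian_subgroup[OF L])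
  show "L +>\<^bsub>M\<^esub> x = L +>\<^bsub>M\<^esub> \<zero>\<^bsub>M\<^esub>" using assms(2)[OF L] by (simp add: L.a_rcos_const)
qed

lemma End_rcos_cong:
  assumes L: "fully_invariant L" and \<theta>: "\<theta> \<in> End" and xy: "x \<in> carrier M" "y \<in> carrier M"
    and eq: "L +>\<^bsub>M\<^esub> x = L +>\<^bsub>M\<^esub> y"
  shows "L +>\<^bsub>M\<^esub> \<theta> x = L +>\<^bsub>M\<^esub> \<theta> y"
proof -
  interpret L: abelian_subgroup L M by (rule fully_invariant_abelian_subgroup[OF L])
  show ?thesis
    using eq xy fully_invariant_image[OF L \<theta>, of "x \<ominus>\<^bsub>M\<^esub> y"]
    by (simp add: L.a_rcos_eq_iff continuous_hom_closed[OF \<theta>] End_minus[OF \<theta>])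
qed

lemma funpow_fact_rcos_stable:
  assumes L: "fully_invariant L" and \<theta>: "\<theta> \<in> End" and x: "x \<in> carrier M"
  shows funpow_fact_rcos_eventually_const:
      "\<exists>z\<in>carrier M. \<forall>\<^sub>F n in sequentially. L +>\<^bsub>M\<^esub> (\<theta> ^^ fact n) x = L +>\<^bsub>M\<^esub> z"
    and funpow_fact_rcos_idempotent:
      "\<forall>\<^sub>F n in sequentially. L +>\<^bsub>M\<^esub> (\<theta> ^^ fact n) ((\<theta> ^^ fact n) x) = L +>\<^bsub>M\<^esub> (\<theta> ^^ fact n) x"
proof -
  let ?index = "card ((\<lambda>y. L +>\<^bsub>M\<^esub> y) ` carrier M)"
  have "(\<lambda>y. L +>\<^bsub>M\<^esub> y) ` carrier M = a_rcosets\<^bsub>M\<^esub> L" by (auto simp: A_RCOSETS_def')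
  then have "finite ((\<lambda>y. L +>\<^bsub>M\<^esub> y) ` carrier M)"
    using finite_rcosets_open_submodule fully_invariant_submodule[OF L] fully_invariant_open[OF L] by simp
  note stable = funpow_fact_fibres_stable[OF _ x this End_rcos_cong[OF L \<theta>]]
  have \<theta>_maps: "\<theta> \<in> carrier M \<rightarrow> carrier M" using continuous_hom_closed[OF \<theta>] by blast
  have "\<forall>\<^sub>F n in sequentially. L +>\<^bsub>M\<^esub> (\<theta> ^^ fact n) x = L +>\<^bsub>M\<^esub> (\<theta> ^^ fact ?index) x"
    using eventually_ge_at_top[of ?index] by eventually_elim (rule stable(1)[OF \<theta>_maps])
  then show "\<exists>z\<in>carrier M. \<forall>\<^sub>F n in sequentially. L +>\<^bsub>M\<^esub> (\<theta> ^^ fact n) x = L +>\<^bsub>M\<^esub> z"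
    using continuous_hom_closed[OF End_funpow[OF \<theta>] x] by blast
  show "\<forall>\<^sub>F n in sequentially. L +>\<^bsub>M\<^esub> (\<theta> ^^ fact n) ((\<theta> ^^ fact n) x) = L +>\<^bsub>M\<^esub> (\<theta> ^^ fact n) x"
    using eventually_ge_at_top[of ?index] by eventually_elim (rule stable(2)[OF \<theta>_maps])
qed

lemma funpow_fact_limit:
  assumes \<theta>: "\<theta> \<in> End" and x: "x \<in> carrier M"
  obtains y where "y \<in> carrier M"
    "\<And>L. fully_invariant L \<Longrightarrow> \<forall>\<^sub>F n in sequentially. L +>\<^bsub>M\<^esub> (\<theta> ^^ fact n) x = L +>\<^bsub>M\<^esub> y"
proof -
  define C where "C L = {y \<in> carrier M. \<forall>\<^sub>F n in sequentially. L +>\<^bsub>M\<^esub> (\<theta> ^^ fact n) x = L +>\<^bsub>M\<^esub> y}" for L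
  have closed: "(\<theta> ^^ n) x \<in> carrier M" for n by (rule continuous_hom_closed[OF End_funpow[OF \<theta>] x])
  have C_rcos: "\<exists>z\<in>carrier M. C L = L +>\<^bsub>M\<^esub> z" if L: "fully_invariant L" for L
  proof -
    interpret L: abelian_subgroup L M by (rule fully_invariant_abelian_subgroup[OF L])
    obtain z where z: "z \<in> carrier M" "\<forall>\<^sub>F n in sequentially. L +>\<^bsub>M\<^esub> (\<theta> ^^ fact n) x = L +>\<^bsub>M\<^esub> z"
      using funpow_fact_rcos_eventually_const[OF L \<theta> x] by blast
    have "(\<forall>\<^sub>F n in sequentially. L +>\<^bsub>M\<^esub> (\<theta> ^^ fact n) x = L +>\<^bsub>M\<^esub> y) \<longleftrightarrow>
        (\<forall>\<^sub>F n in sequentially. L +>\<^bsub>M\<^esub> z = L +>\<^bsub>M\<^esub> y)" for y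
      by (rule eventually_subst[OF eventually_mono[OF z(2)]]) simp
    moreover have "y \<in> L +>\<^bsub>M\<^esub> z \<longleftrightarrow> y \<in> carrier M \<and> L +>\<^bsub>M\<^esub> z = L +>\<^bsub>M\<^esub> y" for y
      using L.a_repr_independence'[of y z] L.a_repr_independenceD[of y z]
        L.a_elemrcos_carrier[of z y] z(1)
      by blast
    ultimately have "C L = L +>\<^bsub>M\<^esub> z" by (auto simp: C_def)
    then show ?thesis using z(1) by blast
  qed
  have "\<exists>y. \<forall>L. fully_invariant L \<longrightarrow> y \<in> C L"
  proof (rule fully_invariant_Inter_nonempty)
    fix L assume L: "fully_invariant L"
    obtain z where z: "z \<in> carrier M" "C L = L +>\<^bsub>M\<^esub> z" using C_rcos[OF L] by blast
    show "closedin Mtop (C L)"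
      unfolding z(2) using fully_invariant_submodule[OF L] fully_invariant_open[OF L] z(1)
      by (intro closedin_rcos closedin_open_submodule)
    show "C L \<noteq> {}"
      unfolding z(2)
      using abelian_subgroup.a_rcos_self[OF fully_invariant_abelian_subgroup[OF L] z(1)] by blast
  next
    fix K L assume KL: "fully_invariant K" "fully_invariant L" "K \<subseteq> L"
    show "C K \<subseteq> C L"
      using fully_invariant_rcos_mono[OF KL closed] by (auto simp: C_def elim!: eventually_mono)
  qed
  then show thesis using that fully_invariant_carrier by (auto simp: C_def)
qed

lemma End_limit:
  assumes f: "\<And>n. f n \<in> End" and e: "\<And>x. x \<in> carrier M \<Longrightarrow> e x \<in> carrier M"
    and lim: "\<And>L x. fully_invariant L \<Longrightarrow> x \<in> carrier M \<Longrightarrow>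
      \<forall>\<^sub>F n in sequentially. L +>\<^bsub>M\<^esub> f n x = L +>\<^bsub>M\<^esub> e x"
  shows "e \<in> End"
proof (rule EndI[OF e])
  note f = continuous_homD[OF f]
  show "e (x \<oplus>\<^bsub>M\<^esub> y) = e x \<oplus>\<^bsub>M\<^esub> e y" if x: "x \<in> carrier M" and y: "y \<in> carrier M" for x y
  proof (rule eq_if_fully_invariant_rcos_eq)
    fix L assume L: "fully_invariant L"
    interpret L: abelian_subgroup L M by (rule fully_invariant_abelian_subgroup[OF L])
    have "\<forall>\<^sub>F n in sequentially. L +>\<^bsub>M\<^esub> e (x \<oplus>\<^bsub>M\<^esub> y) = L +>\<^bsub>M\<^esub> (e x \<oplus>\<^bsub>M\<^esub> e y)"
      using lim[OF L x] lim[OF L y] lim[OF L M.a_closed[OF x y]]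
    proof eventually_elim
      case (elim n)
      then show ?case using L.a_rcos_add_cong[OF f(1)[OF x] e[OF x] f(1)[OF y] e[OF y]] f(2)[OF x y]
        by simp
    qed
    then show "L +>\<^bsub>M\<^esub> e (x \<oplus>\<^bsub>M\<^esub> y) = L +>\<^bsub>M\<^esub> (e x \<oplus>\<^bsub>M\<^esub> e y)" by simp
  qed (use x y e in auto)
  show "e (r \<odot>\<^bsub>M\<^esub> x) = r \<odot>\<^bsub>M\<^esub> e x" if r: "r \<in> carrier R" and x: "x \<in> carrier M" for r x
  proof (rule eq_if_fully_invariant_rcos_eq)
    fix L assume L: "fully_invariant L"
    have "\<forall>\<^sub>F n in sequentially. L +>\<^bsub>M\<^esub> e (r \<odot>\<^bsub>M\<^esub> x) = L +>\<^bsub>M\<^esub> (r \<odot>\<^bsub>M\<^esub> e x)"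
      using lim[OF L x] lim[OF L smult_closed[OF r x]]
    proof eventually_elim
      case (elim n)
      then show ?case
        using rcos_smult_cong[OF fully_invariant_submodule[OF L] r f(1)[OF x] e[OF x]] f(3)[OF r x]
        by simp
    qed
    then show "L +>\<^bsub>M\<^esub> e (r \<odot>\<^bsub>M\<^esub> x) = L +>\<^bsub>M\<^esub> (r \<odot>\<^bsub>M\<^esub> e x)" by simp
  qed (use r x e in auto)
qed

lemma fitting_idempotent:
  assumes \<theta>: "\<theta> \<in> End"
  obtains e where "e \<in> End" "\<And>x. x \<in> carrier M \<Longrightarrow> e (e x) = e x"
    "\<And>L x. fully_invariant L \<Longrightarrow> x \<in> carrier M \<Longrightarrow>
      \<forall>\<^sub>F n in sequentially. L +>\<^bsub>M\<^esub> (\<theta> ^^ fact n) x = L +>\<^bsub>M\<^esub> e x"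
proof -
  have "\<forall>x\<in>carrier M. \<exists>y\<in>carrier M. \<forall>L. fully_invariant L \<longrightarrow>
      (\<forall>\<^sub>F n in sequentially. L +>\<^bsub>M\<^esub> (\<theta> ^^ fact n) x = L +>\<^bsub>M\<^esub> y)"
    using funpow_fact_limit[OF \<theta>] by metis
  then obtain e where e: "\<And>x. x \<in> carrier M \<Longrightarrow> e x \<in> carrier M"
    and lim: "\<And>L x. fully_invariant L \<Longrightarrow> x \<in> carrier M \<Longrightarrow>
      \<forall>\<^sub>F n in sequentially. L +>\<^bsub>M\<^esub> (\<theta> ^^ fact n) x = L +>\<^bsub>M\<^esub> e x"
    by metis
  have "e \<in> End" by (rule End_limit[OF End_funpow[OF \<theta>] e lim])
  moreover have "e (e x) = e x" if x: "x \<in> carrier M" for x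
  proof (rule eq_if_fully_invariant_rcos_eq)
    fix L assume L: "fully_invariant L"
    have "\<forall>\<^sub>F n in sequentially. L +>\<^bsub>M\<^esub> e (e x) = L +>\<^bsub>M\<^esub> e x"
      using lim[OF L x] lim[OF L e[OF x]] funpow_fact_rcos_idempotent[OF L \<theta> x]
    proof eventually_elim
      case (elim n)
      then show ?case
        using End_rcos_cong[OF L End_funpow[OF \<theta>]
            continuous_hom_closed[OF End_funpow[OF \<theta>] x] e[OF x] elim(1)]
        by simp
    qed
    then show "L +>\<^bsub>M\<^esub> e (e x) = L +>\<^bsub>M\<^esub> e x" by simp
  qed (use x e in auto)
  ultimately show thesis using that lim by blast
qed

end

context compact_ring_module
begin

lemma direct_sum_decompositionI:
  assumes A: "submodule A R M" "closedin Mtop A" and B: "submodule B R M" "closedin Mtop B"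
    and sum: "\<And>x. x \<in> carrier M \<Longrightarrow> \<exists>a\<in>A. \<exists>b\<in>B. x = a \<oplus>\<^bsub>M\<^esub> b" and disj: "A \<inter> B \<subseteq> {\<zero>\<^bsub>M\<^esub>}"
  shows "direct_sum_decomposition R M A B"
proof -
  let ?P = "prod_topology (subtopology Mtop A) (subtopology Mtop B)"
  have AM: "A \<subseteq> carrier M" and BM: "B \<subseteq> carrier M" using A B submodule_subset by blast+
  then have top: "topspace ?P = A \<times> B" by (auto simp: topspace_mtopology)
  have "homeomorphic_map ?P Mtop (\<lambda>(x, y). x \<oplus>\<^bsub>M\<^esub> y)"
  proof (rule continuous_imp_homeomorphic_map[OF _ _ Hausdorff_M])
    show "compact_space ?P"
      using closedin_compact_space[OF compact_M] A(2) B(2)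
      by (simp add: compact_space_prod_topology compact_space_subtopology)
    show "continuous_map ?P Mtop (\<lambda>(x, y). x \<oplus>\<^bsub>M\<^esub> y)"
      unfolding case_prod_beta
      by (intro continuous_map_add continuous_map_into_fulltopology[OF continuous_map_fst]
        continuous_map_into_fulltopology[OF continuous_map_snd])
    show "(\<lambda>(x, y). x \<oplus>\<^bsub>M\<^esub> y) ` topspace ?P = topspace Mtop"
      unfolding top topspace_mtopology
    proof (intro equalityI subsetI)
      show "x \<in> (\<lambda>(x, y). x \<oplus>\<^bsub>M\<^esub> y) ` (A \<times> B)" if "x \<in> carrier M" for x using sum[OF that] by auto
    qed (use AM BM in auto)
    show "inj_on (\<lambda>(x, y). x \<oplus>\<^bsub>M\<^esub> y) (topspace ?P)"
      unfolding top
    proof (rule inj_onI, clarify)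
      fix a b c d assume mem: "a \<in> A" "b \<in> B" "c \<in> A" "d \<in> B" and eq: "a \<oplus>\<^bsub>M\<^esub> b = c \<oplus>\<^bsub>M\<^esub> d"
      then have closed: "a \<in> carrier M" "b \<in> carrier M" "c \<in> carrier M" "d \<in> carrier M" using AM BM
        by auto
      have "(a \<ominus>\<^bsub>M\<^esub> c) \<oplus>\<^bsub>M\<^esub> (b \<ominus>\<^bsub>M\<^esub> d) = \<zero>\<^bsub>M\<^esub>"
        using closed eq by (simp add: M.minus_eq_zero_iff flip: M.add_minus_add_eq)
      then have "a \<ominus>\<^bsub>M\<^esub> c = d \<ominus>\<^bsub>M\<^esub> b"
        using closed M.minus_equality[of "a \<ominus>\<^bsub>M\<^esub> c" "b \<ominus>\<^bsub>M\<^esub> d"]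
        by (simp add: a_minus_def M.minus_add M.a_comm)
      moreover have "a \<ominus>\<^bsub>M\<^esub> c \<in> A" "d \<ominus>\<^bsub>M\<^esub> b \<in> B"
        using submodule_minus_closed A(1) B(1) mem by blast+
      ultimately have "a \<ominus>\<^bsub>M\<^esub> c = \<zero>\<^bsub>M\<^esub>" "d \<ominus>\<^bsub>M\<^esub> b = \<zero>\<^bsub>M\<^esub>" using disj by auto
      then show "a = c \<and> b = d" using closed by (simp add: M.minus_eq_zero_iff)
    qed
  qed
  then show ?thesis using A(1) B(1) by (simp add: direct_sum_decomposition_def)
qed

end

context fg_profinite_module
begin

lemma idempotent_decomposition:
  assumes e: "e \<in> End" and idem: "\<And>x. x \<in> carrier M \<Longrightarrow> e (e x) = e x"
  shows "direct_sum_decomposition R M {x \<in> carrier M. e x = x} {x \<in> carrier M. e x = \<zero>\<^bsub>M\<^esub>}"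
proof (rule direct_sum_decompositionI)
  note eD = continuous_homD[OF e]
  show "submodule {x \<in> carrier M. e x = x} R M" "submodule {x \<in> carrier M. e x = \<zero>\<^bsub>M\<^esub>} R M"
    by (rule left_submoduleI; use eD End_zero[OF e] in auto)+
  show "closedin Mtop {x \<in> carrier M. e x = x}" "closedin Mtop {x \<in> carrier M. e x = \<zero>\<^bsub>M\<^esub>}"
    using closedin_continuous_maps_eq[OF Hausdorff_M eD(4) continuous_map_id]
      closedin_continuous_maps_eq[OF Hausdorff_M eD(4), of "\<lambda>_. \<zero>\<^bsub>M\<^esub>"]
    by (simp_all add: topspace_mtopology)
  fix x assume x: "x \<in> carrier M"
  have "e (x \<ominus>\<^bsub>M\<^esub> e x) = \<zero>\<^bsub>M\<^esub>"
    using End_minus[OF e x eD(1)[OF x]] idem[OF x] eD(1)[OF x] by (simp add: M.minus_eq_zero_iff)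
  moreover have "x = e x \<oplus>\<^bsub>M\<^esub> (x \<ominus>\<^bsub>M\<^esub> e x)"
    using M.minus_add_cancel[OF x eD(1)[OF x]] x eD(1)[OF x] by (simp add: M.a_comm)
  ultimately show "\<exists>a\<in>{x \<in> carrier M. e x = x}. \<exists>b\<in>{x \<in> carrier M. e x = \<zero>\<^bsub>M\<^esub>}. x = a \<oplus>\<^bsub>M\<^esub> b"
    using x eD(1)[OF x] idem[OF x] by (intro bexI[of _ "e x"] bexI[of _ "x \<ominus>\<^bsub>M\<^esub> e x"]) auto
qed auto

lemma End_surj_if_dense:
  assumes \<theta>: "\<theta> \<in> End"
    and dense: "\<And>L x. fully_invariant L \<Longrightarrow> x \<in> carrier M \<Longrightarrow> \<exists>y\<in>carrier M. L +>\<^bsub>M\<^esub> \<theta> y = L +>\<^bsub>M\<^esub> x"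
  shows "\<theta> ` carrier M = carrier M"
proof (intro equalityI subsetI)
  fix x assume x: "x \<in> carrier M"
  define C where "C L = {y \<in> carrier M. L +>\<^bsub>M\<^esub> \<theta> y = L +>\<^bsub>M\<^esub> x}" for L
  have "\<exists>y. \<forall>L. fully_invariant L \<longrightarrow> y \<in> C L"
  proof (rule fully_invariant_Inter_nonempty)
    fix L assume L: "fully_invariant L"
    interpret L: abelian_subgroup L M by (rule fully_invariant_abelian_subgroup[OF L])
    have "C L = {y \<in> topspace Mtop. \<theta> y \<ominus>\<^bsub>M\<^esub> x \<in> L}"
      by (simp add: C_def topspace_mtopology L.a_rcos_eq_iff x continuous_hom_closed[OF \<theta>] cong:
          conj_cong)
    moreover have "closedin Mtop \<dots>"
    proof (rule closedin_continuous_map_preimage)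
      show "continuous_map Mtop Mtop (\<lambda>y. \<theta> y \<ominus>\<^bsub>M\<^esub> x)"
        by (intro continuous_map_minus continuous_hom_continuous[OF \<theta>]) (simp add: topspace_mtopology x)
      show "closedin Mtop L" by (rule closedin_open_submodule)
        (rule fully_invariant_submodule[OF L] fully_invariant_open[OF L])+
    qed
    ultimately show "closedin Mtop (C L)" by simp
    show "C L \<noteq> {}" using dense[OF L x] by (auto simp: C_def)
  next
    fix K L assume KL: "fully_invariant K" "fully_invariant L" "K \<subseteq> L"
    show "C K \<subseteq> C L"
      using fully_invariant_rcos_mono[OF KL _ x] by (auto simp: C_def continuous_hom_closed[OF \<theta>])
  qed
  then obtain y where "y \<in> carrier M" "\<And>L. fully_invariant L \<Longrightarrow> L +>\<^bsub>M\<^esub> \<theta> y = L +>\<^bsub>M\<^esub> x"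
    using fully_invariant_carrier by (auto simp: C_def)
  moreover from this have "\<theta> y = x"
    by (intro eq_if_fully_invariant_rcos_eq continuous_hom_closed[OF \<theta>] x)
  ultimately show "x \<in> \<theta> ` carrier M" by blast
qed (auto simp: continuous_hom_closed[OF \<theta>])

lemma End_bij_if_topologically_unipotent:
  assumes \<theta>: "\<theta> \<in> End"
    and unip: "\<And>L x. fully_invariant L \<Longrightarrow> x \<in> carrier M \<Longrightarrow> \<exists>n. L +>\<^bsub>M\<^esub> (\<theta> ^^ Suc n) x = L +>\<^bsub>M\<^esub> x"
  shows "bij_betw \<theta> (carrier M) (carrier M)"
proof -
  interpret \<theta>: abelian_group_hom M M \<theta> by (rule End_abelian_group_hom[OF \<theta>])
  have "inj_on \<theta> (carrier M)"
  proof (rule \<theta>.inj_on_if_trivial_kernel, rule zero_if_fully_invariant)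
    fix x L assume x: "x \<in> carrier M" "\<theta> x = \<zero>\<^bsub>M\<^esub>" and L: "fully_invariant L"
    interpret L: abelian_subgroup L M by (rule fully_invariant_abelian_subgroup[OF L])
    obtain n where "L +>\<^bsub>M\<^esub> (\<theta> ^^ Suc n) x = L +>\<^bsub>M\<^esub> x" using unip[OF L x(1)] by blast
    moreover have "(\<theta> ^^ Suc n) x = \<zero>\<^bsub>M\<^esub>"
      using x(2) End_zero[OF End_funpow[OF \<theta>]] by (simp only: funpow_Suc_right comp_apply)
    ultimately show "x \<in> L"
      using L.a_rcos_eq_self_iff[OF x(1)] M.a_coset_add_zero[OF L.a_subset] by metis
  qed
  moreover have "\<theta> ` carrier M = carrier M"
  proof (rule End_surj_if_dense[OF \<theta>])
    fix L x assume Lx: "fully_invariant L" "x \<in> carrier M"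
    then obtain n where "L +>\<^bsub>M\<^esub> \<theta> ((\<theta> ^^ n) x) = L +>\<^bsub>M\<^esub> x" using unip by force
    then show "\<exists>y\<in>carrier M. L +>\<^bsub>M\<^esub> \<theta> y = L +>\<^bsub>M\<^esub> x"
      using continuous_hom_closed[OF End_funpow[OF \<theta>] Lx(2)] by blast
  qed
  ultimately show ?thesis by (simp add: bij_betw_def)
qed

text \<open>The partial sums of the geometric series invert \<open>id - \<theta>\<close> up to a power of \<open>\<theta>\<close>.\<close>

lemma id_minus_geometric_sum:
  assumes \<theta>: "\<theta> \<in> End" and x: "x \<in> carrier M"
  shows "\<exists>y\<in>carrier M. y \<ominus>\<^bsub>M\<^esub> \<theta> y = x \<ominus>\<^bsub>M\<^esub> (\<theta> ^^ n) x"
proof (induction n)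
  case 0
  have "\<zero>\<^bsub>M\<^esub> \<ominus>\<^bsub>M\<^esub> \<theta> \<zero>\<^bsub>M\<^esub> = \<zero>\<^bsub>M\<^esub>" "x \<ominus>\<^bsub>M\<^esub> (\<theta> ^^ 0) x = \<zero>\<^bsub>M\<^esub>"
    using x End_zero[OF \<theta>] by (simp_all add: M.minus_eq_zero_iff)
  then show ?case by (metis M.zero_closed)
next
  case (Suc n)
  then obtain y where y: "y \<in> carrier M" "y \<ominus>\<^bsub>M\<^esub> \<theta> y = x \<ominus>\<^bsub>M\<^esub> (\<theta> ^^ n) x" by blast
  let ?z = "(\<theta> ^^ n) x"
  have z: "?z \<in> carrier M" by (rule continuous_hom_closed[OF End_funpow[OF \<theta>] x])
  have "(y \<oplus>\<^bsub>M\<^esub> ?z) \<ominus>\<^bsub>M\<^esub> \<theta> (y \<oplus>\<^bsub>M\<^esub> ?z) = (y \<ominus>\<^bsub>M\<^esub> \<theta> y) \<oplus>\<^bsub>M\<^esub> (?z \<ominus>\<^bsub>M\<^esub> \<theta> ?z)"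
    using y z by (simp add: continuous_homD[OF \<theta>] M.add_minus_add_eq)
  also have "\<dots> = x \<ominus>\<^bsub>M\<^esub> (\<theta> ^^ Suc n) x"
    unfolding y(2) using x z by (simp add: M.minus_add_minus continuous_hom_closed[OF \<theta>])
  finally show ?case using y z by blast
qed

lemma End_id_minus_bij_if_topologically_nilpotent:
  assumes \<theta>: "\<theta> \<in> End"
    and nil: "\<And>L x. fully_invariant L \<Longrightarrow> x \<in> carrier M \<Longrightarrow> \<exists>n. (\<theta> ^^ n) x \<in> L"
  shows "bij_betw (\<lambda>x. x \<ominus>\<^bsub>M\<^esub> \<theta> x) (carrier M) (carrier M)"
proof -
  have \<theta>': "(\<lambda>x. x \<ominus>\<^bsub>M\<^esub> \<theta> x) \<in> End" by (rule End_id_minus[OF \<theta>])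
  then interpret \<theta>': abelian_group_hom M M "\<lambda>x. x \<ominus>\<^bsub>M\<^esub> \<theta> x" by (rule End_abelian_group_hom)
  have "inj_on (\<lambda>x. x \<ominus>\<^bsub>M\<^esub> \<theta> x) (carrier M)"
  proof (rule \<theta>'.inj_on_if_trivial_kernel, rule zero_if_fully_invariant)
    fix x L assume x: "x \<in> carrier M" "x \<ominus>\<^bsub>M\<^esub> \<theta> x = \<zero>\<^bsub>M\<^esub>" and L: "fully_invariant L"
    then have "\<theta> x = x" by (simp add: M.minus_eq_zero_iff continuous_hom_closed[OF \<theta>])
    then have "(\<theta> ^^ n) x = x" for n by (induction n) simp_all
    then show "x \<in> L" using nil[OF L x(1)] by simp
  qed
  moreover have "(\<lambda>x. x \<ominus>\<^bsub>M\<^esub> \<theta> x) ` carrier M = carrier M"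
  proof (rule End_surj_if_dense[OF \<theta>'])
    fix L x assume L: "fully_invariant L" and x: "x \<in> carrier M"
    interpret L: abelian_subgroup L M by (rule fully_invariant_abelian_subgroup[OF L])
    obtain n where n: "(\<theta> ^^ n) x \<in> L" using nil[OF L x] by blast
    obtain y where y: "y \<in> carrier M" "y \<ominus>\<^bsub>M\<^esub> \<theta> y = x \<ominus>\<^bsub>M\<^esub> (\<theta> ^^ n) x"
      using id_minus_geometric_sum[OF \<theta> x] by blast
    have "L +>\<^bsub>M\<^esub> x = L +>\<^bsub>M\<^esub> (x \<ominus>\<^bsub>M\<^esub> (\<theta> ^^ n) x)"
      using x n by (simp add: L.a_rcos_eq_iff M.minus_minus_cancel)
    then show "\<exists>y\<in>carrier M. L +>\<^bsub>M\<^esub> (y \<ominus>\<^bsub>M\<^esub> \<theta> y) = L +>\<^bsub>M\<^esub> x" using y by metis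
  qed
  ultimately show ?thesis by (simp add: bij_betw_def)
qed

lemma End_inverse:
  assumes \<theta>: "\<theta> \<in> End" and bij: "bij_betw \<theta> (carrier M) (carrier M)"
  obtains \<eta> where "\<eta> \<in> End" "\<And>x. x \<in> carrier M \<Longrightarrow> \<eta> (\<theta> x) = x" "\<And>x. x \<in> carrier M \<Longrightarrow> \<theta> (\<eta> x) = x"
proof -
  let ?\<eta> = "inv_into (carrier M) \<theta>"
  have left: "?\<eta> (\<theta> x) = x" and right: "\<theta> (?\<eta> x) = x" and closed: "?\<eta> x \<in> carrier M"
    if "x \<in> carrier M" for x
    using bij that by (auto simp: bij_betw_def inv_into_into f_inv_into_f)
  have eqI: "x = y" if "x \<in> carrier M" "y \<in> carrier M" "\<theta> x = \<theta> y" for x y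
    using that left by metis
  have "?\<eta> \<in> End"
  proof (rule EndI[OF closed])
    show "?\<eta> (x \<oplus>\<^bsub>M\<^esub> y) = ?\<eta> x \<oplus>\<^bsub>M\<^esub> ?\<eta> y" if "x \<in> carrier M" "y \<in> carrier M" for x y
      by (rule eqI) (use that closed right continuous_hom_add[OF \<theta>] in auto)
    show "?\<eta> (r \<odot>\<^bsub>M\<^esub> x) = r \<odot>\<^bsub>M\<^esub> ?\<eta> x" if "r \<in> carrier R" "x \<in> carrier M" for r x
      by (rule eqI) (use that closed right continuous_hom_smult[OF \<theta>] in auto)
  qed
  then show thesis using that left right by blast
qed

end

section \<open>The endomorphism ring of an indecomposable module is local\<close>

locale indecomposable_profinite_module = fg_profinite_module R M
  for R :: "('r, 'a) top_ring_scheme" (structure) and M :: "('r, 'm, 'b) top_module_scheme" (structure) +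
  assumes indecomposable: "indecomposable_module R M"
begin

lemma idempotent_trivial:
  assumes e: "e \<in> End" and idem: "\<And>x. x \<in> carrier M \<Longrightarrow> e (e x) = e x"
  shows "(\<forall>x\<in>carrier M. e x = \<zero>\<^bsub>M\<^esub>) \<or> (\<forall>x\<in>carrier M. e x = x)"
proof -
  note closed = continuous_hom_closed[OF e]
  have "e (x \<ominus>\<^bsub>M\<^esub> e x) = \<zero>\<^bsub>M\<^esub>" if "x \<in> carrier M" for x
    using that End_minus[OF e that closed] idem[OF that] closed by (simp add: M.minus_eq_zero_iff)
  then have mem: "e x \<in> {x \<in> carrier M. e x = x}" "x \<ominus>\<^bsub>M\<^esub> e x \<in> {x \<in> carrier M. e x = \<zero>\<^bsub>M\<^esub>}"
    if "x \<in> carrier M" for x using that idem closed by auto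
  have "{x \<in> carrier M. e x = x} = {\<zero>\<^bsub>M\<^esub>} \<or> {x \<in> carrier M. e x = \<zero>\<^bsub>M\<^esub>} = {\<zero>\<^bsub>M\<^esub>}"
    using indecomposable idempotent_decomposition[OF e idem] by (simp add: indecomposable_module_def)
  then show ?thesis
  proof
    assume "{x \<in> carrier M. e x = x} = {\<zero>\<^bsub>M\<^esub>}"
    then show ?thesis using mem(1) by blast
  next
    assume "{x \<in> carrier M. e x = \<zero>\<^bsub>M\<^esub>} = {\<zero>\<^bsub>M\<^esub>}"
    then have "x \<ominus>\<^bsub>M\<^esub> e x = \<zero>\<^bsub>M\<^esub>" if "x \<in> carrier M" for x using mem(2)[OF that] by simp
    then show ?thesis using closed by (simp add: M.minus_eq_zero_iff)
  qed
qed

lemma End_local: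
  assumes \<theta>: "\<theta> \<in> End"
  shows "bij_betw \<theta> (carrier M) (carrier M) \<or> bij_betw (\<lambda>x. x \<ominus>\<^bsub>M\<^esub> \<theta> x) (carrier M) (carrier M)"
proof -
  obtain e where e: "e \<in> End" "\<And>x. x \<in> carrier M \<Longrightarrow> e (e x) = e x"
    and lim: "\<And>L x. fully_invariant L \<Longrightarrow> x \<in> carrier M \<Longrightarrow>
      \<forall>\<^sub>F n in sequentially. L +>\<^bsub>M\<^esub> (\<theta> ^^ fact n) x = L +>\<^bsub>M\<^esub> e x"
    by (rule fitting_idempotent[OF \<theta>]) blast
  have power: "\<exists>n. L +>\<^bsub>M\<^esub> (\<theta> ^^ Suc n) x = L +>\<^bsub>M\<^esub> e x" if "fully_invariant L" "x \<in> carrier M" for L x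
    using eventually_happens[OF lim[OF that]]
    by (metis fact_gt_zero gr0_conv_Suc trivial_limit_sequentially)
  from idempotent_trivial[OF e] show ?thesis
  proof
    assume zero: "\<forall>x\<in>carrier M. e x = \<zero>\<^bsub>M\<^esub>"
    have "\<exists>n. (\<theta> ^^ n) x \<in> L" if L: "fully_invariant L" and x: "x \<in> carrier M" for L x
    proof -
      interpret L: abelian_subgroup L M by (rule fully_invariant_abelian_subgroup[OF L])
      obtain n where "L +>\<^bsub>M\<^esub> (\<theta> ^^ Suc n) x = L +>\<^bsub>M\<^esub> \<zero>\<^bsub>M\<^esub>" using power[OF L x] zero x by auto
      then have "L +>\<^bsub>M\<^esub> (\<theta> ^^ Suc n) x = L" by (simp only: M.a_coset_add_zero[OF L.a_subset])
      then show ?thesis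
        using L.a_rcos_eq_self_iff[OF continuous_hom_closed[OF End_funpow[OF \<theta>] x]] by blast
    qed
    then show ?thesis using End_id_minus_bij_if_topologically_nilpotent[OF \<theta>] by blast
  next
    assume "\<forall>x\<in>carrier M. e x = x"
    then show ?thesis using End_bij_if_topologically_unipotent[OF \<theta>] power by simp
  qed
qed

lemma End_bij_summand:
  assumes \<theta>: "\<theta> \<in> End" and \<eta>: "\<eta> \<in> End"
    and bij: "bij_betw (\<lambda>x. \<theta> x \<oplus>\<^bsub>M\<^esub> \<eta> x) (carrier M) (carrier M)"
  shows "bij_betw \<theta> (carrier M) (carrier M) \<or> bij_betw \<eta> (carrier M) (carrier M)"
proof -
  let ?u = "\<lambda>x. \<theta> x \<oplus>\<^bsub>M\<^esub> \<eta> x"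
  have u: "?u \<in> End" by (rule End_add[OF \<theta> \<eta>])
  obtain v where v: "v \<in> End" "\<And>x. x \<in> carrier M \<Longrightarrow> ?u (v x) = x"
    by (rule End_inverse[OF u bij]) blast
  note closed = continuous_hom_closed[OF \<theta>] continuous_hom_closed[OF \<eta>] continuous_hom_closed[OF v(1)]
  have lift: "bij_betw h (carrier M) (carrier M)"
    if "bij_betw f (carrier M) (carrier M)" "\<And>x. x \<in> carrier M \<Longrightarrow> ?u (f x) = h x" for f h
    using bij_betw_trans[OF that(1) bij] that(2) bij_betw_cong[of "carrier M" "?u \<circ> f" h] by simp
  have \<eta>_eq: "?u (x \<ominus>\<^bsub>M\<^esub> v (\<theta> x)) = \<eta> x" if x: "x \<in> carrier M" for x
    using End_minus[OF u x, of "v (\<theta> x)"] v(2)[of "\<theta> x"] x closed by (simp add: M.add_minus_cancel_left)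
  have "(\<lambda>x. v (\<theta> x)) \<in> End" by (rule continuous_hom_compose[OF \<theta> v(1)])
  from End_local[OF this] show ?thesis
    using lift[of "\<lambda>x. v (\<theta> x)" \<theta>] lift[of "\<lambda>x. x \<ominus>\<^bsub>M\<^esub> v (\<theta> x)" \<eta>] v(2) closed \<eta>_eq by blast
qed

lemma End_bij_finsum_summand:
  assumes "finite I" "\<And>i. i \<in> I \<Longrightarrow> \<theta> i \<in> End"
    "bij_betw (\<lambda>x. \<Oplus>\<^bsub>M\<^esub>i\<in>I. \<theta> i x) (carrier M) (carrier M)"
  shows "\<exists>i\<in>I. bij_betw (\<theta> i) (carrier M) (carrier M)"
  using assms
proof (induction I)
  case empty
  then have "carrier M = {\<zero>\<^bsub>M\<^esub>}" by (auto simp: bij_betw_def)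
  then show ?case using indecomposable by (simp add: indecomposable_module_def)
next
  case (insert j I)
  have "(\<Oplus>\<^bsub>M\<^esub>i\<in>insert j I. \<theta> i x) = \<theta> j x \<oplus>\<^bsub>M\<^esub> (\<Oplus>\<^bsub>M\<^esub>i\<in>I. \<theta> i x)" if "x \<in> carrier M" for x
    using that insert.hyps continuous_hom_closed[OF insert.prems(1)] by (intro M.finsum_insert) auto
  then have "bij_betw (\<lambda>x. \<theta> j x \<oplus>\<^bsub>M\<^esub> (\<Oplus>\<^bsub>M\<^esub>i\<in>I. \<theta> i x)) (carrier M) (carrier M)"
    using insert.prems(2) by (simp cong: bij_betw_cong)
  then have "bij_betw (\<theta> j) (carrier M) (carrier M) \<or> bij_betw (\<lambda>x. \<Oplus>\<^bsub>M\<^esub>i\<in>I. \<theta> i x) (carrier M) (carrier M)"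
    by (intro End_bij_summand End_finsum) (use insert in auto)
  then show ?case using insert.IH insert.prems(1) by blast
qed

end

section \<open>Group actions and conjugates\<close>

context group
begin

lemma group_actionI:
  assumes closed: "\<And>g x. g \<in> carrier G \<Longrightarrow> x \<in> E \<Longrightarrow> s g x \<in> E"
    and one: "\<And>x. x \<in> E \<Longrightarrow> s \<one> x = x"
    and mult: "\<And>g h x. g \<in> carrier G \<Longrightarrow> h \<in> carrier G \<Longrightarrow> x \<in> E \<Longrightarrow> s (g \<otimes> h) x = s g (s h x)"
  shows "group_action G E (\<lambda>g. \<lambda>x\<in>E. s g x)"
proof -
  have inverse: "s (inv g) (s g x) = x" "s g (s (inv g) x) = x" if "g \<in> carrier G" "x \<in> E" for g x
    using that by (simp_all add: one flip: mult)
  have "(\<lambda>x\<in>E. s g x) \<in> Bij E" if g: "g \<in> carrier G" for g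
  proof -
    have "bij_betw (\<lambda>x\<in>E. s g x) E E"
      by (rule bij_betw_byWitness[where f' = "s (inv g)"]) (use g closed inverse in auto)
    then show ?thesis by (simp add: Bij_def)
  qed
  then have "(\<lambda>g. \<lambda>x\<in>E. s g x) \<in> hom G (BijGroup E)"
    using closed mult by (auto simp: hom_def BijGroup_def compose_def intro!: restrict_ext)
  then show ?thesis
    by (intro group_action.intro group_hom.intro group_hom_axioms.intro is_group group_BijGroup)
qed

abbreviation conjugate :: "'a \<Rightarrow> 'a set \<Rightarrow> 'a set" where
  "conjugate x H \<equiv> x <# H #> inv x"

lemma conjugate_eq_image: "conjugate x H = (\<lambda>h. x \<otimes> h \<otimes> inv x) ` H"
  by (auto simp: l_coset_def r_coset_def)

lemma inv_conjugation:
  assumes "x \<in> carrier G" "g \<in> carrier G"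
  shows "inv x \<otimes> (x \<otimes> g \<otimes> inv x) \<otimes> x = g"
  using conjugation_is_surj[of "inv x" g] assms by simp

lemma mem_conjugate_iff:
  assumes "x \<in> carrier G" "H \<subseteq> carrier G"
  shows "g \<in> conjugate x H \<longleftrightarrow> g \<in> carrier G \<and> inv x \<otimes> g \<otimes> x \<in> H"
proof
  assume "g \<in> conjugate x H"
  then obtain h where "h \<in> H" "g = x \<otimes> h \<otimes> inv x" by (auto simp: conjugate_eq_image)
  then show "g \<in> carrier G \<and> inv x \<otimes> g \<otimes> x \<in> H"
    using assms inv_conjugation[of x h] by (auto simp: subset_iff)
next
  assume g: "g \<in> carrier G \<and> inv x \<otimes> g \<otimes> x \<in> H"
  then have "g = x \<otimes> (inv x \<otimes> g \<otimes> x) \<otimes> inv x" using assms(1) by (simp add: conjugation_is_surj)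
  then show "g \<in> conjugate x H" using g unfolding conjugate_eq_image by blast
qed

lemma conjugate_subset: "x \<in> carrier G \<Longrightarrow> H \<subseteq> carrier G \<Longrightarrow> conjugate x H \<subseteq> carrier G"
  by (auto simp: mem_conjugate_iff)

lemma conjugate_mult:
  assumes "x \<in> carrier G" "y \<in> carrier G" "H \<subseteq> carrier G"
  shows "conjugate x (conjugate y H) = conjugate (x \<otimes> y) H"
  unfolding conjugate_eq_image image_image
  by (rule image_cong) (use assms in \<open>auto simp: inv_mult_group m_assoc subset_iff\<close>)

lemma conjugate_one: "H \<subseteq> carrier G \<Longrightarrow> conjugate \<one> H = H"
  unfolding conjugate_eq_image by (force simp: subset_iff)

lemma inj_on_conjugation: "x \<in> carrier G \<Longrightarrow> inj_on (\<lambda>h. x \<otimes> h \<otimes> inv x) (carrier G)"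
  by (rule inj_on_inverseI[where g = "\<lambda>g. inv x \<otimes> g \<otimes> x"]) (rule inv_conjugation)

lemma conjugate_Int:
  assumes "x \<in> carrier G" "H \<subseteq> carrier G" "K \<subseteq> carrier G"
  shows "conjugate x (H \<inter> K) = conjugate x H \<inter> conjugate x K"
  unfolding conjugate_eq_image by (rule inj_on_image_Int[OF inj_on_conjugation[OF assms(1)] assms(2,3)])

lemma conjugate_INT:
  assumes "x \<in> carrier G" "I \<noteq> {}" "\<And>i. i \<in> I \<Longrightarrow> H i \<subseteq> carrier G"
  shows "conjugate x (\<Inter>i\<in>I. H i) = (\<Inter>i\<in>I. conjugate x (H i))"
proof -
  obtain i where "i \<in> I" using assms(2) by blast
  then show ?thesis
    unfolding conjugate_eq_image using assms(3)
    by (intro image_INT[OF inj_on_conjugation[OF assms(1)]]) auto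
qed

lemma conjugate_inv:
  assumes "x \<in> carrier G" "H \<subseteq> carrier G"
  shows "conjugate x (conjugate (inv x) H) = H" "conjugate (inv x) (conjugate x H) = H"
  using conjugate_mult[of x "inv x" H] conjugate_mult[of "inv x" x H] conjugate_one assms by simp_all

lemma conjugate_mono: "H \<subseteq> K \<Longrightarrow> conjugate x H \<subseteq> conjugate x K"
  unfolding conjugate_eq_image by (rule image_mono)

lemma psubset_conjugate:
  assumes x: "x \<in> carrier G" "H \<subseteq> carrier G" and K: "K \<subset> conjugate x H"
  shows "conjugate (inv x) K \<subset> H"
proof
  have KG: "K \<subseteq> carrier G" using K conjugate_subset[OF x] by blast
  show "conjugate (inv x) K \<subseteq> H"
    using conjugate_mono[of K "conjugate x H" "inv x"] K conjugate_inv(2)[OF x] by auto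
  show "conjugate (inv x) K \<noteq> H" using conjugate_inv(1)[OF x(1) KG] K by auto
qed

lemma conjugate_eq_self:
  assumes "subgroup H G" "x \<in> H"
  shows "conjugate x H = H"
proof -
  have H: "x \<in> carrier G" "H \<subseteq> carrier G" "inv x \<in> H"
    using assms subgroup.subset[OF assms(1)] subgroup.m_inv_closed[OF assms(1)] by auto
  have sub: "conjugate y H \<subseteq> H" if "y \<in> H" for y
    unfolding conjugate_eq_image
    using that subgroup.m_closed[OF assms(1)] subgroup.m_inv_closed[OF assms(1)] by auto
  have "H = conjugate x (conjugate (inv x) H)" using conjugate_inv(1)[OF H(1,2)] by simp
  also have "\<dots> \<subseteq> conjugate x H" by (rule conjugate_mono[OF sub[OF H(3)]])
  finally show ?thesis using sub[OF assms(2)] by blast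
qed

lemma conjugate_normal_mult:
  assumes N: "N \<lhd> G" "n \<in> N" and H: "subgroup H G" "N \<subseteq> H" and x: "x \<in> carrier G"
  shows "conjugate (n \<otimes> x) H = conjugate x H"
proof -
  have n: "n \<in> carrier G" using N(2) H subgroup.subset by blast
  have "inv x \<otimes> n \<otimes> x \<in> H" using normal.inv_op_closed1[OF N(1) x N(2)] H(2) by blast
  moreover have "n \<otimes> x = x \<otimes> (inv x \<otimes> n \<otimes> x)" using x n by (simp flip: m_assoc)
  ultimately show ?thesis
    using x n subgroup.subset[OF H(1)] conjugate_eq_self[OF H(1)] by (simp flip: conjugate_mult)
qed

lemma rcosets_transitive_action:
  assumes H: "subgroup H G"
  shows "transitive_action G (rcosets H) (\<lambda>g. \<lambda>C\<in>rcosets H. C #> inv g)"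
proof -
  have HG: "H \<subseteq> carrier G" by (rule subgroup.subset[OF H])
  have sub: "C \<subseteq> carrier G" if "C \<in> rcosets H" for C
    by (rule subgroup.rcosets_carrier[OF H is_group that])
  have act: "(H #> x) #> inv g = H #> (x \<otimes> inv g)" if "x \<in> carrier G" "g \<in> carrier G" for x g
    using coset_mult_assoc[OF HG that(1)] that(2) by simp
  interpret group_action G "rcosets H" "\<lambda>g. \<lambda>C\<in>rcosets H. C #> inv g"
  proof (rule group_actionI)
    show "C #> inv g \<in> rcosets H" if "g \<in> carrier G" "C \<in> rcosets H" for g C
      using that act by (auto simp: RCOSETS_def)
    show "C #> inv \<one> = C" if "C \<in> rcosets H" for C using sub[OF that] by simp
    show "C #> inv (g \<otimes> h) = C #> inv h #> inv g"
      if "g \<in> carrier G" "h \<in> carrier G" "C \<in> rcosets H" for g h C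
      using coset_mult_assoc[OF sub[OF that(3)], of "inv h" "inv g"] that by (simp add: inv_mult_group)
  qed
  show ?thesis
  proof
    fix C D assume "C \<in> rcosets H" "D \<in> rcosets H"
    then obtain x y where xy: "x \<in> carrier G" "y \<in> carrier G" "C = H #> x" "D = H #> y"
      by (auto simp: RCOSETS_def)
    then have "C #> inv (inv y \<otimes> x) = D" unfolding xy(3)
      by (subst act) (simp_all add: inv_mult_group flip: m_assoc)
    then show "\<exists>g\<in>carrier G. (\<lambda>C\<in>rcosets H. C #> inv g) C = D"
      using xy \<open>C \<in> rcosets H\<close> by (intro bexI[of _ "inv y \<otimes> x"]) simp_all
  qed
qed

lemma stabilizer_rcoset:
  assumes H: "subgroup H G" and x: "x \<in> carrier G"
  shows "stabilizer G (\<lambda>g. \<lambda>C\<in>rcosets H. C #> inv g) (H #> x) = conjugate (inv x) H"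
proof -
  have HG: "H \<subseteq> carrier G" by (rule subgroup.subset[OF H])
  have "(H #> x) #> inv g = H #> x \<longleftrightarrow> x \<otimes> g \<otimes> inv x \<in> H" if g: "g \<in> carrier G" for g
  proof -
    have "(H #> x) #> inv g = H #> x \<longleftrightarrow> H #> (x \<otimes> inv g) = H #> x"
      using coset_mult_assoc[OF HG x] g by simp
    also have "\<dots> \<longleftrightarrow> x \<in> H #> (x \<otimes> inv g)"
      using repr_independence[OF _ _ H, of x "x \<otimes> inv g"] repr_independenceD[OF H x, of "x \<otimes> inv g"] x g
      by auto
    also have "\<dots> \<longleftrightarrow> x \<otimes> inv (x \<otimes> inv g) \<in> H"
      using subgroup.rcos_module[OF H is_group, of "x \<otimes> inv g" x] x g by simp
    also have "x \<otimes> inv (x \<otimes> inv g) = x \<otimes> g \<otimes> inv x"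
      using x g by (simp add: inv_mult_group m_assoc)
    finally show ?thesis .
  qed
  moreover have "H #> x \<in> rcosets H" using rcosetsI[OF HG x] .
  ultimately have "g \<in> stabilizer G (\<lambda>g. \<lambda>C\<in>rcosets H. C #> inv g) (H #> x) \<longleftrightarrow>
      g \<in> carrier G \<and> x \<otimes> g \<otimes> inv x \<in> H" for g
    by (auto simp: stabilizer_def)
  moreover have "g \<in> conjugate (inv x) H \<longleftrightarrow> g \<in> carrier G \<and> x \<otimes> g \<otimes> inv x \<in> H" for g
    using mem_conjugate_iff[of "inv x" H g] x HG by simp
  ultimately show ?thesis by blast
qed

definition normal_translation_stabilizer :: "'a set \<Rightarrow> 'a set" where
  "normal_translation_stabilizer C = {x \<in> carrier G.
    \<forall>(g, c)\<in>carrier G \<times> C. g \<otimes> x \<otimes> inv g \<otimes> c \<in> C \<and> g \<otimes> inv x \<otimes> inv g \<otimes> c \<in> C}"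

lemma normal_translation_stabilizer:
  assumes C: "C \<subseteq> carrier G"
  shows "normal_translation_stabilizer C \<lhd> G"
proof -
  have mem: "x \<in> normal_translation_stabilizer C \<longleftrightarrow> x \<in> carrier G \<and>
      (\<forall>g\<in>carrier G. \<forall>c\<in>C. g \<otimes> x \<otimes> inv g \<otimes> c \<in> C \<and> g \<otimes> inv x \<otimes> inv g \<otimes> c \<in> C)" for x
    by (auto simp: normal_translation_stabilizer_def)
  have conj_mult: "g \<otimes> (x \<otimes> y) \<otimes> inv g \<otimes> c = g \<otimes> x \<otimes> inv g \<otimes> (g \<otimes> y \<otimes> inv g \<otimes> c)"
    if "g \<in> carrier G" "x \<in> carrier G" "y \<in> carrier G" "c \<in> carrier G" for g x y c
    using that by (simp add: m_assoc) (simp add: m_assoc[symmetric])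
  have conj_conj: "g \<otimes> (x \<otimes> h \<otimes> inv x) \<otimes> inv g = (g \<otimes> x) \<otimes> h \<otimes> inv (g \<otimes> x)"
    if "g \<in> carrier G" "x \<in> carrier G" "h \<in> carrier G" for g x h
    using that by (simp add: inv_mult_group m_assoc)
  have inv_conj: "inv (x \<otimes> h \<otimes> inv x) = x \<otimes> inv h \<otimes> inv x"
    if "x \<in> carrier G" "h \<in> carrier G" for x h
    using that by (simp add: inv_mult_group m_assoc)
  have "subgroup (normal_translation_stabilizer C) G"
  proof (rule subgroupI)
    show "normal_translation_stabilizer C \<subseteq> carrier G" using mem by blast
    have "\<one> \<in> normal_translation_stabilizer C" unfolding mem using C by (auto simp: subset_iff)
    then show "normal_translation_stabilizer C \<noteq> {}" by blast
    show "inv a \<in> normal_translation_stabilizer C" if "a \<in> normal_translation_stabilizer C" for a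
      using that unfolding mem by auto
    show "a \<otimes> b \<in> normal_translation_stabilizer C"
      if "a \<in> normal_translation_stabilizer C" "b \<in> normal_translation_stabilizer C" for a b
      using that C unfolding mem by (auto simp: inv_mult_group conj_mult subset_iff)
  qed
  moreover have "x \<otimes> h \<otimes> inv x \<in> normal_translation_stabilizer C"
    if "x \<in> carrier G" "h \<in> normal_translation_stabilizer C" for x h
    using that unfolding mem by (simp add: inv_conj conj_conj)
  ultimately show ?thesis by (simp add: normal_inv_iff)
qed

lemma normal_translation_stabilizer_subset:
  assumes "\<one> \<in> C"
  shows "normal_translation_stabilizer C \<subseteq> C"
proof
  fix x assume "x \<in> normal_translation_stabilizer C"
  then have "x \<in> carrier G" "\<forall>g\<in>carrier G. \<forall>c\<in>C. g \<otimes> x \<otimes> inv g \<otimes> c \<in> C"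
    by (auto simp: normal_translation_stabilizer_def)
  moreover from this(2) have "\<one> \<otimes> x \<otimes> inv \<one> \<otimes> \<one> \<in> C" using assms by blast
  ultimately show "x \<in> C" by simp
qed

end

lemma (in group_action) inverse_rule:
  assumes "g \<in> carrier G" "x \<in> E"
  shows "\<phi> g (\<phi> (inv g) x) = x" "\<phi> (inv g) (\<phi> g x) = x"
proof -
  interpret group G using group_hom by (simp add: group_hom_def)
  have "\<phi> \<one> x = x" using id_eq_one assms(2) by (metis restrict_apply)
  then show "\<phi> g (\<phi> (inv g) x) = x" "\<phi> (inv g) (\<phi> g x) = x"
    using composition_rule[OF assms(2), of g "inv g"] composition_rule[OF assms(2), of "inv g" g] assms(1)
    by simp_all
qed

lemma (in group_action) action_eq_iff:
  assumes "g \<in> carrier G" "x \<in> E" "y \<in> E"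
  shows "\<phi> g y = x \<longleftrightarrow> y = \<phi> (inv g) x"
  using assms inverse_rule by metis

lemma (in group_action) mem_stabilizerI:
  assumes "x \<in> E" "s \<in> carrier G" "t \<in> carrier G" "g \<in> carrier G" "\<phi> t x = \<phi> g (\<phi> s x)"
  shows "inv t \<otimes> g \<otimes> s \<in> stabilizer G \<phi> x"
proof -
  interpret group G using group_hom by (simp add: group_hom_def)
  have "\<phi> (inv t \<otimes> g \<otimes> s) x = \<phi> (inv t) (\<phi> t x)"
    using assms element_image[OF _ assms(1) refl] by (simp add: composition_rule)
  then show ?thesis using assms(1-4) by (simp add: inverse_rule stabilizer_def)
qed

lemma (in group_action) orbit_subset: "x \<in> E \<Longrightarrow> orbit G \<phi> x \<subseteq> E"
  using element_image by (auto simp: orbit_def)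

lemma (in group_action) orbit_transitive_action:
  assumes x: "x \<in> E"
  shows "transitive_action G (orbit G \<phi> x) (\<lambda>g. \<lambda>y\<in>orbit G \<phi> x. \<phi> g y)"
proof -
  interpret group G using group_hom by (simp add: group_hom_def)
  note sub = orbit_subset[OF x]
  have closed: "\<phi> g y \<in> orbit G \<phi> x" if g: "g \<in> carrier G" and y: "y \<in> orbit G \<phi> x" for g y
  proof -
    obtain h where "h \<in> carrier G" "y = \<phi> h x" using y by (auto simp: orbit_def)
    moreover from this have "\<phi> g y = \<phi> (g \<otimes> h) x" using composition_rule[OF x g] by simp
    moreover have "g \<otimes> h \<in> carrier G" using g \<open>h \<in> carrier G\<close> by simp
    ultimately show ?thesis unfolding orbit_def by blast
  qed
  interpret orbit: group_action G "orbit G \<phi> x" "\<lambda>g. \<lambda>y\<in>orbit G \<phi> x. \<phi> g y"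
  proof (rule group_actionI[OF closed])
    show "\<phi> \<one> y = y" if "y \<in> orbit G \<phi> x" for y using that sub id_eq_one by (metis restrict_apply subsetD)
    show "\<phi> (g \<otimes> h) y = \<phi> g (\<phi> h y)" if "g \<in> carrier G" "h \<in> carrier G" "y \<in> orbit G \<phi> x" for g h y
      using that sub by (intro composition_rule) auto
  qed
  show ?thesis
  proof
    fix y z assume y: "y \<in> orbit G \<phi> x" and z: "z \<in> orbit G \<phi> x"
    then have "z \<in> orbit G \<phi> y"
      using x sub orbit_trans[of y x z] orbit_sym[of x y] by blast
    then show "\<exists>g\<in>carrier G. (\<lambda>y\<in>orbit G \<phi> x. \<phi> g y) y = z" using y by (auto simp: orbit_def)
  qed
qed

lemma (in group_action) finsum_orbits:
  assumes M: "abelian_monoid M" and E: "finite E" and f: "f \<in> E \<rightarrow> carrier M"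
  shows "(\<Oplus>\<^bsub>M\<^esub>S\<in>orbits G E \<phi>. \<Oplus>\<^bsub>M\<^esub>x\<in>S. f x) = (\<Oplus>\<^bsub>M\<^esub>x\<in>E. f x)"
proof -
  interpret M: abelian_monoid M by fact
  have union: "\<Union>(orbits G E \<phi>) = E" by (rule partition.partition_coverture[OF orbit_partition])
  have "(\<Oplus>\<^bsub>M\<^esub>x\<in>\<Union>(orbits G E \<phi>). f x) = (\<Oplus>\<^bsub>M\<^esub>S\<in>orbits G E \<phi>. \<Oplus>\<^bsub>M\<^esub>x\<in>S. f x)"
  proof (rule M.add.finprod_Union_disjoint)
    show "finite (orbits G E \<phi>)" using E by (simp add: union finite_UnionD)
    show "pairwise disjnt (orbits G E \<phi>)"
      using disjoint_union by (auto simp: pairwise_def disjnt_def)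
    show "finite S \<and> (\<forall>x\<in>S. f x \<in> carrier M)" if "S \<in> orbits G E \<phi>" for S
      using that union finite_subset[OF _ E] f by blast
  qed
  then show ?thesis by (simp add: union)
qed

lemma group_action_Times:
  assumes "group_action G A \<phi>" "group_action G B \<psi>"
  shows "group_action G (A \<times> B) (\<lambda>g. \<lambda>p\<in>A \<times> B. (\<phi> g (fst p), \<psi> g (snd p)))"
proof -
  interpret A: group_action G A \<phi> by fact
  interpret B: group_action G B \<psi> by fact
  interpret group G using A.group_hom by (simp add: group_hom_def)
  have one: "\<phi> \<one>\<^bsub>G\<^esub> a = a" "\<psi> \<one>\<^bsub>G\<^esub> b = b" if "a \<in> A" "b \<in> B" for a b
    using that A.id_eq_one B.id_eq_one by (metis restrict_apply)+
  show ?thesis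
    by (rule group_actionI)
      (auto simp: one A.composition_rule B.composition_rule A.element_image[OF _ _ refl]
          B.element_image[OF _ _ refl])
qed

lemma stabilizer_Times:
  "p \<in> A \<times> B \<Longrightarrow> stabilizer G (\<lambda>g. \<lambda>p\<in>A \<times> B. (\<phi> g (fst p), \<psi> g (snd p))) p
    = stabilizer G \<phi> (fst p) \<inter> stabilizer G \<psi> (snd p)"
  by (auto simp: stabilizer_def prod_eq_iff)

lemma stabilizer_restrict: "x \<in> S \<Longrightarrow> stabilizer G (\<lambda>g. \<lambda>x\<in>S. \<phi> g x) x = stabilizer G \<phi> x"
  by (simp add: stabilizer_def)

section \<open>Profinite groups\<close>

lemma sub_top_group_simps [simp]:
  "carrier (sub_top_group G H) = H" "x \<otimes>\<^bsub>sub_top_group G H\<^esub> y = x \<otimes>\<^bsub>G\<^esub> y"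
  "\<one>\<^bsub>sub_top_group G H\<^esub> = \<one>\<^bsub>G\<^esub>" "gtopology (sub_top_group G H) = subtopology (gtopology G) H"
  by (simp_all add: sub_top_group_def)

context profinite_group
begin

abbreviation "Gtop \<equiv> gtopology G"
abbreviation "ONS \<equiv> open_normal_subgroups G"

lemma compact_Gtop: "compact_space Gtop"
  using profinite_topology by (simp add: profinite_space_def)

lemma continuous_map_mult:
  assumes "continuous_map X Gtop f" "continuous_map X Gtop g"
  shows "continuous_map X Gtop (\<lambda>x. f x \<otimes> g x)"
  using continuous_map_compose[OF continuous_map_pairedI[OF assms] continuous_mult] by (simp add: o_def)

lemma continuous_map_inv: "continuous_map X Gtop f \<Longrightarrow> continuous_map X Gtop (\<lambda>x. inv (f x))"
  using continuous_map_compose[OF _ continuous_inv] by (force simp: o_def)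

lemma openin_normal_translation_stabilizer:
  assumes C: "openin Gtop C" "closedin Gtop C"
  shows "openin Gtop (normal_translation_stabilizer C)"
proof -
  have K: "compactin (prod_topology Gtop Gtop) (carrier G \<times> C)"
    using compact_Gtop closedin_compact_space[OF compact_Gtop C(2)]
    by (simp add: compactin_Times compact_space_def topspace_gtopology)
  let ?P = "prod_topology Gtop (prod_topology Gtop Gtop)"
  have "continuous_map ?P Gtop (\<lambda>(x, g, c). g \<otimes> x \<otimes> inv g \<otimes> c)"
    "continuous_map ?P Gtop (\<lambda>(x, g, c). g \<otimes> inv x \<otimes> inv g \<otimes> c)"
    unfolding case_prod_beta
    by (intro continuous_map_mult continuous_map_inv continuous_map_fst continuous_map_fst_snd
        continuous_map_snd_snd)+
  note this[THEN openin_forall_compactin[OF _ K C(1)]]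
  from openin_Int[OF this] show ?thesis
    by (rule back_subst[of "openin Gtop"])
      (auto simp: normal_translation_stabilizer_def topspace_gtopology)
qed

lemma open_normal_inside:
  assumes D: "openin Gtop D" and one: "\<one> \<in> D"
  obtains N where "N \<in> ONS" "N \<subseteq> D"
proof -
  obtain C where C: "openin Gtop C" "closedin Gtop C" "\<one> \<in> C" "C \<subseteq> D"
    using profinite_space_clopen_neighbourhood[OF profinite_topology D one] by blast
  then have "C \<subseteq> carrier G" using openin_subset topspace_gtopology by fastforce
  then show thesis
    using that[of "normal_translation_stabilizer C"] normal_translation_stabilizer
      openin_normal_translation_stabilizer[OF C(1,2)] normal_translation_stabilizer_subset[OF C(3)] C(4)
    by (auto simp: open_normal_subgroups_def)
qed

lemma openin_r_coset:
  assumes A: "openin Gtop A" and g: "g \<in> carrier G"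
  shows "openin Gtop (A #> g)"
proof -
  have AG: "A \<subseteq> carrier G" using openin_subset[OF A] topspace_gtopology by simp
  have "openin Gtop {x \<in> topspace Gtop. x \<otimes> inv g \<in> A}"
    using g continuous_map_id[of Gtop]
    by (intro openin_continuous_map_preimage[OF continuous_map_mult A])
      (simp_all add: topspace_gtopology id_def)
  also have "{x \<in> topspace Gtop. x \<otimes> inv g \<in> A} = A #> g"
    using AG g by (force simp: r_coset_def topspace_gtopology m_assoc subset_iff)
  finally show ?thesis .
qed

lemma rcosets_open_partition:
  assumes H: "subgroup H G" "openin Gtop H"
  shows finite_rcosets_open_subgroup: "finite (rcosets H)"
    and closedin_open_subgroup: "closedin Gtop H"
proof -
  have part: "\<Union>(rcosets H) = topspace Gtop" "pairwise disjnt (rcosets H)"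
    using rcosets_part_G[OF H(1)] rcos_disjoint[OF H(1)] by (simp_all add: topspace_gtopology)
  have op: "openin Gtop C" and ne: "C \<noteq> {}" if "C \<in> rcosets H" for C
    using that openin_r_coset[OF H(2)] subgroup.rcosets_non_empty[OF H(1)] by (auto simp: RCOSETS_def)
  show "finite (rcosets H)"
    by (rule compact_space_finite_open_partition[OF compact_Gtop part op ne])
  show "closedin Gtop H"
    by (rule closedin_open_partition[OF part op subgroup.subgroup_in_rcosets[OF H(1) is_group]])
qed

lemma sub_top_group_is_group:
  assumes "subgroup H G"
  shows "group (sub_top_group G H)"
proof (rule groupI)
  fix x assume "x \<in> carrier (sub_top_group G H)"
  then show "\<exists>y\<in>carrier (sub_top_group G H). y \<otimes>\<^bsub>sub_top_group G H\<^esub> x = \<one>\<^bsub>sub_top_group G H\<^esub>"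
    using subgroup.m_inv_closed[OF assms, of x] subgroup.mem_carrier[OF assms, of x]
    by (intro bexI[of _ "inv x"]) simp_all
qed (use subgroup.m_closed[OF assms] subgroup.one_closed[OF assms] subgroup.mem_carrier[OF assms]
  in \<open>auto simp: m_assoc\<close>)

lemma sub_top_group_inv:
  assumes "subgroup H G" "x \<in> H"
  shows "inv\<^bsub>sub_top_group G H\<^esub> x = inv x"
  using m_inv_consistent[OF assms] by (simp add: m_inv_def)

lemma closed_subgroup_if_open: "subgroup H G \<Longrightarrow> openin Gtop H \<Longrightarrow> closed_subgroup H G"
  by (simp add: closed_subgroup_def closedin_open_subgroup)

lemma closed_subgroupD:
  assumes "closed_subgroup H G"
  shows closed_subgroup_subgroup: "subgroup H G" and closed_subgroup_closedin: "closedin Gtop H"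
    and closed_subgroup_subset: "H \<subseteq> carrier G"
  using assms subgroup.subset by (auto simp: closed_subgroup_def)

lemma closed_subgroup_Int: "closed_subgroup H G \<Longrightarrow> closed_subgroup K G \<Longrightarrow> closed_subgroup (H \<inter> K) G"
  by (auto simp: closed_subgroup_def subgroups_Inter_pair)

lemma conjugate_eq_vimage:
  assumes "x \<in> carrier G" "H \<subseteq> carrier G"
  shows "conjugate x H = {g \<in> topspace Gtop. inv x \<otimes> g \<otimes> x \<in> H}"
  using assms by (auto simp: mem_conjugate_iff topspace_gtopology)

lemma continuous_map_conjugation:
  "x \<in> carrier G \<Longrightarrow> continuous_map Gtop Gtop (\<lambda>g. inv x \<otimes> g \<otimes> x)"
  using continuous_map_id[of Gtop]
  by (intro continuous_map_mult) (simp_all add: topspace_gtopology id_def)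

lemma openin_conjugate:
  assumes "openin Gtop H" "x \<in> carrier G"
  shows "openin Gtop (conjugate x H)"
proof -
  have "H \<subseteq> carrier G" using openin_subset[OF assms(1)] topspace_gtopology by simp
  then show ?thesis
    unfolding conjugate_eq_vimage[OF assms(2) \<open>H \<subseteq> carrier G\<close>]
    by (intro openin_continuous_map_preimage[OF continuous_map_conjugation] assms)
qed

lemma closed_subgroup_conjugate:
  assumes H: "closed_subgroup H G" and x: "x \<in> carrier G"
  shows "closed_subgroup (conjugate x H) G"
  unfolding closed_subgroup_def
proof
  show "subgroup (conjugate x H) G"
    by (rule subgroup_conjugation_is_surj2[OF x closed_subgroup_subgroup[OF H]])
  show "closedin Gtop (conjugate x H)"
    unfolding conjugate_eq_vimage[OF x closed_subgroup_subset[OF H]]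
    by (rule closedin_continuous_map_preimage[OF continuous_map_conjugation[OF x]
        closed_subgroup_closedin[OF H]])
qed

lemma open_normal_Int: "N \<in> ONS \<Longrightarrow> M \<in> ONS \<Longrightarrow> N \<inter> M \<in> ONS"
  by (auto simp: open_normal_subgroups_def normal_subgroup_intersect)

lemma carrier_open_normal: "carrier G \<in> ONS"
  using openin_topspace[of Gtop] topspace_gtopology normal_inv_iff[of "carrier G"] subgroup_self
  by (simp add: open_normal_subgroups_def)

lemma open_normalD:
  assumes "N \<in> ONS"
  shows open_normal_normal: "N \<lhd> G" and open_normal_subgroup: "subgroup N G"
    and open_normal_openin: "openin Gtop N" and open_normal_subset: "N \<subseteq> carrier G"
    and open_normal_finite_cosets: "finite (carrier (G Mod N))"
proof -
  show n: "N \<lhd> G" and o: "openin Gtop N" using assms by (auto simp: open_normal_subgroups_def)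
  show s: "subgroup N G" by (rule normal_imp_subgroup[OF n])
  show "N \<subseteq> carrier G" by (rule subgroup.subset[OF s])
  show "finite (carrier (G Mod N))" using finite_rcosets_open_subgroup[OF s o]
    by (simp add: FactGroup_def)
qed

lemma profinite_sub_top_group:
  assumes H: "closed_subgroup H G"
  shows "profinite_group (sub_top_group G H)"
proof (intro profinite_group.intro profinite_group_axioms.intro)
  let ?S = "subtopology Gtop H"
  have sub: "subgroup H G" by (rule closed_subgroup_subgroup[OF H])
  show "group (sub_top_group G H)" by (rule sub_top_group_is_group[OF sub])
  show "topspace (gtopology (sub_top_group G H)) = carrier (sub_top_group G H)"
    using closed_subgroup_subset[OF H] by (auto simp: topspace_gtopology)
  show "profinite_space (gtopology (sub_top_group G H))"
    using profinite_space_closed_subtopology[OF profinite_topology closed_subgroup_closedin[OF H]] by simp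
  have "continuous_map (prod_topology ?S ?S) Gtop (\<lambda>(x, y). x \<otimes> y)"
    unfolding case_prod_beta
    by (intro continuous_map_mult continuous_map_into_fulltopology[OF continuous_map_fst]
        continuous_map_into_fulltopology[OF continuous_map_snd])
  then show "continuous_map
      (prod_topology (gtopology (sub_top_group G H)) (gtopology (sub_top_group G H)))
      (gtopology (sub_top_group G H)) (\<lambda>(x, y). x \<otimes>\<^bsub>sub_top_group G H\<^esub> y)"
    using subgroup.m_closed[OF sub] by (auto simp: continuous_map_in_subtopology)
  have "continuous_map ?S ?S (\<lambda>x. inv x)"
    using continuous_map_from_subtopology[OF continuous_inv] subgroup.m_inv_closed[OF sub]
    by (auto simp: continuous_map_in_subtopology)
  then show "continuous_map (gtopology (sub_top_group G H)) (gtopology (sub_top_group G H))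
      (\<lambda>x. inv\<^bsub>sub_top_group G H\<^esub> x)"
    by (simp, rule continuous_map_eq) (simp add: sub_top_group_inv[OF sub])
qed

lemma open_normal_sub_top_group:
  assumes H: "closed_subgroup H G" and N: "N \<in> ONS"
  shows "H \<inter> N \<in> open_normal_subgroups (sub_top_group G H)"
proof -
  have "H \<inter> N \<lhd> G\<lparr>carrier := H\<rparr>"
    using normal_Int_subgroup[OF closed_subgroup_subgroup[OF H] open_normal_normal[OF N]]
    by (simp add: Int_commute)
  then have "H \<inter> N \<lhd> sub_top_group G H"
    using sub_top_group_is_group[OF closed_subgroup_subgroup[OF H]]
    by (simp add: normal_def normal_axioms_def subgroup_def r_coset_def l_coset_def m_inv_def)
  moreover have "openin (subtopology Gtop H) (H \<inter> N)"
    using open_normal_openin[OF N] by (metis openin_subtopology_Int2)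
  ultimately show ?thesis by (simp add: open_normal_subgroups_def)
qed

lemma rcosets_action_open_kernel:
  assumes H: "subgroup H G" "openin Gtop H"
  obtains L where "L \<in> ONS" "\<And>g C. g \<in> L \<Longrightarrow> C \<in> rcosets H \<Longrightarrow> C #> inv g = C"
proof -
  obtain L where L: "L \<in> ONS" "L \<subseteq> H"
    using open_normal_inside[OF H(2) subgroup.one_closed[OF H(1)]] by blast
  show thesis
  proof (rule that[OF L(1)])
    fix g C assume g: "g \<in> L" and C: "C \<in> rcosets H"
    then obtain x where x: "x \<in> carrier G" "C = H #> x" by (auto simp: RCOSETS_def)
    have "g \<in> carrier G" using g open_normal_subset[OF L(1)] by blast
    moreover have "x \<otimes> g \<otimes> inv x \<in> H"
      using normal.inv_op_closed2[OF open_normal_normal[OF L(1)] x(1) g] L(2) by blast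
    ultimately have "g \<in> conjugate (inv x) H"
      using mem_conjugate_iff[of "inv x" H g] x(1) subgroup.subset[OF H(1)] by simp
    then show "C #> inv g = C"
      using C unfolding stabilizer_rcoset[OF H(1) x(1), symmetric] x(2) by (simp add: stabilizer_def)
  qed
qed

lemma mult_open_normal:
  assumes H: "subgroup H G" and N: "N \<in> ONS"
  shows subgroup_mult_open_normal: "subgroup (N <#> H) G"
    and openin_mult_open_normal: "openin Gtop (N <#> H)"
    and subset_mult_open_normal: "H \<subseteq> N <#> H" "N \<subseteq> N <#> H"
proof -
  have HG: "H \<subseteq> carrier G" by (rule subgroup.subset[OF H])
  show "subgroup (N <#> H) G" by (rule mult_norm_subgroup[OF open_normal_normal[OF N] H])
  have "N <#> H = (\<Union>h\<in>H. N #> h)" by (auto simp: set_mult_def r_coset_def)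
  also have "openin Gtop \<dots>"
    by (rule openin_Union) (use openin_r_coset[OF open_normal_openin[OF N]] HG in auto)
  finally show "openin Gtop (N <#> H)" .
  have one: "\<one> \<in> N" "\<one> \<in> H" using H open_normal_subgroup[OF N] by (auto intro: subgroup.one_closed)
  show "H \<subseteq> N <#> H" using one(1) HG unfolding set_mult_def by force
  show "N \<subseteq> N <#> H" using one(2) open_normal_subset[OF N] unfolding set_mult_def by force
qed

lemma Inter_mult_open_normal:
  assumes H: "closed_subgroup H G"
  shows "(\<Inter>N\<in>ONS. N <#> H) = H"
proof
  note HG = closed_subgroup_subset[OF H]
  show "(\<Inter>N\<in>ONS. N <#> H) \<subseteq> H"
  proof (rule ccontr)
    assume "\<not> (\<Inter>N\<in>ONS. N <#> H) \<subseteq> H"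
    then obtain g where g: "g \<notin> H" "\<And>N. N \<in> ONS \<Longrightarrow> g \<in> N <#> H" by blast
    have gG: "g \<in> carrier G"
      using g(2)[OF carrier_open_normal] set_mult_closed[OF order_refl HG] by blast
    have "continuous_map Gtop Gtop (\<lambda>n. inv n \<otimes> g)"
      by (rule continuous_map_mult[OF continuous_inv]) (simp add: gG topspace_gtopology)
    then have "openin Gtop {n \<in> topspace Gtop. inv n \<otimes> g \<in> topspace Gtop - H}"
      by (rule openin_continuous_map_preimage) (use closed_subgroup_closedin[OF H] in blast)
    moreover have "\<one> \<in> {n \<in> topspace Gtop. inv n \<otimes> g \<in> topspace Gtop - H}"
      using g(1) gG by (simp add: topspace_gtopology)
    ultimately obtain N where N: "N \<in> ONS" "N \<subseteq> {n \<in> topspace Gtop. inv n \<otimes> g \<in> topspace Gtop - H}"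
      by (rule open_normal_inside)
    obtain n h where nh: "n \<in> N" "h \<in> H" "g = n \<otimes> h" using g(2)[OF N(1)] by (auto simp: set_mult_def)
    then have "inv n \<otimes> g = h"
      using HG open_normal_subset[OF N(1)] by (auto simp: subset_iff simp flip: m_assoc)
    then show False using N(2) nh(1,2) by blast
  qed
  show "H \<subseteq> (\<Inter>N\<in>ONS. N <#> H)"
    using subset_mult_open_normal(1)[OF closed_subgroup_subgroup[OF H]] by blast
qed

text \<open>For fixed \<open>N\<close> the solutions of \<open>P N\<close> form a union of cosets of \<open>N\<close>, hence a closed set.\<close>

lemma compact_simultaneous_solution:
  assumes ex: "\<And>N. N \<in> ONS \<Longrightarrow> \<exists>x\<in>carrier G. P N x"
    and mono: "\<And>N M x. N \<in> ONS \<Longrightarrow> M \<in> ONS \<Longrightarrow> x \<in> carrier G \<Longrightarrow> N \<subseteq> M \<Longrightarrow> P N x \<Longrightarrow> P M x"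
    and invariant: "\<And>N n x. N \<in> ONS \<Longrightarrow> n \<in> N \<Longrightarrow> x \<in> carrier G \<Longrightarrow> P N (n \<otimes> x) \<longleftrightarrow> P N x"
  shows "\<exists>x\<in>carrier G. \<forall>N\<in>ONS. P N x"
proof -
  let ?C = "\<lambda>N. {x \<in> carrier G. P N x}"
  have "(\<Inter>N\<in>ONS. ?C N) \<noteq> {}"
  proof (rule compact_space_directed_Inter[OF compact_Gtop])
    show "ONS \<noteq> {}" using carrier_open_normal by blast
    fix N assume N: "N \<in> ONS"
    have "openin Gtop (carrier G - ?C N)"
    proof (subst openin_subopen, intro ballI)
      fix x assume x: "x \<in> carrier G - ?C N"
      have "N #> x \<subseteq> carrier G - ?C N"
        using x invariant[OF N] open_normal_subset[OF N] by (auto simp: r_coset_def)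
      then show "\<exists>T. openin Gtop T \<and> x \<in> T \<and> T \<subseteq> carrier G - ?C N"
        using openin_r_coset[OF open_normal_openin[OF N]] rcos_self[OF _ open_normal_subgroup[OF N]] x
        by blast
    qed
    then show "closedin Gtop (?C N)" by (simp add: closedin_def topspace_gtopology)
    show "?C N \<noteq> {}" using ex[OF N] by blast
    fix M assume M: "M \<in> ONS"
    have "?C (N \<inter> M) \<subseteq> ?C N \<inter> ?C M"
      using mono[of "N \<inter> M"] open_normal_Int[OF N M] N M by auto
    then show "\<exists>L\<in>ONS. ?C L \<subseteq> ?C N \<inter> ?C M" using open_normal_Int[OF N M] by blast
  qed
  then show ?thesis by (auto simp: ex_in_conv[symmetric] intro: carrier_open_normal)
qed

end

section \<open>Elements of the completed group algebra\<close>

definition group_algebra_point ::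
    "('k, 'a) ring_scheme \<Rightarrow> ('h, 'b) monoid_scheme \<Rightarrow> 'k \<Rightarrow> 'h \<Rightarrow> 'h \<Rightarrow> 'k" where
  "group_algebra_point k G c x = (\<lambda>z\<in>carrier G. if z = x then c else \<zero>\<^bsub>k\<^esub>)"

lemma group_algebra_point_mult:
  assumes k: "ring k" and G: "group G"
    and c: "c \<in> carrier k" "d \<in> carrier k" and x: "x \<in> carrier G" "y \<in> carrier G"
  shows "group_algebra_point k G c x \<otimes>\<^bsub>group_algebra k G\<^esub> group_algebra_point k G d y
    = group_algebra_point k G (c \<otimes>\<^bsub>k\<^esub> d) (x \<otimes>\<^bsub>G\<^esub> y)"
proof -
  interpret k: ring k by fact
  interpret G: group G by fact
  let ?p = "group_algebra_point k G c x" and ?q = "group_algebra_point k G d y"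
  have "(\<Oplus>\<^bsub>k\<^esub>u\<in>{u \<in> carrier G. ?p u \<noteq> \<zero>\<^bsub>k\<^esub>}. ?p u \<otimes>\<^bsub>k\<^esub> ?q (inv\<^bsub>G\<^esub> u \<otimes>\<^bsub>G\<^esub> z))
      = (if z = x \<otimes>\<^bsub>G\<^esub> y then c \<otimes>\<^bsub>k\<^esub> d else \<zero>\<^bsub>k\<^esub>)" if z: "z \<in> carrier G" for z
  proof (cases "c = \<zero>\<^bsub>k\<^esub>")
    case True
    then have "{u \<in> carrier G. ?p u \<noteq> \<zero>\<^bsub>k\<^esub>} = {}" by (auto simp: group_algebra_point_def)
    then show ?thesis using True c by (simp only: k.finsum_empty) simp
  next
    case False
    then have "{u \<in> carrier G. ?p u \<noteq> \<zero>\<^bsub>k\<^esub>} = {x}" using x by (auto simp: group_algebra_point_def)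
    moreover have "inv\<^bsub>G\<^esub> x \<otimes>\<^bsub>G\<^esub> z = y \<longleftrightarrow> z = x \<otimes>\<^bsub>G\<^esub> y" using G.inv_solve_left[of y x z] x z by auto
    ultimately show ?thesis
      using c x z by (simp add: group_algebra_point_def k.finsum_insert)
  qed
  then show ?thesis
    by (simp add: group_algebra_def group_algebra_point_def[of k G "c \<otimes>\<^bsub>k\<^esub> d"] cong: restrict_cong)
qed

definition cga_point ::
    "('k, 'a) ring_scheme \<Rightarrow> ('g, 'b) top_group_scheme \<Rightarrow> 'k \<Rightarrow> 'g \<Rightarrow> ('g, 'k) cga" where
  "cga_point k G c g =
    (\<lambda>N\<in>open_normal_subgroups G. group_algebra_point k (G Mod N) c (N #>\<^bsub>G\<^esub> g))"

locale profinite_group_algebra = G: profinite_group G + k: field k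
  for k :: "('k, 'a) ring_scheme" and G :: "('g, 'b) top_group_scheme" +
  assumes finite_k: "finite (carrier k)"
begin

abbreviation "ONS \<equiv> open_normal_subgroups G"
abbreviation "cosets N \<equiv> carrier (G Mod N)"
abbreviation "KG \<equiv> completed_group_algebra k G"
abbreviation "KGtop \<equiv> rtopology KG"
abbreviation "pt \<equiv> cga_point k G"

lemma coset_of:
  assumes "N \<in> ONS" "g \<in> carrier G"
  shows "N #>\<^bsub>G\<^esub> g \<in> cosets N" "g \<in> N #>\<^bsub>G\<^esub> g"
  using assms G.rcos_self[OF _ G.open_normal_subgroup] by (auto simp: carrier_FactGroup)

lemma coset_eqI:
  assumes "N \<in> ONS" "C \<in> cosets N" "z \<in> C"
  shows "C = N #>\<^bsub>G\<^esub> z" "z \<in> carrier G"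
proof -
  obtain x where x: "x \<in> carrier G" "C = N #>\<^bsub>G\<^esub> x" using assms(2) by (auto simp: carrier_FactGroup)
  then show "C = N #>\<^bsub>G\<^esub> z"
    using G.repr_independence[OF _ _ G.open_normal_subgroup[OF assms(1)]] assms(3) by blast
  show "z \<in> carrier G" using x assms(3) G.open_normal_subset[OF assms(1)] G.r_coset_subset_G by blast
qed

lemma coset_unique:
  assumes "N \<in> ONS" "C \<in> cosets N" "D \<in> cosets N" "z \<in> C" "z \<in> D"
  shows "C = D"
  using coset_eqI(1)[OF assms(1,2,4)] coset_eqI(1)[OF assms(1,3,5)] by simp

lemma coset_nonempty: "N \<in> ONS \<Longrightarrow> C \<in> cosets N \<Longrightarrow> \<exists>z. z \<in> C"
  using coset_of(2) by (auto simp: carrier_FactGroup)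

lemma finite_cosets: "N \<in> ONS \<Longrightarrow> finite {C \<in> cosets N. P C}"
  using G.open_normal_finite_cosets by simp

definition saturated :: "'g set \<Rightarrow> 'g set \<Rightarrow> bool" where
  "saturated N S \<longleftrightarrow> (\<forall>C\<in>cosets N. \<forall>z\<in>C. z \<in> S \<longrightarrow> C \<subseteq> S)"

lemma saturatedD: "saturated N S \<Longrightarrow> C \<in> cosets N \<Longrightarrow> z \<in> C \<Longrightarrow> z \<in> S \<Longrightarrow> C \<subseteq> S"
  by (auto simp: saturated_def)

lemma saturated_mono:
  assumes N: "N \<in> ONS" and M: "M \<in> ONS" and NM: "N \<subseteq> M" and S: "saturated M S"
  shows "saturated N S"
  unfolding saturated_def
proof (intro ballI impI)
  fix C z assume C: "C \<in> cosets N" "z \<in> C" and z: "z \<in> S"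
  have "C \<subseteq> M #>\<^bsub>G\<^esub> z" using coset_eqI(1)[OF N C] NM by (auto simp: r_coset_def)
  also have "\<dots> \<subseteq> S" using saturatedD[OF S coset_of[OF M coset_eqI(2)[OF N C]] z] .
  finally show "C \<subseteq> S" .
qed

lemma saturated_coset:
  assumes "N \<in> ONS" "M \<in> ONS" "N \<subseteq> M" "C \<in> cosets M"
  shows "saturated N C"
  by (rule saturated_mono[OF assms(1-3)])
    (use coset_unique[OF assms(2)] assms(4) in \<open>auto simp: saturated_def\<close>)

lemma saturated_Int: "saturated N S \<Longrightarrow> saturated N T \<Longrightarrow> saturated N (S \<inter> T)"
  unfolding saturated_def by blast

text \<open>A function on \<open>G/N\<close> is a finitely additive \<open>k\<close>-valued measure on the unions of cosets of \<open>N\<close>; an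
  element of \<open>k[[G]]\<close> is one on the clopen subsets of \<open>G\<close>.\<close>

definition mass :: "'g set \<Rightarrow> 'g set \<Rightarrow> ('g set \<Rightarrow> 'k) \<Rightarrow> 'k" where
  "mass N S v = (\<Oplus>\<^bsub>k\<^esub>C\<in>{C \<in> cosets N. C \<subseteq> S}. v C)"

lemma mass_closed: "v \<in> cosets N \<rightarrow> carrier k \<Longrightarrow> mass N S v \<in> carrier k"
  by (auto simp: mass_def intro!: k.finsum_closed)

lemma mass_add:
  "v \<in> cosets N \<rightarrow> carrier k \<Longrightarrow> w \<in> cosets N \<rightarrow> carrier k \<Longrightarrow>
    mass N S (\<lambda>C. v C \<oplus>\<^bsub>k\<^esub> w C) = mass N S v \<oplus>\<^bsub>k\<^esub> mass N S w"
  unfolding mass_def by (rule k.finsum_addf) auto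

lemma mass_cong: "(\<And>C. C \<in> cosets N \<Longrightarrow> v C = w C) \<Longrightarrow> w \<in> cosets N \<rightarrow> carrier k \<Longrightarrow> mass N S v = mass N S w"
  unfolding mass_def by (rule k.finsum_cong') auto

lemma mass_partition:
  assumes N: "N \<in> ONS" and v: "v \<in> cosets N \<rightarrow> carrier k" and I: "finite I"
    and cover: "\<And>C. C \<in> cosets N \<Longrightarrow> C \<subseteq> S \<Longrightarrow> \<exists>i\<in>I. C \<subseteq> T i" and sub: "\<And>i. i \<in> I \<Longrightarrow> T i \<subseteq> S"
    and disj: "\<And>i j. i \<in> I \<Longrightarrow> j \<in> I \<Longrightarrow> i \<noteq> j \<Longrightarrow> T i \<inter> T j = {}"
  shows "mass N S v = (\<Oplus>\<^bsub>k\<^esub>i\<in>I. mass N (T i) v)"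
proof -
  let ?A = "\<lambda>i. {C \<in> cosets N. C \<subseteq> T i}"
  have "pairwise (\<lambda>i j. disjnt (?A i) (?A j)) I"
    unfolding pairwise_def disjnt_iff using disj coset_nonempty[OF N] by blast
  then have "(\<Oplus>\<^bsub>k\<^esub>C\<in>\<Union>(?A ` I). v C) = (\<Oplus>\<^bsub>k\<^esub>i\<in>I. \<Oplus>\<^bsub>k\<^esub>C\<in>?A i. v C)"
    using v finite_cosets[OF N] by (intro k.add.finprod_UN_disjoint I) auto
  moreover have "\<Union>(?A ` I) = {C \<in> cosets N. C \<subseteq> S}"
  proof (rule Set.set_eqI)
    show "C \<in> \<Union>(?A ` I) \<longleftrightarrow> C \<in> {C \<in> cosets N. C \<subseteq> S}" for C using cover[of C] sub by blast
  qed
  ultimately show ?thesis by (simp add: mass_def)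
qed

lemma carrier_group_algebra:
  "N \<in> ONS \<Longrightarrow> carrier (group_algebra k (G Mod N)) = cosets N \<rightarrow>\<^sub>E carrier k"
  using finite_cosets by (auto simp: group_algebra_def)

lemma carrier_KG:
  "carrier KG = {a \<in> (\<Pi>\<^sub>E N\<in>ONS. cosets N \<rightarrow>\<^sub>E carrier k).
    \<forall>N\<in>ONS. \<forall>M\<in>ONS. N \<subseteq> M \<longrightarrow> a M = coset_push k (cosets N) (cosets M) (a N)}"
proof -
  have "(\<Pi>\<^sub>E N\<in>ONS. carrier (group_algebra k (G Mod N))) = (\<Pi>\<^sub>E N\<in>ONS. cosets N \<rightarrow>\<^sub>E carrier k)"
    by (rule PiE_cong) (rule carrier_group_algebra)
  then show ?thesis by (simp only: completed_group_algebra_def cga_carrier_def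
      partial_object.select_convs)
qed

lemma KG_in_PiE: "a \<in> carrier KG \<Longrightarrow> a \<in> (\<Pi>\<^sub>E N\<in>ONS. cosets N \<rightarrow>\<^sub>E carrier k)"
  by (simp only: carrier_KG mem_Collect_eq)

lemma KG_component: "a \<in> carrier KG \<Longrightarrow> N \<in> ONS \<Longrightarrow> a N \<in> cosets N \<rightarrow>\<^sub>E carrier k"
  by (rule PiE_mem[OF KG_in_PiE])

lemma KG_component_maps: "a \<in> carrier KG \<Longrightarrow> N \<in> ONS \<Longrightarrow> a N \<in> cosets N \<rightarrow> carrier k"
  using KG_component by (simp add: PiE_def)

lemma KG_mass:
  assumes "a \<in> carrier KG" "N \<in> ONS" "M \<in> ONS" "N \<subseteq> M" "C \<in> cosets M"
  shows "a M C = mass N C (a N)"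
proof -
  have "a M = coset_push k (cosets N) (cosets M) (a N)"
    using assms(1-4) unfolding carrier_KG by blast
  then show ?thesis using assms(5) by (simp add: coset_push_def mass_def)
qed

lemma KG_memI:
  assumes ext: "a \<in> extensional ONS" and comp: "\<And>N. N \<in> ONS \<Longrightarrow> a N \<in> cosets N \<rightarrow>\<^sub>E carrier k"
    and mass: "\<And>N M C. N \<in> ONS \<Longrightarrow> M \<in> ONS \<Longrightarrow> N \<subseteq> M \<Longrightarrow> C \<in> cosets M \<Longrightarrow> a M C = mass N C (a N)"
  shows "a \<in> carrier KG"
proof -
  have compatible: "a M = coset_push k (cosets N) (cosets M) (a N)" if "N \<in> ONS" "M \<in> ONS" "N \<subseteq> M" for N M
  proof (rule extensionalityI)
    show "a M \<in> extensional (cosets M)" using comp[OF that(2)] by (simp add: PiE_def)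
    show "a M C = coset_push k (cosets N) (cosets M) (a N) C" if "C \<in> cosets M" for C
      using mass[OF \<open>N \<in> ONS\<close> \<open>M \<in> ONS\<close> \<open>N \<subseteq> M\<close> that] that by (simp add: coset_push_def mass_def)
  qed (simp add: coset_push_def)
  have "a \<in> (\<Pi>\<^sub>E N\<in>ONS. cosets N \<rightarrow>\<^sub>E carrier k)" using ext comp by (simp add: PiE_iff)
  then show ?thesis unfolding carrier_KG mem_Collect_eq by (intro conjI ballI impI compatible)
qed

lemma KG_component_ext:
  assumes "a \<in> carrier KG" "b \<in> carrier KG" "N \<in> ONS" "\<And>C. C \<in> cosets N \<Longrightarrow> a N C = b N C"
  shows "a N = b N"
  by (rule PiE_ext[OF KG_component[OF assms(1,3)] KG_component[OF assms(2,3)] assms(4)])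

lemma KG_ext:
  assumes "a \<in> carrier KG" "b \<in> carrier KG" "\<And>N C. N \<in> ONS \<Longrightarrow> C \<in> cosets N \<Longrightarrow> a N C = b N C"
  shows "a = b"
  by (rule PiE_ext[OF KG_in_PiE[OF assms(1)] KG_in_PiE[OF assms(2)]])
    (rule KG_component_ext[OF assms(1,2) _ assms(3)])

lemma KG_component_mono:
  assumes "a \<in> carrier KG" "b \<in> carrier KG" "N \<in> ONS" "M \<in> ONS" "N \<subseteq> M" "a N = b N"
  shows "a M = b M"
  by (rule KG_component_ext[OF assms(1,2,4)])
    (use KG_mass[OF assms(1,3-5)] KG_mass[OF assms(2,3-5)] assms(6) in simp)

lemma mass_refine:
  assumes a: "a \<in> carrier KG" and NM: "N \<in> ONS" "M \<in> ONS" "N \<subseteq> M" and S: "saturated M S"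
  shows "mass N S (a N) = mass M S (a M)"
proof -
  let ?I = "{C \<in> cosets M. C \<subseteq> S}"
  have "mass N S (a N) = (\<Oplus>\<^bsub>k\<^esub>C\<in>?I. mass N C (a N))"
  proof (rule mass_partition[OF NM(1) KG_component_maps[OF a NM(1)]])
    fix D assume D: "D \<in> cosets N" "D \<subseteq> S"
    obtain z where z: "z \<in> D" using coset_nonempty[OF NM(1) D(1)] by blast
    have E: "M #>\<^bsub>G\<^esub> z \<in> cosets M" "z \<in> M #>\<^bsub>G\<^esub> z"
      using coset_of[OF NM(2) coset_eqI(2)[OF NM(1) D(1) z]] by auto
    then show "\<exists>C\<in>?I. D \<subseteq> C"
      using saturatedD[OF saturated_coset[OF NM E(1)] D(1) z] saturatedD[OF S E] z D(2) by blast
  next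
    fix C D assume "C \<in> ?I" "D \<in> ?I" "C \<noteq> D"
    then show "C \<inter> D = {}" using coset_unique[OF NM(2)] by blast
  qed (use finite_cosets[OF NM(2)] in auto)
  also have "\<dots> = mass M S (a M)"
    unfolding mass_def[of M] using KG_mass[OF a NM] KG_component_maps[OF a NM(2)]
    by (intro k.finsum_cong') auto
  finally show ?thesis .
qed

lemma KG_add: "N \<in> ONS \<Longrightarrow> C \<in> cosets N \<Longrightarrow> (a \<oplus>\<^bsub>KG\<^esub> b) N C = a N C \<oplus>\<^bsub>k\<^esub> b N C"
  by (simp add: completed_group_algebra_def group_algebra_def)

lemma KG_zero: "N \<in> ONS \<Longrightarrow> C \<in> cosets N \<Longrightarrow> \<zero>\<^bsub>KG\<^esub> N C = \<zero>\<^bsub>k\<^esub>"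
  by (simp add: completed_group_algebra_def group_algebra_def)

lemma KG_mult: "N \<in> ONS \<Longrightarrow> (a \<otimes>\<^bsub>KG\<^esub> b) N = a N \<otimes>\<^bsub>group_algebra k (G Mod N)\<^esub> b N"
  by (simp add: completed_group_algebra_def)

lemma KG_zero_closed: "\<zero>\<^bsub>KG\<^esub> \<in> carrier KG"
proof (rule KG_memI)
  show "\<zero>\<^bsub>KG\<^esub> M C = mass N C (\<zero>\<^bsub>KG\<^esub> N)" if "N \<in> ONS" "M \<in> ONS" "C \<in> cosets M" for N M C
    using that unfolding mass_def by (subst k.add.finprod_one_eqI) (simp_all add: KG_zero)
qed (auto simp: completed_group_algebra_def group_algebra_def)

lemma KG_add_closed:
  assumes a: "a \<in> carrier KG" and b: "b \<in> carrier KG"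
  shows "a \<oplus>\<^bsub>KG\<^esub> b \<in> carrier KG"
proof (rule KG_memI)
  note maps = KG_component_maps[OF a] KG_component_maps[OF b]
  show "a \<oplus>\<^bsub>KG\<^esub> b \<in> extensional ONS" by (simp add: completed_group_algebra_def)
  show "(a \<oplus>\<^bsub>KG\<^esub> b) N \<in> cosets N \<rightarrow>\<^sub>E carrier k" if "N \<in> ONS" for N
    using maps[OF that] that by (auto simp: completed_group_algebra_def group_algebra_def)
  fix N M C assume NM: "N \<in> ONS" "M \<in> ONS" "N \<subseteq> M" "C \<in> cosets M"
  have "(a \<oplus>\<^bsub>KG\<^esub> b) M C = mass N C (a N) \<oplus>\<^bsub>k\<^esub> mass N C (b N)"
    using NM KG_mass[OF a NM] KG_mass[OF b NM] by (simp add: KG_add)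
  also have "\<dots> = mass N C ((a \<oplus>\<^bsub>KG\<^esub> b) N)"
    using maps[OF NM(1)] KG_add[OF NM(1)]
    by (subst mass_add[symmetric]) (auto intro!: mass_cong simp: Pi_iff)
  finally show "(a \<oplus>\<^bsub>KG\<^esub> b) M C = mass N C ((a \<oplus>\<^bsub>KG\<^esub> b) N)" .
qed

subsection \<open>Points\<close>

lemma pt_val:
  assumes "N \<in> ONS" "C \<in> cosets N" "g \<in> carrier G"
  shows "pt c g N C = (if g \<in> C then c else \<zero>\<^bsub>k\<^esub>)"
  using coset_of[OF assms(1,3)] coset_unique[OF assms(1,2)] assms(1,2)
  by (auto simp: cga_point_def group_algebra_point_def)

lemma mass_pt:
  assumes N: "N \<in> ONS" and S: "saturated N S" and c: "c \<in> carrier k" and g: "g \<in> carrier G"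
  shows "mass N S (pt c g N) = (if g \<in> S then c else \<zero>\<^bsub>k\<^esub>)"
proof -
  let ?I = "{C \<in> cosets N. C \<subseteq> S}" and ?C = "N #>\<^bsub>G\<^esub> g"
  have C: "?C \<in> cosets N" "g \<in> ?C" using coset_of[OF N g] by auto
  have "mass N S (pt c g N) = (\<Oplus>\<^bsub>k\<^esub>D\<in>?I. if D = ?C then c else \<zero>\<^bsub>k\<^esub>)"
    unfolding mass_def using c N by (intro k.finsum_cong')
      (auto simp: cga_point_def group_algebra_point_def)
  also have "\<dots> = (if g \<in> S then c else \<zero>\<^bsub>k\<^esub>)"
  proof (cases "g \<in> S")
    case True
    then have "?C \<in> ?I" using saturatedD[OF S C] C by blast
    then show ?thesis
      using k.add.finprod_singleton_swap[of ?C ?I "\<lambda>_. c"] finite_cosets[OF N] c True by simp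
  next
    case False
    then have "D \<noteq> ?C" if "D \<in> ?I" for D using that C(2) by blast
    then show ?thesis using False by (simp cong: k.finsum_cong)
  qed
  finally show ?thesis .
qed

lemma pt_closed:
  assumes c: "c \<in> carrier k" and g: "g \<in> carrier G"
  shows "pt c g \<in> carrier KG"
proof (rule KG_memI)
  show "pt c g \<in> extensional ONS" "\<And>N. N \<in> ONS \<Longrightarrow> pt c g N \<in> cosets N \<rightarrow>\<^sub>E carrier k"
    using c by (auto simp: cga_point_def group_algebra_point_def)
  show "pt c g M C = mass N C (pt c g N)" if NM: "N \<in> ONS" "M \<in> ONS" "N \<subseteq> M" "C \<in> cosets M" for N M C
    using mass_pt[OF NM(1) saturated_coset[OF NM] c g] pt_val[OF NM(2,4) g] by simp
qed

lemma pt_mult: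
  assumes c: "c \<in> carrier k" "d \<in> carrier k" and g: "g \<in> carrier G" "h \<in> carrier G"
  shows "pt c g \<otimes>\<^bsub>KG\<^esub> pt d h = pt (c \<otimes>\<^bsub>k\<^esub> d) (g \<otimes>\<^bsub>G\<^esub> h)"
proof (rule extensionalityI)
  fix N assume N: "N \<in> ONS"
  interpret N: normal N G by (rule G.open_normal_normal[OF N])
  have "(pt c g \<otimes>\<^bsub>KG\<^esub> pt d h) N
      = group_algebra_point k (G Mod N) (c \<otimes>\<^bsub>k\<^esub> d) ((N #>\<^bsub>G\<^esub> g) \<otimes>\<^bsub>G Mod N\<^esub> (N #>\<^bsub>G\<^esub> h))"
    unfolding KG_mult[OF N] using c g N coset_of[OF N]
    by (simp add: cga_point_def group_algebra_point_mult[OF k.ring_axioms N.factorgroup_is_group])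
  also have "(N #>\<^bsub>G\<^esub> g) \<otimes>\<^bsub>G Mod N\<^esub> (N #>\<^bsub>G\<^esub> h) = N #>\<^bsub>G\<^esub> (g \<otimes>\<^bsub>G\<^esub> h)"
    using N.rcos_sum[OF g] by simp
  finally show "(pt c g \<otimes>\<^bsub>KG\<^esub> pt d h) N = pt (c \<otimes>\<^bsub>k\<^esub> d) (g \<otimes>\<^bsub>G\<^esub> h) N" using N
    by (simp only: cga_point_def restrict_apply')
qed (auto simp: completed_group_algebra_def cga_point_def)

lemma pt_one: "\<one>\<^bsub>KG\<^esub> = pt \<one>\<^bsub>k\<^esub> \<one>\<^bsub>G\<^esub>"
  using G.coset_mult_one[OF G.open_normal_subset]
  by (auto simp: completed_group_algebra_def group_algebra_def cga_point_def group_algebra_point_def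
      intro!: restrict_ext)

lemma pt_zero: "g \<in> carrier G \<Longrightarrow> pt \<zero>\<^bsub>k\<^esub> g = \<zero>\<^bsub>KG\<^esub>"
  by (rule KG_ext) (auto simp: pt_closed KG_zero_closed pt_val KG_zero)

subsection \<open>Topology\<close>

lemma topspace_KGtop: "topspace KGtop = carrier KG"
  by (rule topspace_completed_group_algebra)

lemma KGtop_eq:
  "KGtop = subtopology (product_topology (\<lambda>N. discrete_topology (cosets N \<rightarrow>\<^sub>E carrier k)) ONS)
    (carrier KG)"
proof -
  have "product_topology (\<lambda>N. discrete_topology (carrier (group_algebra k (G Mod N)))) ONS
      = product_topology (\<lambda>N. discrete_topology (cosets N \<rightarrow>\<^sub>E carrier k)) ONS"
    by (rule product_topology_cong) (simp add: carrier_group_algebra)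
  then show ?thesis by (simp add: completed_group_algebra_def)
qed

lemma openin_component:
  assumes N: "N \<in> ONS"
  shows "openin KGtop {a \<in> carrier KG. P (a N)}"
proof -
  have "continuous_map KGtop (discrete_topology (cosets N \<rightarrow>\<^sub>E carrier k)) (\<lambda>a. a N)"
    unfolding KGtop_eq by (intro continuous_map_from_subtopology continuous_map_product_projection N)
  then have "openin KGtop {a \<in> topspace KGtop. a N \<in> {v \<in> cosets N \<rightarrow>\<^sub>E carrier k. P v}}"
    by (rule openin_continuous_map_preimage) auto
  also have "{a \<in> topspace KGtop. a N \<in> {v \<in> cosets N \<rightarrow>\<^sub>E carrier k. P v}} = {a \<in> carrier KG. P (a N)}"
    using KG_component[OF _ N] unfolding topspace_KGtop by blast
  finally show ?thesis .
qed

lemma continuous_map_into_KG: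
  assumes f: "f \<in> topspace X \<rightarrow> carrier KG"
    and locally_const: "\<And>N x. N \<in> ONS \<Longrightarrow> x \<in> topspace X \<Longrightarrow>
      \<exists>U. openin X U \<and> x \<in> U \<and> (\<forall>y\<in>U. f y N = f x N)"
  shows "continuous_map X KGtop f"
  unfolding KGtop_eq continuous_map_in_subtopology continuous_map_componentwise
proof (intro conjI ballI)
  show "f ` topspace X \<subseteq> extensional ONS" using f KG_in_PiE by (auto simp: Pi_iff PiE_def)
  fix N assume N: "N \<in> ONS"
  show "continuous_map X (discrete_topology (cosets N \<rightarrow>\<^sub>E carrier k)) (\<lambda>x. f x N)"
    unfolding continuous_map_def
  proof (intro conjI allI impI)
    show "(\<lambda>x. f x N) \<in> topspace X \<rightarrow> topspace (discrete_topology (cosets N \<rightarrow>\<^sub>E carrier k))"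
      using f KG_component[OF _ N] by (simp add: Pi_iff)
    fix V
    show "openin X {x \<in> topspace X. f x N \<in> V}"
    proof (subst openin_subopen, intro ballI)
      fix x assume x: "x \<in> {x \<in> topspace X. f x N \<in> V}"
      then obtain U where U: "openin X U" "x \<in> U" "\<forall>y\<in>U. f y N = f x N"
        using locally_const[OF N] by blast
      have "y \<in> {x \<in> topspace X. f x N \<in> V}" if "y \<in> U" for y
        using U(3)[rule_format, OF that] x openin_subset[OF U(1)] that by auto
      with U show "\<exists>T. openin X T \<and> x \<in> T \<and> T \<subseteq> {x \<in> topspace X. f x N \<in> V}" by blast
    qed
  qed
qed (rule f)

lemma continuous_map_KG_KG:
  assumes f: "f \<in> carrier KG \<rightarrow> carrier KG"
    and determined: "\<And>N. N \<in> ONS \<Longrightarrow> \<exists>M\<in>ONS. \<forall>r\<in>carrier KG. \<forall>s\<in>carrier KG. r M = s M \<longrightarrow> f r N = f s N"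
  shows "continuous_map KGtop KGtop f"
proof (rule continuous_map_into_KG)
  fix N x assume N: "N \<in> ONS" and x: "x \<in> topspace KGtop"
  obtain M where M: "M \<in> ONS" "\<And>r s. r \<in> carrier KG \<Longrightarrow> s \<in> carrier KG \<Longrightarrow> r M = s M \<Longrightarrow> f r N = f s N"
    using determined[OF N] by blast
  show "\<exists>U. openin KGtop U \<and> x \<in> U \<and> (\<forall>y\<in>U. f y N = f x N)"
    using openin_component[OF M(1), of "\<lambda>v. v = x M"] x M(2) unfolding topspace_KGtop
    by (intro exI[of _ "{s \<in> carrier KG. s M = x M}"]) blast
qed (use f in \<open>simp add: topspace_KGtop\<close>)

lemma KG_neighbourhood:
  assumes D: "openin KGtop D" and r: "r \<in> D"
  shows "\<exists>N\<in>ONS. \<forall>s\<in>carrier KG. s N = r N \<longrightarrow> s \<in> D"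
proof -
  let ?P = "product_topology (\<lambda>N. discrete_topology (cosets N \<rightarrow>\<^sub>E carrier k)) ONS"
  obtain T where T: "openin ?P T" "D = T \<inter> carrier KG"
    using D unfolding KGtop_eq openin_subtopology by blast
  then obtain U where U: "finite {N \<in> ONS. U N \<noteq> (cosets N \<rightarrow>\<^sub>E carrier k)}" "r \<in> Pi\<^sub>E ONS U" "Pi\<^sub>E ONS U \<subseteq> T"
    using r unfolding openin_product_topology_alt by fastforce
  have "\<exists>M\<in>ONS. M \<subseteq> (\<Inter>N\<in>{N \<in> ONS. U N \<noteq> (cosets N \<rightarrow>\<^sub>E carrier k)}. N)"
    by (rule finite_directed_lower_bound[OF U(1)]) (use G.open_normal_Int G.carrier_open_normal in auto)
  then obtain M where M: "M \<in> ONS" "\<And>N. N \<in> ONS \<Longrightarrow> U N \<noteq> (cosets N \<rightarrow>\<^sub>E carrier k) \<Longrightarrow> M \<subseteq> N"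
    by (auto simp: subset_iff)
  have "s \<in> D" if s: "s \<in> carrier KG" "s M = r M" for s
  proof -
    have rK: "r \<in> carrier KG" using r T by blast
    have "s N \<in> U N" if N: "N \<in> ONS" for N
    proof (cases "U N = (cosets N \<rightarrow>\<^sub>E carrier k)")
      case True then show ?thesis using KG_component[OF s(1) N] by simp
    next
      case False
      then have "s N = r N" using KG_component_mono[OF s(1) rK M(1) N M(2)[OF N] s(2)] by simp
      then show ?thesis using U(2) N by auto
    qed
    then have "s \<in> Pi\<^sub>E ONS U" using KG_in_PiE[OF s(1)] by (simp add: PiE_def Pi_def)
    then show ?thesis using U(3) T(2) s(1) by blast
  qed
  with M(1) show ?thesis by blast
qed

lemma compact_KG: "compact_space KGtop"
proof -
  let ?P = "product_topology (\<lambda>N. discrete_topology (cosets N \<rightarrow>\<^sub>E carrier k)) ONS"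
  have "finite (cosets N \<rightarrow>\<^sub>E carrier k)" if "N \<in> ONS" for N
    using G.open_normal_finite_cosets[OF that] finite_k by (simp add: finite_PiE)
  then have compact: "compact_space ?P"
    by (simp add: compact_space_product_topology compact_space_discrete_topology)
  have closed: "closedin ?P {a \<in> topspace ?P. a M = coset_push k (cosets N) (cosets M) (a N)}"
    if NM: "N \<in> ONS" "M \<in> ONS" for N M
  proof (rule closedin_continuous_maps_eq)
    show "Hausdorff_space (discrete_topology (cosets M \<rightarrow>\<^sub>E carrier k))" by simp
    show "continuous_map ?P (discrete_topology (cosets M \<rightarrow>\<^sub>E carrier k)) (\<lambda>a. a M)"
      by (rule continuous_map_product_projection[OF NM(2)])
    have "continuous_map ?P (discrete_topology (cosets M \<rightarrow>\<^sub>E carrier k))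
       (coset_push k (cosets N) (cosets M) \<circ> (\<lambda>a. a N))"
      by (rule continuous_map_compose[OF continuous_map_product_projection[OF NM(1)]])
        (auto simp: coset_push_def intro!: k.finsum_closed)
    then show "continuous_map ?P (discrete_topology (cosets M \<rightarrow>\<^sub>E carrier k))
       (\<lambda>a. coset_push k (cosets N) (cosets M) (a N))" by (simp add: o_def)
  qed
  have "carrier KG = {a \<in> topspace ?P. \<forall>p\<in>{(N, M). N \<in> ONS \<and> M \<in> ONS \<and> N \<subseteq> M}.
      a (snd p) = coset_push k (cosets (fst p)) (cosets (snd p)) (a (fst p))}"
    unfolding carrier_KG by auto
  also have "closedin ?P \<dots>" by (rule closedin_Collect_ball) (use closed in auto)
  finally show ?thesis
    unfolding KGtop_eq using compact by (simp add: closedin_compact_space compact_space_subtopology)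
qed

lemma continuous_map_pt:
  assumes c: "c \<in> carrier k"
  shows "continuous_map G.Gtop KGtop (pt c)"
proof (rule continuous_map_into_KG)
  show "pt c \<in> topspace G.Gtop \<rightarrow> carrier KG" using pt_closed[OF c] by (simp add: G.topspace_gtopology)
  fix N g assume N: "N \<in> ONS" and "g \<in> topspace G.Gtop"
  then have g: "g \<in> carrier G" by (simp add: G.topspace_gtopology)
  have "pt c y N = pt c g N" if "y \<in> N #>\<^bsub>G\<^esub> g" for y
    using coset_eqI(1)[OF N coset_of(1)[OF N g] that] N by (simp add: cga_point_def)
  then show "\<exists>U. openin G.Gtop U \<and> g \<in> U \<and> (\<forall>y\<in>U. pt c y N = pt c g N)"
    using G.openin_r_coset[OF G.open_normal_openin[OF N] g] coset_of(2)[OF N g] by blast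
qed

subsection \<open>Density of finite sums of points\<close>

inductive_set point_span :: "'g set \<Rightarrow> ('g, 'k) cga set" for H where
  zero: "\<zero>\<^bsub>KG\<^esub> \<in> point_span H"
| add: "c \<in> carrier k \<Longrightarrow> h \<in> H \<Longrightarrow> s \<in> point_span H \<Longrightarrow> pt c h \<oplus>\<^bsub>KG\<^esub> s \<in> point_span H"

abbreviation closed_point_span :: "'g set \<Rightarrow> ('g, 'k) cga set" where
  "closed_point_span H \<equiv> KGtop closure_of (point_span H)"

lemma point_span_subset:
  assumes H: "H \<subseteq> carrier G"
  shows "point_span H \<subseteq> carrier KG"
proof
  fix s assume "s \<in> point_span H"
  then show "s \<in> carrier KG"
    by induction (use H in \<open>auto intro!: KG_zero_closed KG_add_closed pt_closed\<close>)
qed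

lemma closed_point_span_induct:
  assumes r: "r \<in> closed_point_span H" and closed: "closedin KGtop A" and zero: "\<zero>\<^bsub>KG\<^esub> \<in> A"
    and add: "\<And>c h s. c \<in> carrier k \<Longrightarrow> h \<in> H \<Longrightarrow> s \<in> A \<Longrightarrow> pt c h \<oplus>\<^bsub>KG\<^esub> s \<in> A"
  shows "r \<in> A"
proof -
  have "s \<in> A" if "s \<in> point_span H" for s using that by induction (auto intro: zero add)
  then have "closed_point_span H \<subseteq> A" by (intro closure_of_minimal closed subsetI)
  then show ?thesis using r by blast
qed

lemma closed_point_spanI:
  assumes r: "r \<in> carrier KG" and H: "H \<subseteq> carrier G"
    and approx: "\<And>N. N \<in> ONS \<Longrightarrow> \<exists>s\<in>point_span H. \<forall>C\<in>cosets N. s N C = r N C"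
  shows "r \<in> closed_point_span H"
  unfolding in_closure_of
proof (intro conjI allI impI)
  fix T assume T: "r \<in> T \<and> openin KGtop T"
  obtain N where N: "N \<in> ONS" "\<forall>s\<in>carrier KG. s N = r N \<longrightarrow> s \<in> T"
    using KG_neighbourhood[OF conjunct2[OF T] conjunct1[OF T]] by (rule bexE)
  obtain s where s: "s \<in> point_span H" "\<forall>C\<in>cosets N. s N C = r N C" using approx[OF N(1)] by blast
  have sK: "s \<in> carrier KG" using s(1) point_span_subset[OF H] by blast
  have "s N = r N" by (rule KG_component_ext[OF sK r N(1)]) (rule bspec[OF s(2)])
  then show "\<exists>s. s \<in> point_span H \<and> s \<in> T" using s(1) N(2) sK by blast
qed (simp add: topspace_KGtop r)

lemma point_span_approx:
  assumes N: "N \<in> ONS" and F: "finite F" and v: "v \<in> F \<rightarrow> carrier k" and H: "H \<subseteq> carrier G"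
    and meets: "\<And>D. D \<in> F \<Longrightarrow> D \<inter> H \<noteq> {}" and inside: "\<And>D. D \<in> F \<Longrightarrow> \<exists>C\<in>cosets N. D \<subseteq> C"
  shows "\<exists>s\<in>point_span H. \<forall>C\<in>cosets N. s N C = (\<Oplus>\<^bsub>k\<^esub>D\<in>{D \<in> F. D \<subseteq> C}. v D)"
proof -
  have "\<forall>D\<in>F. \<exists>z. z \<in> D \<inter> H" using meets by blast
  then obtain h where h: "\<forall>D\<in>F. h D \<in> D \<inter> H"
    by (rule bchoice[THEN exE])
  have "\<exists>s\<in>point_span H. \<forall>C\<in>cosets N. s N C = (\<Oplus>\<^bsub>k\<^esub>D\<in>F. if h D \<in> C then v D else \<zero>\<^bsub>k\<^esub>)"
    using F v h
  proof (induction F)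
    case empty
    then show ?case using N by (intro bexI[of _ "\<zero>\<^bsub>KG\<^esub>"]) (auto simp: KG_zero point_span.zero)
  next
    case (insert D F)
    then obtain s where s: "s \<in> point_span H"
      "\<And>C. C \<in> cosets N \<Longrightarrow> s N C = (\<Oplus>\<^bsub>k\<^esub>D\<in>F. if h D \<in> C then v D else \<zero>\<^bsub>k\<^esub>)" by auto
    have hD: "h D \<in> H" "v D \<in> carrier k" using insert.prems by auto
    then have "(pt (v D) (h D) \<oplus>\<^bsub>KG\<^esub> s) N C = (\<Oplus>\<^bsub>k\<^esub>D\<in>insert D F. if h D \<in> C then v D else \<zero>\<^bsub>k\<^esub>)"
      if "C \<in> cosets N" for C
      using that N H insert.hyps insert.prems(1)
      by (subst k.finsum_insert) (auto simp: KG_add pt_val s(2))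
    then show ?case using point_span.add[OF hD(2,1) s(1)] by blast
  qed
  moreover have "(\<Oplus>\<^bsub>k\<^esub>D\<in>F. if h D \<in> C then v D else \<zero>\<^bsub>k\<^esub>) = (\<Oplus>\<^bsub>k\<^esub>D\<in>{D \<in> F. D \<subseteq> C}. v D)"
    if C: "C \<in> cosets N" for C
  proof (rule k.add.finprod_mono_neutral_cong_right)
    have iff: "h D \<in> C \<longleftrightarrow> D \<subseteq> C" if "D \<in> F" for D
      using inside[OF that] bspec[OF h that] coset_unique[OF N C] by blast
    show "\<And>D. D \<in> F - {D \<in> F. D \<subseteq> C} \<Longrightarrow> (if h D \<in> C then v D else \<zero>\<^bsub>k\<^esub>) = \<zero>\<^bsub>k\<^esub>"
      "\<And>D. D \<in> {D \<in> F. D \<subseteq> C} \<Longrightarrow> (if h D \<in> C then v D else \<zero>\<^bsub>k\<^esub>) = v D"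
      using iff by auto
  qed (use F v in auto)
  ultimately obtain s where "s \<in> point_span H" "\<forall>C\<in>cosets N. s N C = (\<Oplus>\<^bsub>k\<^esub>D\<in>{D \<in> F. D \<subseteq> C}. v D)" by auto
  then show ?thesis by (intro bexI)
qed

lemma KG_subset_closed_point_span: "carrier KG \<subseteq> closed_point_span (carrier G)"
proof
  fix r assume r: "r \<in> carrier KG"
  show "r \<in> closed_point_span (carrier G)"
  proof (rule closed_point_spanI[OF r order_refl])
    fix N assume N: "N \<in> ONS"
    have "\<exists>s\<in>point_span (carrier G). \<forall>C\<in>cosets N. s N C = (\<Oplus>\<^bsub>k\<^esub>D\<in>{D \<in> cosets N. D \<subseteq> C}. r N D)"
    proof (rule point_span_approx[OF N])
      show "finite (cosets N)" by (rule G.open_normal_finite_cosets[OF N])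
      show "D \<inter> carrier G \<noteq> {}" if "D \<in> cosets N" for D
        using coset_nonempty[OF N that] coset_eqI(2)[OF N that] by blast
    qed (use KG_component_maps[OF r N] in auto)
    then show "\<exists>s\<in>point_span (carrier G). \<forall>C\<in>cosets N. s N C = r N C"
      using KG_mass[OF r N N order_refl] by (simp add: mass_def)
  qed
qed

end

subsection \<open>Restriction to clopen sets and to closed subgroups\<close>

context profinite_group_algebra
begin

definition restriction :: "'g set \<Rightarrow> 'g set \<Rightarrow> ('g, 'k) cga \<Rightarrow> ('g, 'k) cga" where
  "restriction L S r = (\<lambda>N\<in>ONS. \<lambda>C\<in>cosets N. mass (N \<inter> L) (S \<inter> C) (r (N \<inter> L)))"

lemma restriction_apply:
  "N \<in> ONS \<Longrightarrow> C \<in> cosets N \<Longrightarrow> restriction L S r N C = mass (N \<inter> L) (S \<inter> C) (r (N \<inter> L))"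
  by (simp add: restriction_def)

context
  fixes L S :: "'g set"
  assumes L: "L \<in> ONS" and S: "saturated L S"
begin

lemma saturated_Int_coset:
  assumes "N \<in> ONS" "M \<in> ONS" "N \<subseteq> M" "C \<in> cosets M"
  shows "saturated (N \<inter> L) (S \<inter> C)"
  using assms G.open_normal_Int[OF assms(1) L]
  by (intro saturated_Int saturated_mono[OF _ L _ S] saturated_coset[OF _ assms(2)]) auto

lemma restriction_closed:
  assumes r: "r \<in> carrier KG"
  shows "restriction L S r \<in> carrier KG"
proof (rule KG_memI)
  have comp: "r (N \<inter> L) \<in> cosets (N \<inter> L) \<rightarrow> carrier k" if "N \<in> ONS" for N
    by (rule KG_component_maps[OF r G.open_normal_Int[OF that L]])
  show "restriction L S r \<in> extensional ONS" by (simp add: restriction_def)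
  show "restriction L S r N \<in> cosets N \<rightarrow>\<^sub>E carrier k" if "N \<in> ONS" for N
    using that mass_closed[OF comp[OF that]] by (auto simp: restriction_def)
  fix N M C assume NM: "N \<in> ONS" "M \<in> ONS" "N \<subseteq> M" "C \<in> cosets M"
  have NL: "N \<inter> L \<in> ONS" by (rule G.open_normal_Int[OF NM(1) L])
  let ?I = "{E \<in> cosets N. E \<subseteq> C}"
  have "restriction L S r M C = mass (N \<inter> L) (S \<inter> C) (r (N \<inter> L))"
    unfolding restriction_apply[OF NM(2,4)]
    by (rule mass_refine[OF r, symmetric])
      (use NM NL G.open_normal_Int[OF NM(2) L] saturated_Int_coset[OF NM(2,2) order_refl NM(4)] in auto)
  also have "\<dots> = (\<Oplus>\<^bsub>k\<^esub>E\<in>?I. mass (N \<inter> L) (S \<inter> E) (r (N \<inter> L)))"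
  proof (rule mass_partition[OF NL comp[OF NM(1)] finite_cosets[OF NM(1)]])
    fix D assume D: "D \<in> cosets (N \<inter> L)" "D \<subseteq> S \<inter> C"
    obtain z where z: "z \<in> D" using coset_nonempty[OF NL D(1)] by blast
    have E: "N #>\<^bsub>G\<^esub> z \<in> cosets N" "z \<in> N #>\<^bsub>G\<^esub> z"
      using coset_of[OF NM(1) coset_eqI(2)[OF NL D(1) z]] by auto
    have "D \<subseteq> N #>\<^bsub>G\<^esub> z" using coset_eqI(1)[OF NL D(1) z] by (auto simp: r_coset_def)
    moreover have "N #>\<^bsub>G\<^esub> z \<subseteq> C" using saturatedD[OF saturated_coset[OF NM] E] D(2) z by blast
    ultimately show "\<exists>E\<in>?I. D \<subseteq> S \<inter> E" using D(2) E(1) by blast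
  next
    fix E E' assume "E \<in> ?I" "E' \<in> ?I" "E \<noteq> E'"
    then show "(S \<inter> E) \<inter> (S \<inter> E') = {}" using coset_unique[OF NM(1)] by blast
  qed auto
  also have "\<dots> = mass N C (restriction L S r N)"
    unfolding mass_def[of N] using NM(1) mass_closed[OF comp[OF NM(1)]]
    by (intro k.finsum_cong') (auto simp: restriction_apply)
  finally show "restriction L S r M C = mass N C (restriction L S r N)" .
qed

lemma restriction_add:
  assumes a: "a \<in> carrier KG" and b: "b \<in> carrier KG"
  shows "restriction L S (a \<oplus>\<^bsub>KG\<^esub> b) = restriction L S a \<oplus>\<^bsub>KG\<^esub> restriction L S b"
proof (rule KG_ext)
  show "restriction L S (a \<oplus>\<^bsub>KG\<^esub> b) \<in> carrier KG" "restriction L S a \<oplus>\<^bsub>KG\<^esub> restriction L S b \<in> carrier KG"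
    by (intro restriction_closed KG_add_closed a b)+
  fix N C assume N: "N \<in> ONS" and C: "C \<in> cosets N"
  have NL: "N \<inter> L \<in> ONS" by (rule G.open_normal_Int[OF N L])
  note maps = KG_component_maps[OF a NL] KG_component_maps[OF b NL]
  have "restriction L S (a \<oplus>\<^bsub>KG\<^esub> b) N C = mass (N \<inter> L) (S \<inter> C) (\<lambda>D. a (N \<inter> L) D \<oplus>\<^bsub>k\<^esub> b (N \<inter> L) D)"
    unfolding restriction_apply[OF N C]
    by (rule mass_cong) (use KG_add[OF NL] maps in \<open>auto simp: Pi_iff\<close>)
  then show "restriction L S (a \<oplus>\<^bsub>KG\<^esub> b) N C = (restriction L S a \<oplus>\<^bsub>KG\<^esub> restriction L S b) N C"
    using N C by (simp add: mass_add[OF maps] KG_add restriction_apply)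
qed

lemma restriction_pt:
  assumes c: "c \<in> carrier k" and g: "g \<in> carrier G"
  shows "restriction L S (pt c g) = pt (if g \<in> S then c else \<zero>\<^bsub>k\<^esub>) g"
proof (rule KG_ext)
  show "restriction L S (pt c g) \<in> carrier KG" "pt (if g \<in> S then c else \<zero>\<^bsub>k\<^esub>) g \<in> carrier KG"
    using c g by (auto intro!: restriction_closed pt_closed)
  fix N C assume N: "N \<in> ONS" and C: "C \<in> cosets N"
  then show "restriction L S (pt c g) N C = pt (if g \<in> S then c else \<zero>\<^bsub>k\<^esub>) g N C"
    using mass_pt[OF G.open_normal_Int[OF N L] saturated_Int_coset[OF N N order_refl C] c g]
      pt_val[OF N C g]
    by (simp add: restriction_apply)
qed

lemma continuous_map_restriction: "continuous_map KGtop KGtop (restriction L S)"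
proof (rule continuous_map_KG_KG)
  show "restriction L S \<in> carrier KG \<rightarrow> carrier KG" using restriction_closed by blast
  fix N assume N: "N \<in> ONS"
  have "restriction L S r N = restriction L S s N" if "r (N \<inter> L) = s (N \<inter> L)" for r s
    using that N by (simp add: restriction_def)
  then show "\<exists>M\<in>ONS. \<forall>r\<in>carrier KG. \<forall>s\<in>carrier KG. r M = s M \<longrightarrow> restriction L S r N = restriction L S s N"
    using G.open_normal_Int[OF N L] by blast
qed

end

end

locale profinite_group_algebra_subgroup = profinite_group_algebra k G
  for k :: "('k, 'a) ring_scheme" and G :: "('g, 'b) top_group_scheme" +
  fixes H :: "'g set"
  assumes closed_subgroup: "closed_subgroup H G"

sublocale profinite_group_algebra_subgroup \<subseteq> H: profinite_group_algebra k "sub_top_group G H"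
  by (intro profinite_group_algebra.intro G.profinite_sub_top_group closed_subgroup k.field_axioms
      profinite_group_algebra_axioms.intro finite_k)

context profinite_group_algebra_subgroup
begin

lemmas H_subset = G.closed_subgroup_subset[OF closed_subgroup]
  and open_normal_H = G.open_normal_sub_top_group[OF closed_subgroup]

lemma coset_H:
  assumes N: "N \<in> ONS" and D: "D \<in> H.cosets (H \<inter> N)" and z: "z \<in> D"
  shows "z \<in> H" "D \<subseteq> N #>\<^bsub>G\<^esub> z" "N #>\<^bsub>G\<^esub> z \<in> cosets N" "z \<in> N #>\<^bsub>G\<^esub> z"
proof -
  show zH: "z \<in> H" using H.coset_eqI(2)[OF open_normal_H[OF N] D z] by simp
  show "D \<subseteq> N #>\<^bsub>G\<^esub> z"
    using H.coset_eqI(1)[OF open_normal_H[OF N] D z] by (auto simp: r_coset_def)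
  show "N #>\<^bsub>G\<^esub> z \<in> cosets N" "z \<in> N #>\<^bsub>G\<^esub> z" using coset_of[OF N] zH H_subset by auto
qed

lemma saturated_H_coset:
  assumes "N \<in> ONS" "C \<in> cosets N"
  shows "H.saturated (H \<inter> N) C"
  unfolding H.saturated_def
proof (intro ballI impI)
  fix D z assume "D \<in> H.cosets (H \<inter> N)" "z \<in> D" "z \<in> C"
  then show "D \<subseteq> C" using coset_H(2)[OF assms(1)] coset_eqI(1)[OF assms] by blast
qed

lemma incl_apply:
  "N \<in> ONS \<Longrightarrow> C \<in> cosets N \<Longrightarrow> cga_incl k G H b N C = H.mass (H \<inter> N) C (b (H \<inter> N))"
  by (simp add: cga_incl_def coset_push_def H.mass_def)

lemma incl_closed:
  assumes b: "b \<in> carrier H.KG"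
  shows "cga_incl k G H b \<in> carrier KG"
proof (rule KG_memI)
  have comp: "b (H \<inter> N) \<in> H.cosets (H \<inter> N) \<rightarrow> carrier k" if "N \<in> ONS" for N
    by (rule H.KG_component_maps[OF b open_normal_H[OF that]])
  show "cga_incl k G H b \<in> extensional ONS" by (simp add: cga_incl_def)
  show "cga_incl k G H b N \<in> cosets N \<rightarrow>\<^sub>E carrier k" if "N \<in> ONS" for N
    using that H.mass_closed[OF comp[OF that]] by (auto simp: cga_incl_def coset_push_def H.mass_def)
  fix N M C assume NM: "N \<in> ONS" "M \<in> ONS" "N \<subseteq> M" "C \<in> cosets M"
  let ?I = "{E \<in> cosets N. E \<subseteq> C}"
  have "cga_incl k G H b M C = H.mass (H \<inter> N) C (b (H \<inter> N))"
    unfolding incl_apply[OF NM(2,4)]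
    by (rule H.mass_refine[OF b, symmetric])
      (use NM open_normal_H saturated_H_coset[OF NM(2,4)] in auto)
  also have "\<dots> = (\<Oplus>\<^bsub>k\<^esub>E\<in>?I. H.mass (H \<inter> N) E (b (H \<inter> N)))"
  proof (rule H.mass_partition[OF open_normal_H[OF NM(1)] comp[OF NM(1)] finite_cosets[OF NM(1)]])
    fix D assume D: "D \<in> H.cosets (H \<inter> N)" "D \<subseteq> C"
    obtain z where z: "z \<in> D" using H.coset_nonempty[OF open_normal_H[OF NM(1)] D(1)] by blast
    note E = coset_H[OF NM(1) D(1) z]
    have "N #>\<^bsub>G\<^esub> z \<subseteq> C" using saturatedD[OF saturated_coset[OF NM] E(3,4)] D(2) z by blast
    then show "\<exists>E\<in>?I. D \<subseteq> E" using E(2,3) by blast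
  next
    fix E E' assume "E \<in> ?I" "E' \<in> ?I" "E \<noteq> E'"
    then show "E \<inter> E' = {}" using coset_unique[OF NM(1)] by blast
  qed auto
  also have "\<dots> = mass N C (cga_incl k G H b N)"
    unfolding mass_def using NM(1) H.mass_closed[OF comp[OF NM(1)]]
    by (intro k.finsum_cong') (auto simp: incl_apply)
  finally show "cga_incl k G H b M C = mass N C (cga_incl k G H b N)" .
qed

lemma incl_pt:
  assumes c: "c \<in> carrier k" and h: "h \<in> H"
  shows "cga_incl k G H (H.pt c h) = pt c h"
proof (rule KG_ext)
  have hG: "h \<in> carrier G" using h H_subset by blast
  show "cga_incl k G H (H.pt c h) \<in> carrier KG" "pt c h \<in> carrier KG"
    using c h hG by (auto intro!: incl_closed H.pt_closed pt_closed)
  fix N C assume N: "N \<in> ONS" and C: "C \<in> cosets N"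
  then show "cga_incl k G H (H.pt c h) N C = pt c h N C"
    using H.mass_pt[OF open_normal_H[OF N] saturated_H_coset[OF N C] c] h pt_val[OF N C hG]
    by (simp add: incl_apply)
qed

lemma incl_in_closed_point_span:
  assumes b: "b \<in> carrier H.KG"
  shows "cga_incl k G H b \<in> closed_point_span H"
proof (rule closed_point_spanI[OF incl_closed[OF b] H_subset])
  fix N assume N: "N \<in> ONS"
  have "\<exists>s\<in>point_span H. \<forall>C\<in>cosets N. s N C = (\<Oplus>\<^bsub>k\<^esub>D\<in>{D \<in> H.cosets (H \<inter> N). D \<subseteq> C}. b (H \<inter> N) D)"
  proof (rule point_span_approx[OF N])
    show "finite (H.cosets (H \<inter> N))" by (rule H.G.open_normal_finite_cosets[OF open_normal_H[OF N]])
    show "b (H \<inter> N) \<in> H.cosets (H \<inter> N) \<rightarrow> carrier k"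
      by (rule H.KG_component_maps[OF b open_normal_H[OF N]])
    show "H \<subseteq> carrier G" by (rule H_subset)
    fix D assume D: "D \<in> H.cosets (H \<inter> N)"
    obtain z where z: "z \<in> D" using H.coset_nonempty[OF open_normal_H[OF N] D] by blast
    show "D \<inter> H \<noteq> {}" "\<exists>C\<in>cosets N. D \<subseteq> C" using coset_H[OF N D z] z by blast+
  qed
  then show "\<exists>s\<in>point_span H. \<forall>C\<in>cosets N. s N C = cga_incl k G H b N C"
    using N by (simp add: incl_apply H.mass_def cong: ball_cong)
qed

end

section \<open>Modules over completed group algebras\<close>

locale profinite_group_module =
  profinite_group_algebra k G + profinite_module "completed_group_algebra k G" M
  for k :: "('k, 'a) ring_scheme" and G :: "('g, 'b) top_group_scheme"
    and M :: "(('g, 'k) cga, 'm) top_module"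

sublocale profinite_group_module \<subseteq> compact_ring_module "completed_group_algebra k G" M
  by unfold_locales (rule topspace_KGtop compact_KG)+

context profinite_group_module
begin

lemma pt_smult_closed [simp, intro]:
  "c \<in> carrier k \<Longrightarrow> g \<in> carrier G \<Longrightarrow> x \<in> carrier M \<Longrightarrow> pt c g \<odot>\<^bsub>M\<^esub> x \<in> carrier M"
  by (intro smult_closed pt_closed)

lemma pt_smult_smult:
  "c \<in> carrier k \<Longrightarrow> d \<in> carrier k \<Longrightarrow> g \<in> carrier G \<Longrightarrow> h \<in> carrier G \<Longrightarrow> x \<in> carrier M \<Longrightarrow>
    pt c g \<odot>\<^bsub>M\<^esub> (pt d h \<odot>\<^bsub>M\<^esub> x) = pt (c \<otimes>\<^bsub>k\<^esub> d) (g \<otimes>\<^bsub>G\<^esub> h) \<odot>\<^bsub>M\<^esub> x"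
  by (simp add: pt_mult pt_closed flip: smult_assoc1)

lemma pt_zero_smult: "g \<in> carrier G \<Longrightarrow> x \<in> carrier M \<Longrightarrow> pt \<zero>\<^bsub>k\<^esub> g \<odot>\<^bsub>M\<^esub> x = \<zero>\<^bsub>M\<^esub>"
  by (simp add: pt_zero)

lemma pt_one_smult: "x \<in> carrier M \<Longrightarrow> pt \<one>\<^bsub>k\<^esub> \<one>\<^bsub>G\<^esub> \<odot>\<^bsub>M\<^esub> x = x"
  by (simp flip: pt_one)

lemma continuous_map_pt_smult:
  assumes "continuous_map X G.Gtop f" "continuous_map X Mtop h" "c \<in> carrier k"
  shows "continuous_map X Mtop (\<lambda>x. pt c (f x) \<odot>\<^bsub>M\<^esub> h x)"
  using continuous_map_compose[OF assms(1) continuous_map_pt[OF assms(3)]] assms(2)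
  by (intro continuous_map_smult) (simp_all add: o_def)

end

section \<open>Equivariant maps\<close>

definition continuous_additive ::
    "('r, 'm, 'b) top_module_scheme \<Rightarrow> ('r, 'n, 'c) top_module_scheme \<Rightarrow> ('m \<Rightarrow> 'n) set" where
  "continuous_additive M N =
    {f \<in> carrier M \<rightarrow> carrier N.
      (\<forall>x\<in>carrier M. \<forall>y\<in>carrier M. f (x \<oplus>\<^bsub>M\<^esub> y) = f x \<oplus>\<^bsub>N\<^esub> f y) \<and>
      continuous_map (mtopology M) (mtopology N) f}"

lemma continuous_additiveD:
  assumes "f \<in> continuous_additive M N"
  shows continuous_additive_closed: "x \<in> carrier M \<Longrightarrow> f x \<in> carrier N"
    and continuous_additive_add: "x \<in> carrier M \<Longrightarrow> y \<in> carrier M \<Longrightarrow> f (x \<oplus>\<^bsub>M\<^esub> y) = f x \<oplus>\<^bsub>N\<^esub> f y"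
    and continuous_additive_continuous: "continuous_map (mtopology M) (mtopology N) f"
  using assms by (auto simp: continuous_additive_def)

lemma continuous_hom_iff_continuous_additive:
  "f \<in> continuous_hom R M N \<longleftrightarrow>
    f \<in> continuous_additive M N \<and> (\<forall>r\<in>carrier R. \<forall>x\<in>carrier M. f (r \<odot>\<^bsub>M\<^esub> x) = r \<odot>\<^bsub>N\<^esub> f x)"
  by (auto simp: continuous_hom_def continuous_additive_def)

lemma continuous_hom_imp_continuous_additive: "f \<in> continuous_hom R M N \<Longrightarrow> f \<in> continuous_additive M N"
  by (simp add: continuous_hom_iff_continuous_additive)

lemma continuous_additive_compose:
  assumes "f \<in> continuous_additive M N" "g \<in> continuous_additive N P"
  shows "(\<lambda>x. g (f x)) \<in> continuous_additive M P"
  using continuous_additiveD[OF assms(1)] continuous_additiveD[OF assms(2)]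
    continuous_map_compose[of "mtopology M" "mtopology N" f "mtopology P" g]
  by (auto simp: continuous_additive_def o_def)

lemma continuous_additive_abelian_group_hom:
  "abelian_group M \<Longrightarrow> abelian_group N \<Longrightarrow> f \<in> continuous_additive M N \<Longrightarrow> abelian_group_hom M N f"
  by (intro additive_imp_abelian_group_hom) (auto simp: continuous_additive_def)

context compact_ring_module
begin

lemma smult_continuous_additive:
  assumes "r \<in> carrier R"
  shows "(\<lambda>x. r \<odot>\<^bsub>M\<^esub> x) \<in> continuous_additive M M"
  using assms continuous_map_smult_const[OF assms continuous_map_id[of Mtop, unfolded id_def]]
  by (auto simp: continuous_additive_def smult_r_distr)

lemma finsum_continuous_additive:
  fixes N :: "('r, 'n, 'c) top_module_scheme"
  assumes I: "finite I" and f: "\<And>i. i \<in> I \<Longrightarrow> f i \<in> continuous_additive N M"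
  shows "(\<lambda>x. \<Oplus>\<^bsub>M\<^esub>i\<in>I. f i x) \<in> continuous_additive N M"
proof -
  note closed = continuous_additive_closed[OF f]
  have "(\<Oplus>\<^bsub>M\<^esub>i\<in>I. f i (x \<oplus>\<^bsub>N\<^esub> y)) = (\<Oplus>\<^bsub>M\<^esub>i\<in>I. f i x) \<oplus>\<^bsub>M\<^esub> (\<Oplus>\<^bsub>M\<^esub>i\<in>I. f i y)"
    if "x \<in> carrier N" "y \<in> carrier N" for x y
  proof -
    have "(\<Oplus>\<^bsub>M\<^esub>i\<in>I. f i (x \<oplus>\<^bsub>N\<^esub> y)) = (\<Oplus>\<^bsub>M\<^esub>i\<in>I. f i x \<oplus>\<^bsub>M\<^esub> f i y)"
      by (rule M.finsum_cong') (use closed that continuous_additive_add[OF f] in auto)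
    also have "\<dots> = (\<Oplus>\<^bsub>M\<^esub>i\<in>I. f i x) \<oplus>\<^bsub>M\<^esub> (\<Oplus>\<^bsub>M\<^esub>i\<in>I. f i y)"
      by (rule M.finsum_addf) (use closed that in auto)
    finally show ?thesis .
  qed
  moreover have "continuous_map (mtopology N) Mtop (\<lambda>x. \<Oplus>\<^bsub>M\<^esub>i\<in>I. f i x)"
    by (rule continuous_map_finsum[OF I]) (rule continuous_additive_continuous[OF f])
  ultimately show ?thesis
    using closed by (auto simp: continuous_additive_def intro!: M.finsum_closed)
qed

end

locale profinite_group_module_pair =
  profinite_group_algebra k G + U: profinite_group_module k G U + V: profinite_group_module k G V
  for k :: "('k, 'a) ring_scheme" and G :: "('g, 'b) top_group_scheme"
    and U :: "(('g, 'k) cga, 'u) top_module" and V :: "(('g, 'k) cga, 'v) top_module"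
begin

lemmas continuous_additive_UV_hom =
  continuous_additive_abelian_group_hom[OF U.M.abelian_group_axioms V.M.abelian_group_axioms]

definition equivariant_mod :: "'g set \<Rightarrow> 'v set \<Rightarrow> ('u \<Rightarrow> 'v) \<Rightarrow> bool" where
  "equivariant_mod H D f \<longleftrightarrow>
    (\<forall>c\<in>carrier k. \<forall>h\<in>H. \<forall>u\<in>carrier U. D +>\<^bsub>V\<^esub> f (pt c h \<odot>\<^bsub>U\<^esub> u) = D +>\<^bsub>V\<^esub> pt c h \<odot>\<^bsub>V\<^esub> f u)"

abbreviation equivariant :: "'g set \<Rightarrow> ('u \<Rightarrow> 'v) \<Rightarrow> bool" where
  "equivariant H \<equiv> equivariant_mod H {\<zero>\<^bsub>V\<^esub>}"

lemma equivariant_modD: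
  "equivariant_mod H D f \<Longrightarrow> c \<in> carrier k \<Longrightarrow> h \<in> H \<Longrightarrow> u \<in> carrier U \<Longrightarrow>
    D +>\<^bsub>V\<^esub> f (pt c h \<odot>\<^bsub>U\<^esub> u) = D +>\<^bsub>V\<^esub> pt c h \<odot>\<^bsub>V\<^esub> f u"
  by (simp add: equivariant_mod_def)

lemma zero_rcos_eq_iff:
  "x \<in> carrier V \<Longrightarrow> y \<in> carrier V \<Longrightarrow> {\<zero>\<^bsub>V\<^esub>} +>\<^bsub>V\<^esub> x = {\<zero>\<^bsub>V\<^esub>} +>\<^bsub>V\<^esub> y \<longleftrightarrow> x = y"
  by (simp add: abelian_subgroup.a_rcos_eq_iff[OF V.submodule_abelian_subgroup[OF V.submodule_zero]]
      V.M.minus_eq_zero_iff)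

lemma equivariant_iff:
  assumes "f \<in> continuous_additive U V" "H \<subseteq> carrier G"
  shows "equivariant H f \<longleftrightarrow>
    (\<forall>c\<in>carrier k. \<forall>h\<in>H. \<forall>u\<in>carrier U. f (pt c h \<odot>\<^bsub>U\<^esub> u) = pt c h \<odot>\<^bsub>V\<^esub> f u)"
  using assms zero_rcos_eq_iff continuous_additive_closed[OF assms(1)]
  by (simp add: equivariant_mod_def subset_iff)

lemma equivariant_mod_smult:
  assumes f: "f \<in> continuous_additive U V" and D: "submodule D KG V" "closedin V.Mtop D"
    and H: "H \<subseteq> carrier G" and equiv: "equivariant_mod H D f"
    and r: "r \<in> closed_point_span H" and u: "u \<in> carrier U"
  shows "D +>\<^bsub>V\<^esub> f (r \<odot>\<^bsub>U\<^esub> u) = D +>\<^bsub>V\<^esub> r \<odot>\<^bsub>V\<^esub> f u"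
proof -
  interpret f: abelian_group_hom U V f by (rule continuous_additive_UV_hom[OF f])
  interpret D: abelian_subgroup D V by (rule V.submodule_abelian_subgroup[OF D(1)])
  let ?A = "{r \<in> topspace KGtop. f (r \<odot>\<^bsub>U\<^esub> u) \<ominus>\<^bsub>V\<^esub> r \<odot>\<^bsub>V\<^esub> f u \<in> D}"
  have mem: "r \<in> ?A \<longleftrightarrow> r \<in> carrier KG \<and> D +>\<^bsub>V\<^esub> f (r \<odot>\<^bsub>U\<^esub> u) = D +>\<^bsub>V\<^esub> r \<odot>\<^bsub>V\<^esub> f u" for r
    using u by (simp add: topspace_KGtop D.a_rcos_eq_iff cong: conj_cong)
  have "r \<in> ?A"
  proof (rule closed_point_span_induct[OF r])
    have smult: "continuous_map KGtop U.Mtop (\<lambda>r. r \<odot>\<^bsub>U\<^esub> u)" "continuous_map KGtop V.Mtop (\<lambda>r. r \<odot>\<^bsub>V\<^esub> f u)"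
      using u continuous_map_id[of KGtop]
      by (auto intro!: U.continuous_map_smult V.continuous_map_smult
          simp: id_def U.topspace_mtopology V.topspace_mtopology)
    have "continuous_map KGtop V.Mtop (\<lambda>r. f (r \<odot>\<^bsub>U\<^esub> u))"
      using continuous_map_compose[OF smult(1) continuous_additive_continuous[OF f]] by (simp add: o_def)
    then show "closedin KGtop ?A"
      by (intro closedin_continuous_map_preimage[OF V.continuous_map_minus D(2)] smult(2))
    show "\<zero>\<^bsub>KG\<^esub> \<in> ?A" unfolding mem using u by (simp add: KG_zero_closed)
    fix c h s assume c: "c \<in> carrier k" and h: "h \<in> H" and s: "s \<in> ?A"
    have pt: "pt c h \<in> carrier KG" using c h H by (auto intro: pt_closed)
    show "pt c h \<oplus>\<^bsub>KG\<^esub> s \<in> ?A"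
      using s pt u equivariant_modD[OF equiv c h u] unfolding mem
      by (simp add: U.smult_l_distr V.smult_l_distr KG_add_closed) (intro D.a_rcos_add_cong; simp)
  qed
  then show ?thesis unfolding mem by blast
qed

lemma equivariant_smult:
  assumes f: "f \<in> continuous_additive U V" and H: "H \<subseteq> carrier G" and equiv: "equivariant H f"
    and r: "r \<in> closed_point_span H" and u: "u \<in> carrier U"
  shows "f (r \<odot>\<^bsub>U\<^esub> u) = r \<odot>\<^bsub>V\<^esub> f u"
proof -
  have "r \<in> carrier KG" using r closure_of_subset_topspace topspace_KGtop by fastforce
  then show ?thesis
    using equivariant_mod_smult[OF f V.submodule_zero V.closedin_zero H equiv r u] u
      continuous_additive_closed[OF f]
    by (simp add: zero_rcos_eq_iff)
qed

lemma continuous_hom_iff_equivariant: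
  "f \<in> continuous_hom KG U V \<longleftrightarrow> f \<in> continuous_additive U V \<and> equivariant (carrier G) f"
proof
  assume f: "f \<in> continuous_hom KG U V"
  then show "f \<in> continuous_additive U V \<and> equivariant (carrier G) f"
    using equivariant_iff[of f "carrier G"] pt_closed continuous_hom_smult[OF f]
    by (simp add: continuous_hom_imp_continuous_additive)
next
  assume "f \<in> continuous_additive U V \<and> equivariant (carrier G) f"
  then show "f \<in> continuous_hom KG U V"
    using equivariant_smult[of f "carrier G"] KG_subset_closed_point_span
    by (auto simp: continuous_hom_iff_continuous_additive)
qed

lemma continuous_hom_restrict_scalars_iff_equivariant:
  assumes H: "closed_subgroup H G"
  shows "f \<in> continuous_hom (completed_group_algebra k (sub_top_group G H))
      (restrict_scalars (cga_incl k G H) U) (restrict_scalars (cga_incl k G H) V)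
    \<longleftrightarrow> f \<in> continuous_additive U V \<and> equivariant H f" (is "?hom \<longleftrightarrow> _")
proof -
  interpret H: profinite_group_algebra_subgroup k G H by unfold_locales (rule H)
  have hom_iff: "?hom \<longleftrightarrow> f \<in> continuous_additive U V \<and>
      (\<forall>b\<in>carrier H.H.KG. \<forall>u\<in>carrier U. f (cga_incl k G H b \<odot>\<^bsub>U\<^esub> u) = cga_incl k G H b \<odot>\<^bsub>V\<^esub> f u)"
    by (auto simp: continuous_hom_def continuous_additive_def restrict_scalars_def)
  have "(\<forall>b\<in>carrier H.H.KG. \<forall>u\<in>carrier U. f (cga_incl k G H b \<odot>\<^bsub>U\<^esub> u) = cga_incl k G H b \<odot>\<^bsub>V\<^esub> f u)
      \<longleftrightarrow> equivariant H f" if f: "f \<in> continuous_additive U V"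
  proof
    assume hom: "\<forall>b\<in>carrier H.H.KG. \<forall>u\<in>carrier U.
      f (cga_incl k G H b \<odot>\<^bsub>U\<^esub> u) = cga_incl k G H b \<odot>\<^bsub>V\<^esub> f u"
    show "equivariant H f"
      unfolding equivariant_iff[OF f H.H_subset]
      using bspec[OF hom H.H.pt_closed] by (simp add: H.incl_pt)
  next
    assume equiv: "equivariant H f"
    show "\<forall>b\<in>carrier H.H.KG. \<forall>u\<in>carrier U. f (cga_incl k G H b \<odot>\<^bsub>U\<^esub> u) = cga_incl k G H b \<odot>\<^bsub>V\<^esub> f u"
      by (intro ballI equivariant_smult[OF f H.H_subset equiv] H.incl_in_closed_point_span)
  qed
  then show ?thesis unfolding hom_iff by blast
qed

definition conjugate_map :: "'g \<Rightarrow> ('u \<Rightarrow> 'v) \<Rightarrow> 'u \<Rightarrow> 'v" where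
  "conjugate_map g f = (\<lambda>u. pt \<one>\<^bsub>k\<^esub> g \<odot>\<^bsub>V\<^esub> f (pt \<one>\<^bsub>k\<^esub> (inv\<^bsub>G\<^esub> g) \<odot>\<^bsub>U\<^esub> u))"

lemma conjugate_map_continuous_additive:
  assumes f: "f \<in> continuous_additive U V" and g: "g \<in> carrier G"
  shows "conjugate_map g f \<in> continuous_additive U V"
proof -
  have "(\<lambda>u. f (pt \<one>\<^bsub>k\<^esub> (inv\<^bsub>G\<^esub> g) \<odot>\<^bsub>U\<^esub> u)) \<in> continuous_additive U V"
    by (rule continuous_additive_compose[OF U.smult_continuous_additive f]) (simp add: pt_closed g)
  then show ?thesis
    unfolding conjugate_map_def
    by (rule continuous_additive_compose[OF _ V.smult_continuous_additive]) (simp add: pt_closed g)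
qed

lemma conjugate_map_rcos_smult:
  assumes f: "f \<in> continuous_additive U V" and D: "submodule D KG V" and equiv: "equivariant_mod H D f"
    and x: "x \<in> carrier G" and y: "y \<in> carrier G" and g: "g \<in> carrier G"
    and h: "inv\<^bsub>G\<^esub> x \<otimes>\<^bsub>G\<^esub> g \<otimes>\<^bsub>G\<^esub> y \<in> H" and c: "c \<in> carrier k" and u: "u \<in> carrier U"
  shows "D +>\<^bsub>V\<^esub> conjugate_map x f (pt c g \<odot>\<^bsub>U\<^esub> u) = D +>\<^bsub>V\<^esub> pt c g \<odot>\<^bsub>V\<^esub> conjugate_map y f u"
proof -
  let ?h = "inv\<^bsub>G\<^esub> x \<otimes>\<^bsub>G\<^esub> g \<otimes>\<^bsub>G\<^esub> y" and ?u = "pt \<one>\<^bsub>k\<^esub> (inv\<^bsub>G\<^esub> y) \<odot>\<^bsub>U\<^esub> u"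
  have hG: "?h \<in> carrier G" and uU: "?u \<in> carrier U" using x y g u by simp_all
  note fU = continuous_additive_closed[OF f]
  have "?h \<otimes>\<^bsub>G\<^esub> inv\<^bsub>G\<^esub> y = inv\<^bsub>G\<^esub> x \<otimes>\<^bsub>G\<^esub> g" using x y g by (simp add: G.m_assoc)
  then have inner: "pt \<one>\<^bsub>k\<^esub> (inv\<^bsub>G\<^esub> x) \<odot>\<^bsub>U\<^esub> (pt c g \<odot>\<^bsub>U\<^esub> u) = pt c ?h \<odot>\<^bsub>U\<^esub> ?u"
    using x y g c u hG by (simp add: U.pt_smult_smult)
  have "x \<otimes>\<^bsub>G\<^esub> ?h = g \<otimes>\<^bsub>G\<^esub> y" using x y g by (simp flip: G.m_assoc)
  then have outer: "pt \<one>\<^bsub>k\<^esub> x \<odot>\<^bsub>V\<^esub> (pt c ?h \<odot>\<^bsub>V\<^esub> f ?u) = pt c g \<odot>\<^bsub>V\<^esub> (pt \<one>\<^bsub>k\<^esub> y \<odot>\<^bsub>V\<^esub> f ?u)"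
    using x y g c hG fU[OF uU] by (simp add: V.pt_smult_smult)
  have "D +>\<^bsub>V\<^esub> pt \<one>\<^bsub>k\<^esub> x \<odot>\<^bsub>V\<^esub> f (pt c ?h \<odot>\<^bsub>U\<^esub> ?u) = D +>\<^bsub>V\<^esub> pt \<one>\<^bsub>k\<^esub> x \<odot>\<^bsub>V\<^esub> (pt c ?h \<odot>\<^bsub>V\<^esub> f ?u)"
    using x c hG uU fU equivariant_modD[OF equiv c h uU]
    by (intro V.rcos_smult_cong[OF D]) (auto intro: pt_closed)
  then show ?thesis unfolding conjugate_map_def inner outer .
qed

lemma lift_conjugate_map:
  fixes W :: "(('g, 'k) cga, 'w) top_module"
  assumes W: "profinite_group_module k G W"
    and \<beta>: "\<beta> \<in> continuous_hom KG V W" and \<phi>: "\<phi> \<in> continuous_hom KG U W"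
    and f: "f \<in> continuous_additive U V" and lift: "\<And>u. u \<in> carrier U \<Longrightarrow> \<beta> (f u) = \<phi> u"
    and g: "g \<in> carrier G" and u: "u \<in> carrier U"
  shows "\<beta> (conjugate_map g f u) = \<phi> u"
proof -
  interpret W: profinite_group_module k G W by fact
  have "\<beta> (conjugate_map g f u) = pt \<one>\<^bsub>k\<^esub> g \<odot>\<^bsub>W\<^esub> \<phi> (pt \<one>\<^bsub>k\<^esub> (inv\<^bsub>G\<^esub> g) \<odot>\<^bsub>U\<^esub> u)"
    using g u by (simp add: conjugate_map_def continuous_hom_smult[OF \<beta>] pt_closed
        continuous_additive_closed[OF f] lift)
  also have "\<dots> = \<phi> u"
    using g u
    by (simp add: continuous_hom_smult[OF \<phi>] pt_closed continuous_hom_closed[OF \<phi>] W.pt_smult_smult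
        W.pt_one_smult)
  finally show ?thesis .
qed

lemma equivariant_mod_finsum:
  assumes E: "group_action G E \<sigma>" and D: "submodule D KG V"
    and closed: "\<And>w u. w \<in> E \<Longrightarrow> u \<in> carrier U \<Longrightarrow> f w u \<in> carrier V"
    and equiv: "\<And>c g w u. c \<in> carrier k \<Longrightarrow> g \<in> carrier G \<Longrightarrow> w \<in> E \<Longrightarrow> u \<in> carrier U \<Longrightarrow>
      D +>\<^bsub>V\<^esub> f (\<sigma> g w) (pt c g \<odot>\<^bsub>U\<^esub> u) = D +>\<^bsub>V\<^esub> pt c g \<odot>\<^bsub>V\<^esub> f w u"
  shows "equivariant_mod (carrier G) D (\<lambda>u. \<Oplus>\<^bsub>V\<^esub>w\<in>E. f w u)"
  unfolding equivariant_mod_def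
proof (intro ballI)
  interpret E: group_action G E \<sigma> by fact
  interpret D: abelian_subgroup D V by (rule V.submodule_abelian_subgroup[OF D])
  fix c g u assume c: "c \<in> carrier k" and g: "g \<in> carrier G" and u: "u \<in> carrier U"
  have gE: "\<sigma> g w \<in> E" if "w \<in> E" for w by (rule E.element_image[OF g that refl])
  have "(\<Oplus>\<^bsub>V\<^esub>w\<in>E. f w (pt c g \<odot>\<^bsub>U\<^esub> u)) = (\<Oplus>\<^bsub>V\<^esub>w\<in>\<sigma> g ` E. f w (pt c g \<odot>\<^bsub>U\<^esub> u))"
    by (simp add: E.surj_prop[OF g])
  also have "\<dots> = (\<Oplus>\<^bsub>V\<^esub>w\<in>E. f (\<sigma> g w) (pt c g \<odot>\<^bsub>U\<^esub> u))"
    by (rule V.M.finsum_reindex[OF _ E.inj_prop[OF g]]) (use c g u gE closed in auto)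
  finally have "D +>\<^bsub>V\<^esub> (\<Oplus>\<^bsub>V\<^esub>w\<in>E. f w (pt c g \<odot>\<^bsub>U\<^esub> u)) = D +>\<^bsub>V\<^esub> (\<Oplus>\<^bsub>V\<^esub>w\<in>E. f (\<sigma> g w) (pt c g \<odot>\<^bsub>U\<^esub> u))"
    by simp
  also have "\<dots> = D +>\<^bsub>V\<^esub> (\<Oplus>\<^bsub>V\<^esub>w\<in>E. pt c g \<odot>\<^bsub>V\<^esub> f w u)"
    by (rule D.a_rcos_finsum_cong) (use c g u gE closed equiv in auto)
  also have "(\<Oplus>\<^bsub>V\<^esub>w\<in>E. pt c g \<odot>\<^bsub>V\<^esub> f w u) = pt c g \<odot>\<^bsub>V\<^esub> (\<Oplus>\<^bsub>V\<^esub>w\<in>E. f w u)"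
    by (rule V.smult_finsum[symmetric]) (use c g u closed in \<open>auto intro: pt_closed\<close>)
  finally show "D +>\<^bsub>V\<^esub> (\<Oplus>\<^bsub>V\<^esub>w\<in>E. f w (pt c g \<odot>\<^bsub>U\<^esub> u)) = D +>\<^bsub>V\<^esub> pt c g \<odot>\<^bsub>V\<^esub> (\<Oplus>\<^bsub>V\<^esub>w\<in>E. f w u)" .
qed

end

section \<open>Equivariant partitions of unity\<close>

text \<open>For \<open>E = G/H\<close> such a family is determined by its member at the base point, an \<open>H\<close>-equivariant map
  whose relative trace from \<open>H\<close> to \<open>G\<close> is the identity, as in Higman's criterion.\<close>

definition (in profinite_group_module) equivariant_partition_of_unity ::
    "'w set \<Rightarrow> ('g \<Rightarrow> 'w \<Rightarrow> 'w) \<Rightarrow> ('w \<Rightarrow> 'm \<Rightarrow> 'm) \<Rightarrow> bool" where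
  "equivariant_partition_of_unity E \<sigma> \<alpha> \<longleftrightarrow>
    (\<forall>w\<in>E. \<alpha> w \<in> continuous_additive M M) \<and>
    (\<forall>c\<in>carrier k. \<forall>g\<in>carrier G. \<forall>w\<in>E. \<forall>u\<in>carrier M.
      \<alpha> (\<sigma> g w) (pt c g \<odot>\<^bsub>M\<^esub> u) = pt c g \<odot>\<^bsub>M\<^esub> \<alpha> w u) \<and>
    (\<forall>u\<in>carrier M. (\<Oplus>\<^bsub>M\<^esub>w\<in>E. \<alpha> w u) = u)"

lemma (in profinite_group_module) equivariant_partition_of_unityD:
  assumes "equivariant_partition_of_unity E \<sigma> \<alpha>"
  shows "w \<in> E \<Longrightarrow> \<alpha> w \<in> continuous_additive M M"
    and "c \<in> carrier k \<Longrightarrow> g \<in> carrier G \<Longrightarrow> w \<in> E \<Longrightarrow> u \<in> carrier M \<Longrightarrow>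
      \<alpha> (\<sigma> g w) (pt c g \<odot>\<^bsub>M\<^esub> u) = pt c g \<odot>\<^bsub>M\<^esub> \<alpha> w u"
    and "u \<in> carrier M \<Longrightarrow> (\<Oplus>\<^bsub>M\<^esub>w\<in>E. \<alpha> w u) = u"
  using assms by (auto simp: equivariant_partition_of_unity_def)

lemma (in profinite_group_module) equivariant_partition_of_unity_Times:
  assumes A: "finite A" "equivariant_partition_of_unity A \<sigma> \<alpha>"
    and B: "finite B" "equivariant_partition_of_unity B \<tau> \<beta>"
  shows "equivariant_partition_of_unity (A \<times> B) (\<lambda>g. \<lambda>p\<in>A \<times> B. (\<sigma> g (fst p), \<tau> g (snd p)))
    (\<lambda>p u. \<alpha> (fst p) (\<beta> (snd p) u))"
proof -
  note \<alpha> = equivariant_partition_of_unityD[OF A(2)] and \<beta> = equivariant_partition_of_unityD[OF B(2)]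
  note closed = continuous_additive_closed[OF \<alpha>(1)] continuous_additive_closed[OF \<beta>(1)]
  have "(\<Oplus>\<^bsub>M\<^esub>p\<in>A \<times> B. \<alpha> (fst p) (\<beta> (snd p) u)) = u" if u: "u \<in> carrier M" for u
  proof -
    have "(\<Oplus>\<^bsub>M\<^esub>p\<in>A \<times> B. \<alpha> (fst p) (\<beta> (snd p) u)) = (\<Oplus>\<^bsub>M\<^esub>b\<in>B. \<Oplus>\<^bsub>M\<^esub>a\<in>A. \<alpha> a (\<beta> b u))"
      using M.finsum_Times[OF A(1) B(1), of "\<lambda>p. \<alpha> (fst p) (\<beta> (snd p) u)"] closed u by simp
    also have "\<dots> = (\<Oplus>\<^bsub>M\<^esub>b\<in>B. \<beta> b u)" by (rule M.finsum_cong') (use \<alpha>(3) closed u in auto)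
    finally show ?thesis using \<beta>(3)[OF u] by simp
  qed
  moreover have "(\<lambda>u. \<alpha> a (\<beta> b u)) \<in> continuous_additive M M" if "a \<in> A" "b \<in> B" for a b
    by (rule continuous_additive_compose[OF \<beta>(1) \<alpha>(1)]) (use that in auto)
  ultimately show ?thesis
    using \<alpha>(2) \<beta>(2) closed(2) by (simp add: equivariant_partition_of_unity_def mem_Times_iff)
qed

context profinite_group_module_pair
begin

lemma lift_partition_of_unity:
  fixes W :: "(('g, 'k) cga, 'w) top_module"
  assumes \<alpha>: "U.equivariant_partition_of_unity E \<sigma> \<alpha>"
    and W: "profinite_group_module k G W"
    and \<beta>: "\<beta> \<in> continuous_hom KG V W" and \<phi>: "\<phi> \<in> continuous_hom KG U W"
    and f: "\<And>w. w \<in> E \<Longrightarrow> f w \<in> continuous_additive U V" and u: "u \<in> carrier U"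
    and lift: "\<And>w v. w \<in> E \<Longrightarrow> v \<in> carrier U \<Longrightarrow> \<beta> (f w v) = \<phi> v"
  shows "\<beta> (\<Oplus>\<^bsub>V\<^esub>w\<in>E. f w (\<alpha> w u)) = \<phi> u"
proof -
  interpret W: profinite_group_module k G W by fact
  interpret \<beta>: abelian_group_hom V W \<beta>
    by (rule continuous_hom_abelian_group_hom[OF V.left_module_axioms W.left_module_axioms \<beta>])
  interpret \<phi>: abelian_group_hom U W \<phi>
    by (rule continuous_hom_abelian_group_hom[OF U.left_module_axioms W.left_module_axioms \<phi>])
  note \<alpha> = U.equivariant_partition_of_unityD[OF \<alpha>]
  have closed: "\<alpha> w u \<in> carrier U" "f w (\<alpha> w u) \<in> carrier V" if "w \<in> E" for w
    using continuous_additive_closed[OF \<alpha>(1)[OF that] u] continuous_additive_closed[OF f[OF that]]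
    by simp_all
  have "\<beta> (\<Oplus>\<^bsub>V\<^esub>w\<in>E. f w (\<alpha> w u)) = (\<Oplus>\<^bsub>W\<^esub>w\<in>E. \<beta> (f w (\<alpha> w u)))"
    by (rule \<beta>.hom_finsum) (use closed in auto)
  also have "\<dots> = (\<Oplus>\<^bsub>W\<^esub>w\<in>E. \<phi> (\<alpha> w u))"
    by (rule W.M.finsum_cong') (use closed lift in auto)
  also have "\<dots> = \<phi> (\<Oplus>\<^bsub>U\<^esub>w\<in>E. \<alpha> w u)" by (rule \<phi>.hom_finsum[symmetric]) (use closed in auto)
  also have "\<dots> = \<phi> u" by (simp add: \<alpha>(3)[OF u])
  finally show ?thesis .
qed

text \<open>The average of the conjugates of \<open>\<psi>\<close>, weighted by \<open>\<alpha>\<close>, is a relative trace.\<close>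

lemma equivariant_lift_if_partition_of_unity:
  fixes W :: "(('g, 'k) cga, 'w) top_module"
  assumes E: "transitive_action G E \<sigma>" "finite E" "w\<^sub>0 \<in> E"
    and \<alpha>: "U.equivariant_partition_of_unity E \<sigma> \<alpha>"
    and W: "profinite_group_module k G W"
    and \<beta>: "\<beta> \<in> continuous_hom KG V W" and \<phi>: "\<phi> \<in> continuous_hom KG U W"
    and \<psi>: "\<psi> \<in> continuous_additive U V" and lift: "\<And>u. u \<in> carrier U \<Longrightarrow> \<beta> (\<psi> u) = \<phi> u"
    and D: "submodule D KG V" and equiv: "equivariant_mod (stabilizer G \<sigma> w\<^sub>0) D \<psi>"
  shows "\<exists>\<rho>\<in>continuous_additive U V. equivariant_mod (carrier G) D \<rho> \<and> (\<forall>u\<in>carrier U. \<beta> (\<rho> u) = \<phi> u)"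
proof -
  interpret E: transitive_action G E \<sigma> by fact
  note \<alpha>D = U.equivariant_partition_of_unityD[OF \<alpha>]
  have "\<forall>w\<in>E. \<exists>g. g \<in> carrier G \<and> \<sigma> g w\<^sub>0 = w" using E.unique_orbit[OF E(3)] by blast
  then obtain t where t: "\<forall>w\<in>E. t w \<in> carrier G \<and> \<sigma> (t w) w\<^sub>0 = w" by (rule bchoice[THEN exE])
  have stab: "inv\<^bsub>G\<^esub> (t (\<sigma> g w)) \<otimes>\<^bsub>G\<^esub> g \<otimes>\<^bsub>G\<^esub> t w \<in> stabilizer G \<sigma> w\<^sub>0"
    if "g \<in> carrier G" "w \<in> E" for g w
    using t that E.element_image[OF that refl] by (intro E.mem_stabilizerI[OF E(3)]) auto
  define f where "f w u = conjugate_map (t w) \<psi> (\<alpha> w u)" for w u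
  have f: "f w \<in> continuous_additive U V" if "w \<in> E" for w
    unfolding f_def
    by (rule continuous_additive_compose[OF \<alpha>D(1)[OF that] conjugate_map_continuous_additive[OF \<psi>]])
      (use t that in blast)
  have "equivariant_mod (carrier G) D (\<lambda>u. \<Oplus>\<^bsub>V\<^esub>w\<in>E. f w u)"
  proof (rule equivariant_mod_finsum[OF E.group_action_axioms D])
    show "f w u \<in> carrier V" if "w \<in> E" "u \<in> carrier U" for w u
      by (rule continuous_additive_closed[OF f[OF that(1)] that(2)])
    fix c g w u assume mem: "c \<in> carrier k" "g \<in> carrier G" "w \<in> E" "u \<in> carrier U"
    then show "D +>\<^bsub>V\<^esub> f (\<sigma> g w) (pt c g \<odot>\<^bsub>U\<^esub> u) = D +>\<^bsub>V\<^esub> pt c g \<odot>\<^bsub>V\<^esub> f w u"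
      unfolding f_def \<alpha>D(2)[OF mem] using t E.element_image[OF mem(2,3) refl]
      by (intro conjugate_map_rcos_smult[OF \<psi> D equiv] stab continuous_additive_closed[OF \<alpha>D(1)]) auto
  qed
  moreover have "(\<lambda>u. \<Oplus>\<^bsub>V\<^esub>w\<in>E. f w u) \<in> continuous_additive U V"
    by (rule V.finsum_continuous_additive[OF E(2) f])
  moreover have "\<beta> (\<Oplus>\<^bsub>V\<^esub>w\<in>E. f w u) = \<phi> u" if "u \<in> carrier U" for u
    unfolding f_def using t lift
    by (intro lift_partition_of_unity[OF \<alpha> W \<beta> \<phi> _ that] lift_conjugate_map[OF W \<beta> \<phi> \<psi>]
        conjugate_map_continuous_additive[OF \<psi>]) auto
  ultimately show ?thesis by blast
qed

end

section \<open>Relative projectivity\<close>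

context profinite_group_module
begin

lemma relatively_projective_lift:
  fixes V :: "(('g, 'k) cga, 'v) top_module" and W :: "(('g, 'k) cga, 'w) top_module"
  assumes proj: "relatively_projective k G H M" and H: "closed_subgroup H G"
    and V: "profinite_group_module k G V" and W: "profinite_group_module k G W"
    and \<beta>: "\<beta> \<in> continuous_epi KG V W" and \<phi>: "\<phi> \<in> continuous_hom KG M W"
    and \<psi>: "\<psi> \<in> continuous_additive M V" "profinite_group_module_pair.equivariant k G M V H \<psi>"
    and lift: "\<And>u. u \<in> carrier M \<Longrightarrow> \<beta> (\<psi> u) = \<phi> u"
  shows "\<exists>\<rho>\<in>continuous_hom KG M V. \<forall>u\<in>carrier M. \<beta> (\<rho> u) = \<phi> u"
proof -
  interpret V: profinite_group_module k G V by fact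
  interpret W: profinite_group_module k G W by fact
  interpret MV: profinite_group_module_pair k G M V by unfold_locales
  have "relative_lifting k G H M V W"
    by (rule relatively_projective_lifting[OF proj])
      (rule profinite_module_axioms V.profinite_module_axioms W.profinite_module_axioms)+
  moreover have "\<exists>\<psi>\<in>continuous_hom (completed_group_algebra k (sub_top_group G H))
      (restrict_scalars (cga_incl k G H) M) (restrict_scalars (cga_incl k G H) V).
      \<forall>u\<in>carrier M. \<beta> (\<psi> u) = \<phi> u"
    using \<psi> lift MV.continuous_hom_restrict_scalars_iff_equivariant[OF H] by (intro bexI[of _ \<psi>]) auto
  ultimately show ?thesis using \<beta> \<phi> unfolding relative_lifting_def by blast
qed

lemma relatively_projectiveI:
  assumes H: "closed_subgroup H G"
    and lift: "\<And>(V :: (('g, 'k) cga, ('g, 'k, 'm) test_universe) top_module)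
      (W :: (('g, 'k) cga, ('g, 'k, 'm) test_universe) top_module) \<beta> \<phi> \<psi>.
      profinite_group_module k G V \<Longrightarrow> profinite_group_module k G W \<Longrightarrow>
      \<beta> \<in> continuous_epi KG V W \<Longrightarrow> \<phi> \<in> continuous_hom KG M W \<Longrightarrow>
      \<psi> \<in> continuous_additive M V \<Longrightarrow> profinite_group_module_pair.equivariant k G M V H \<psi> \<Longrightarrow>
      (\<And>u. u \<in> carrier M \<Longrightarrow> \<beta> (\<psi> u) = \<phi> u) \<Longrightarrow>
      \<exists>\<rho>\<in>continuous_hom KG M V. \<forall>u\<in>carrier M. \<beta> (\<rho> u) = \<phi> u"
  shows "relatively_projective k G H M"
  unfolding relatively_projective_def relative_lifting_def
proof (intro allI impI ballI, elim conjE bexE)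
  fix V W :: "(('g, 'k) cga, ('g, 'k, 'm) test_universe) top_module" and \<beta> \<phi> \<psi>
  assume "profinite_module KG V" "profinite_module KG W"
  then have VW: "profinite_group_module k G V" "profinite_group_module k G W"
    by (simp_all add: profinite_group_module_def profinite_group_algebra_axioms)
  interpret V: profinite_group_module k G V by (rule VW(1))
  interpret MV: profinite_group_module_pair k G M V by unfold_locales
  assume "\<beta> \<in> continuous_epi KG V W" "\<phi> \<in> continuous_hom KG M W"
    "\<psi> \<in> continuous_hom (completed_group_algebra k (sub_top_group G H))
      (restrict_scalars (cga_incl k G H) M) (restrict_scalars (cga_incl k G H) V)"
    "\<forall>u\<in>carrier M. \<beta> (\<psi> u) = \<phi> u"
  then show "\<exists>\<rho>\<in>continuous_hom KG M V. \<forall>u\<in>carrier M. \<beta> (\<rho> u) = \<phi> u"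
    using MV.continuous_hom_restrict_scalars_iff_equivariant[OF H]
    by (intro lift[OF VW]) auto
qed

lemma relatively_projective_mono:
  assumes "relatively_projective k G H M" "closed_subgroup H G" "closed_subgroup K G" "H \<subseteq> K"
  shows "relatively_projective k G K M"
proof (rule relatively_projectiveI[OF assms(3)])
  fix V W :: "(('g, 'k) cga, ('g, 'k, 'm) test_universe) top_module" and \<beta> \<phi> \<psi>
  assume V: "profinite_group_module k G V" and W: "profinite_group_module k G W"
    and \<psi>: "\<psi> \<in> continuous_additive M V" "profinite_group_module_pair.equivariant k G M V K \<psi>"
    and rest: "\<beta> \<in> continuous_epi KG V W" "\<phi> \<in> continuous_hom KG M W"
      "\<And>u. u \<in> carrier M \<Longrightarrow> \<beta> (\<psi> u) = \<phi> u"
  interpret V: profinite_group_module k G V by fact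
  interpret MV: profinite_group_module_pair k G M V by unfold_locales
  have "MV.equivariant H \<psi>" using \<psi>(2) assms(4) by (auto simp: MV.equivariant_mod_def)
  then show "\<exists>\<rho>\<in>continuous_hom KG M V. \<forall>u\<in>carrier M. \<beta> (\<rho> u) = \<phi> u"
    by (rule relatively_projective_lift[OF assms(1,2) V W rest(1,2) \<psi>(1) _ rest(3)])
qed

lemma relatively_projective_conjugate:
  assumes proj: "relatively_projective k G H M" and H: "closed_subgroup H G" and x: "x \<in> carrier G"
  shows "relatively_projective k G (G.conjugate x H) M"
proof (rule relatively_projectiveI[OF G.closed_subgroup_conjugate[OF H x]])
  fix V W :: "(('g, 'k) cga, ('g, 'k, 'm) test_universe) top_module" and \<beta> \<phi> \<psi>
  assume V: "profinite_group_module k G V" and W: "profinite_group_module k G W"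
    and \<psi>: "\<psi> \<in> continuous_additive M V"
      "profinite_group_module_pair.equivariant k G M V (G.conjugate x H) \<psi>"
    and \<beta>: "\<beta> \<in> continuous_epi KG V W" and \<phi>: "\<phi> \<in> continuous_hom KG M W"
    and lift: "\<And>u. u \<in> carrier M \<Longrightarrow> \<beta> (\<psi> u) = \<phi> u"
  interpret V: profinite_group_module k G V by fact
  interpret MV: profinite_group_module_pair k G M V by unfold_locales
  let ?\<psi> = "MV.conjugate_map (inv\<^bsub>G\<^esub> x) \<psi>"
  have x': "inv\<^bsub>G\<^esub> x \<in> carrier G" using x by simp
  have "MV.equivariant H ?\<psi>"
    unfolding MV.equivariant_mod_def
  proof (intro ballI MV.conjugate_map_rcos_smult[OF \<psi>(1) V.submodule_zero \<psi>(2) x' x'])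
    show "inv\<^bsub>G\<^esub> (inv\<^bsub>G\<^esub> x) \<otimes>\<^bsub>G\<^esub> h \<otimes>\<^bsub>G\<^esub> inv\<^bsub>G\<^esub> x \<in> G.conjugate x H" if "h \<in> H" for h
      using that x by (auto simp: G.conjugate_eq_image)
  qed (use G.closed_subgroup_subset[OF H] in auto)
  moreover have "?\<psi> \<in> continuous_additive M V"
    by (rule MV.conjugate_map_continuous_additive[OF \<psi>(1) x'])
  moreover have "\<beta> (?\<psi> u) = \<phi> u" if "u \<in> carrier M" for u
    using \<beta> by (intro MV.lift_conjugate_map[OF W _ \<phi> \<psi>(1) lift x' that])
      (simp_all add: continuous_epi_def)
  ultimately show "\<exists>\<rho>\<in>continuous_hom KG M V. \<forall>u\<in>carrier M. \<beta> (\<rho> u) = \<phi> u"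
    by (intro relatively_projective_lift[OF proj H V W \<beta> \<phi>, of ?\<psi>])
qed

lemma relatively_projective_stabilizer:
  assumes E: "transitive_action G E \<sigma>" "finite E" "w\<^sub>0 \<in> E"
    and \<alpha>: "equivariant_partition_of_unity E \<sigma> \<alpha>" and closed: "closed_subgroup (stabilizer G \<sigma> w\<^sub>0) G"
  shows "relatively_projective k G (stabilizer G \<sigma> w\<^sub>0) M"
proof (rule relatively_projectiveI[OF closed])
  fix V W :: "(('g, 'k) cga, ('g, 'k, 'm) test_universe) top_module" and \<beta> \<phi> \<psi>
  assume V: "profinite_group_module k G V" and W: "profinite_group_module k G W"
    and \<beta>: "\<beta> \<in> continuous_epi KG V W" and \<phi>: "\<phi> \<in> continuous_hom KG M W"
    and \<psi>: "\<psi> \<in> continuous_additive M V"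
      "profinite_group_module_pair.equivariant k G M V (stabilizer G \<sigma> w\<^sub>0) \<psi>"
    and lift: "\<And>u. u \<in> carrier M \<Longrightarrow> \<beta> (\<psi> u) = \<phi> u"
  interpret V: profinite_group_module k G V by fact
  interpret MV: profinite_group_module_pair k G M V by unfold_locales
  have "\<beta> \<in> continuous_hom KG V W" using \<beta> by (simp add: continuous_epi_def)
  then have "\<exists>\<rho>\<in>continuous_additive M V. MV.equivariant (carrier G) \<rho> \<and> (\<forall>u\<in>carrier M. \<beta> (\<rho> u) = \<phi> u)"
    by (intro MV.equivariant_lift_if_partition_of_unity[OF E \<alpha> W _ \<phi> \<psi>(1) lift V.submodule_zero \<psi>(2)])
  then show "\<exists>\<rho>\<in>continuous_hom KG M V. \<forall>u\<in>carrier M. \<beta> (\<rho> u) = \<phi> u"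
    by (simp only: MV.continuous_hom_iff_equivariant Bex_def conj_assoc)
qed

end

section \<open>Higman's criterion\<close>

context profinite_group_module
begin

lemma continuous_maps_KG_eqI:
  assumes T: "Hausdorff_space T" and A: "continuous_map KGtop T A" and B: "continuous_map KGtop T B"
    and add: "\<And>r s. r \<in> carrier KG \<Longrightarrow> s \<in> carrier KG \<Longrightarrow> A (r \<oplus>\<^bsub>KG\<^esub> s) = combine (A r) (A s)"
      "\<And>r s. r \<in> carrier KG \<Longrightarrow> s \<in> carrier KG \<Longrightarrow> B (r \<oplus>\<^bsub>KG\<^esub> s) = combine (B r) (B s)"
    and pts: "\<And>c g. c \<in> carrier k \<Longrightarrow> g \<in> carrier G \<Longrightarrow> A (pt c g) = B (pt c g)"
    and r: "r \<in> carrier KG"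
  shows "A r = B r"
proof -
  have "r \<in> {r \<in> topspace KGtop. A r = B r}"
  proof (rule closed_point_span_induct)
    show "r \<in> closed_point_span (carrier G)" using r KG_subset_closed_point_span by blast
    show "closedin KGtop {r \<in> topspace KGtop. A r = B r}" by (rule closedin_continuous_maps_eq[OF T A B])
    show "\<zero>\<^bsub>KG\<^esub> \<in> {r \<in> topspace KGtop. A r = B r}"
      using pts[OF k.zero_closed G.one_closed] by (simp add: pt_zero topspace_KGtop KG_zero_closed)
    show "pt c h \<oplus>\<^bsub>KG\<^esub> s \<in> {r \<in> topspace KGtop. A r = B r}"
      if "c \<in> carrier k" "h \<in> carrier G" "s \<in> {r \<in> topspace KGtop. A r = B r}" for c h s
      using that by (simp add: topspace_KGtop KG_add_closed pt_closed add pts)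
  qed
  then show ?thesis by blast
qed

lemma continuous_map_KG_mult:
  assumes "r \<in> carrier KG"
  shows "continuous_map KGtop KGtop (\<lambda>s. r \<otimes>\<^bsub>KG\<^esub> s)" "continuous_map KGtop KGtop (\<lambda>s. s \<otimes>\<^bsub>KG\<^esub> r)"
proof -
  have "(r \<otimes>\<^bsub>KG\<^esub> a) N = (r \<otimes>\<^bsub>KG\<^esub> b) N" "(a \<otimes>\<^bsub>KG\<^esub> r) N = (b \<otimes>\<^bsub>KG\<^esub> r) N"
    if "N \<in> ONS" "a N = b N" for a b N using that by (simp_all add: KG_mult)
  then show "continuous_map KGtop KGtop (\<lambda>s. r \<otimes>\<^bsub>KG\<^esub> s)" "continuous_map KGtop KGtop (\<lambda>s. s \<otimes>\<^bsub>KG\<^esub> r)"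
    using assms by (intro continuous_map_KG_KG Pi_I R.m_closed; blast)+
qed

end

locale permutation_tensor = profinite_group_module k G M + E: group_action G E \<sigma>
  for k :: "('k, 'a) ring_scheme" and G :: "('g, 'b) top_group_scheme"
    and M :: "(('g, 'k) cga, 'm) top_module" and E :: "'w set" and \<sigma> +
  fixes L :: "'g set"
  assumes finite_E: "finite E" and L: "L \<in> open_normal_subgroups G"
    and L_acts_trivially: "g \<in> L \<Longrightarrow> w \<in> E \<Longrightarrow> \<sigma> g w = w"
begin

definition transporter :: "'w \<Rightarrow> 'w \<Rightarrow> 'g set" where
  "transporter y x = {g \<in> carrier G. \<sigma> g y = x}"

text \<open>The module \<open>k[E] \<otimes> M\<close> with diagonal action, as functions \<open>E \<rightarrow> M\<close>.  A group element acts by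
  \<open>(g f) x = g (f (g\<^sup>-\<^sup>1 x))\<close>, so in the matrix of a general element of \<open>k[[G]]\<close> the entry at \<open>(x, y)\<close> is its
  restriction to the clopen set \<open>transporter y x\<close>.\<close>

definition tensor :: "(('g, 'k) cga, 'w \<Rightarrow> 'm) top_module" where
  "tensor = \<lparr>carrier = E \<rightarrow>\<^sub>E carrier M, mult = undefined, one = undefined,
     zero = (\<lambda>x\<in>E. \<zero>\<^bsub>M\<^esub>), add = (\<lambda>f h. \<lambda>x\<in>E. f x \<oplus>\<^bsub>M\<^esub> h x),
     smult = (\<lambda>r f. \<lambda>x\<in>E. \<Oplus>\<^bsub>M\<^esub>y\<in>E. restriction L (transporter y x) r \<odot>\<^bsub>M\<^esub> f y),
     mtopology = product_topology (\<lambda>_. Mtop) E\<rparr>"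

lemma tensor_simps:
  "carrier tensor = E \<rightarrow>\<^sub>E carrier M" "\<zero>\<^bsub>tensor\<^esub> = (\<lambda>x\<in>E. \<zero>\<^bsub>M\<^esub>)" "f \<oplus>\<^bsub>tensor\<^esub> h = (\<lambda>x\<in>E. f x \<oplus>\<^bsub>M\<^esub> h x)"
  "r \<odot>\<^bsub>tensor\<^esub> f = (\<lambda>x\<in>E. \<Oplus>\<^bsub>M\<^esub>y\<in>E. restriction L (transporter y x) r \<odot>\<^bsub>M\<^esub> f y)"
  "mtopology tensor = product_topology (\<lambda>_. Mtop) E"
  by (simp_all add: tensor_def)

lemma tensor_apply_closed: "f \<in> carrier tensor \<Longrightarrow> x \<in> E \<Longrightarrow> f x \<in> carrier M"
  by (auto simp: tensor_simps)

lemma tensor_ext: "f \<in> carrier tensor \<Longrightarrow> h \<in> carrier tensor \<Longrightarrow> (\<And>x. x \<in> E \<Longrightarrow> f x = h x) \<Longrightarrow> f = h"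
  unfolding tensor_simps by (rule PiE_ext)

lemma topspace_tensor: "topspace (mtopology tensor) = carrier tensor"
  by (simp add: tensor_simps topspace_mtopology)

lemma profinite_space_tensor: "profinite_space (mtopology tensor)"
  by (simp add: tensor_simps profinite_space_product_topology profinite_topology)

lemma continuous_map_into_tensor:
  assumes "f \<in> topspace X \<rightarrow> carrier tensor" "\<And>x. x \<in> E \<Longrightarrow> continuous_map X Mtop (\<lambda>z. f z x)"
  shows "continuous_map X (mtopology tensor) f"
  unfolding tensor_simps continuous_map_componentwise using assms
  by (auto simp: tensor_simps Pi_iff PiE_def)

lemma evaluation_continuous_additive:
  assumes x: "x \<in> E"
  shows "(\<lambda>f. f x) \<in> continuous_additive tensor M"
  using x continuous_map_product_projection[OF x, of "\<lambda>_. Mtop"]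
  by (auto simp: continuous_additive_def tensor_simps)

lemma continuous_map_tensor_apply:
  assumes "continuous_map X (mtopology tensor) f" "x \<in> E"
  shows "continuous_map X Mtop (\<lambda>z. f z x)"
  using continuous_map_compose[OF assms(1)
      continuous_additive_continuous[OF evaluation_continuous_additive[OF assms(2)]]]
  by (simp add: o_def)

lemma abelian_group_tensor: "abelian_group tensor"
proof (rule abelian_groupI)
  fix f assume f: "f \<in> carrier tensor"
  show "\<exists>h\<in>carrier tensor. h \<oplus>\<^bsub>tensor\<^esub> f = \<zero>\<^bsub>tensor\<^esub>"
    by (rule bexI[of _ "\<lambda>x\<in>E. \<ominus>\<^bsub>M\<^esub> f x"]) (use f in \<open>auto simp: tensor_simps intro!: restrict_ext M.l_neg\<close>)
  show "\<zero>\<^bsub>tensor\<^esub> \<oplus>\<^bsub>tensor\<^esub> f = f"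
    by (rule tensor_ext) (use f tensor_apply_closed[OF f] in \<open>auto simp: tensor_simps\<close>)
qed (auto simp: tensor_simps PiE_iff M.a_ac intro!: restrict_ext)

lemma transporter_saturated:
  assumes y: "y \<in> E"
  shows "saturated L (transporter y x)"
  unfolding saturated_def
proof (intro ballI impI subsetI)
  fix C z g assume C: "C \<in> cosets L" and z: "z \<in> C" "z \<in> transporter y x" and g: "g \<in> C"
  obtain l where l: "l \<in> L" "g = l \<otimes>\<^bsub>G\<^esub> z" using coset_eqI(1)[OF L C z(1)] g by (auto simp: r_coset_def)
  have lG: "l \<in> carrier G" using l(1) G.open_normal_subset[OF L] by blast
  have zG: "z \<in> carrier G" "\<sigma> z y = x" using z(2) by (auto simp: transporter_def)
  then have "x \<in> E" using E.element_image y by blast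
  then have "\<sigma> g y = x" using l zG E.composition_rule[OF y lG zG(1)] L_acts_trivially by simp
  then show "g \<in> transporter y x" using l(2) lG zG(1) by (simp add: transporter_def)
qed

lemmas entry_closed = restriction_closed[OF L transporter_saturated]
  and entry_add = restriction_add[OF L transporter_saturated]
  and entry_pt = restriction_pt[OF L transporter_saturated]
  and continuous_map_entry = continuous_map_restriction[OF L transporter_saturated]

lemma entry_smult_closed:
  "r \<in> carrier KG \<Longrightarrow> f \<in> carrier tensor \<Longrightarrow> y \<in> E \<Longrightarrow> restriction L (transporter y x) r \<odot>\<^bsub>M\<^esub> f y \<in> carrier M"
  by (intro smult_closed entry_closed tensor_apply_closed)

lemma tensor_smult_closed: "r \<in> carrier KG \<Longrightarrow> f \<in> carrier tensor \<Longrightarrow> r \<odot>\<^bsub>tensor\<^esub> f \<in> carrier tensor"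
  using entry_smult_closed by (auto simp: tensor_simps intro!: M.finsum_closed)

lemma tensor_smult_l_distr:
  assumes r: "r \<in> carrier KG" and s: "s \<in> carrier KG" and f: "f \<in> carrier tensor"
  shows "(r \<oplus>\<^bsub>KG\<^esub> s) \<odot>\<^bsub>tensor\<^esub> f = r \<odot>\<^bsub>tensor\<^esub> f \<oplus>\<^bsub>tensor\<^esub> s \<odot>\<^bsub>tensor\<^esub> f"
proof -
  have "(\<Oplus>\<^bsub>M\<^esub>y\<in>E. restriction L (transporter y x) (r \<oplus>\<^bsub>KG\<^esub> s) \<odot>\<^bsub>M\<^esub> f y)
      = (\<Oplus>\<^bsub>M\<^esub>y\<in>E. restriction L (transporter y x) r \<odot>\<^bsub>M\<^esub> f y) \<oplus>\<^bsub>M\<^esub>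
        (\<Oplus>\<^bsub>M\<^esub>y\<in>E. restriction L (transporter y x) s \<odot>\<^bsub>M\<^esub> f y)" for x
  proof -
    have "(\<Oplus>\<^bsub>M\<^esub>y\<in>E. restriction L (transporter y x) (r \<oplus>\<^bsub>KG\<^esub> s) \<odot>\<^bsub>M\<^esub> f y)
        = (\<Oplus>\<^bsub>M\<^esub>y\<in>E. restriction L (transporter y x) r \<odot>\<^bsub>M\<^esub> f y \<oplus>\<^bsub>M\<^esub>
          restriction L (transporter y x) s \<odot>\<^bsub>M\<^esub> f y)"
      by (rule M.finsum_cong')
        (use r s f entry_smult_closed in \<open>auto simp: entry_add intro!: smult_l_distr entry_closed
            tensor_apply_closed\<close>)
    also have "\<dots> = (\<Oplus>\<^bsub>M\<^esub>y\<in>E. restriction L (transporter y x) r \<odot>\<^bsub>M\<^esub> f y) \<oplus>\<^bsub>M\<^esub>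
        (\<Oplus>\<^bsub>M\<^esub>y\<in>E. restriction L (transporter y x) s \<odot>\<^bsub>M\<^esub> f y)"
      by (rule M.finsum_addf) (use r s f entry_smult_closed in auto)
    finally show ?thesis .
  qed
  then show ?thesis by (auto simp: tensor_simps intro!: restrict_ext)
qed

lemma tensor_smult_r_distr:
  assumes r: "r \<in> carrier KG" and f: "f \<in> carrier tensor" and h: "h \<in> carrier tensor"
  shows "r \<odot>\<^bsub>tensor\<^esub> (f \<oplus>\<^bsub>tensor\<^esub> h) = r \<odot>\<^bsub>tensor\<^esub> f \<oplus>\<^bsub>tensor\<^esub> r \<odot>\<^bsub>tensor\<^esub> h"
proof -
  have "(\<lambda>f. \<Oplus>\<^bsub>M\<^esub>y\<in>E. restriction L (transporter y x) r \<odot>\<^bsub>M\<^esub> f y) \<in> continuous_additive tensor M" for x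
    by (intro finsum_continuous_additive finite_E
        continuous_additive_compose[OF evaluation_continuous_additive smult_continuous_additive]
        entry_closed r)
  note entries_add = continuous_additive_add[OF this f h]
  show ?thesis
    unfolding tensor_simps(4)[of r "f \<oplus>\<^bsub>tensor\<^esub> h"] entries_add
    by (simp add: tensor_simps(3,4) cong: restrict_cong)
qed

lemma tensor_pt_smult:
  assumes c: "c \<in> carrier k" and g: "g \<in> carrier G" and f: "f \<in> carrier tensor"
  shows "pt c g \<odot>\<^bsub>tensor\<^esub> f = (\<lambda>x\<in>E. pt c g \<odot>\<^bsub>M\<^esub> f (\<sigma> (inv\<^bsub>G\<^esub> g) x))"
  unfolding tensor_simps(4)
proof (rule restrict_ext)
  fix x assume x: "x \<in> E"
  let ?y = "\<sigma> (inv\<^bsub>G\<^esub> g) x"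
  have y: "?y \<in> E" using E.element_image[OF _ x refl] g by simp
  have "(\<Oplus>\<^bsub>M\<^esub>y\<in>E. restriction L (transporter y x) (pt c g) \<odot>\<^bsub>M\<^esub> f y)
      = (\<Oplus>\<^bsub>M\<^esub>y\<in>E. if ?y = y then pt c g \<odot>\<^bsub>M\<^esub> f y else \<zero>\<^bsub>M\<^esub>)"
  proof (rule M.finsum_cong')
    fix y assume y: "y \<in> E"
    have "g \<in> transporter y x \<longleftrightarrow> ?y = y" using E.action_eq_iff[OF g x y] g by (auto simp: transporter_def)
    then show "restriction L (transporter y x) (pt c g) \<odot>\<^bsub>M\<^esub> f y = (if ?y = y then pt c g \<odot>\<^bsub>M\<^esub> f y else \<zero>\<^bsub>M\<^esub>)"
      using pt_zero_smult[OF g tensor_apply_closed[OF f y]] by (simp add: entry_pt[OF y c g])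
  qed (use c g f tensor_apply_closed in auto)
  also have "\<dots> = pt c g \<odot>\<^bsub>M\<^esub> f ?y"
    by (rule M.finsum_singleton[OF y finite_E]) (use c g f tensor_apply_closed in auto)
  finally show "(\<Oplus>\<^bsub>M\<^esub>y\<in>E. restriction L (transporter y x) (pt c g) \<odot>\<^bsub>M\<^esub> f y) = pt c g \<odot>\<^bsub>M\<^esub> f ?y" .
qed

lemma continuous_map_tensor_smult:
  assumes r: "continuous_map X KGtop r" and f: "continuous_map X (mtopology tensor) f"
  shows "continuous_map X (mtopology tensor) (\<lambda>z. r z \<odot>\<^bsub>tensor\<^esub> f z)"
proof (rule continuous_map_into_tensor)
  show "(\<lambda>z. r z \<odot>\<^bsub>tensor\<^esub> f z) \<in> topspace X \<rightarrow> carrier tensor"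
    using continuous_map_funspace[OF r] continuous_map_funspace[OF f]
    by (auto simp: topspace_KGtop topspace_tensor intro!: tensor_smult_closed)
  fix x assume x: "x \<in> E"
  have "continuous_map X Mtop (\<lambda>z. \<Oplus>\<^bsub>M\<^esub>y\<in>E. restriction L (transporter y x) (r z) \<odot>\<^bsub>M\<^esub> f z y)"
  proof (rule continuous_map_finsum[OF finite_E])
    fix y assume y: "y \<in> E"
    have "continuous_map X KGtop (\<lambda>z. restriction L (transporter y x) (r z))"
      using continuous_map_compose[OF r continuous_map_entry[OF y]] by (simp add: o_def)
    then show "continuous_map X Mtop (\<lambda>z. restriction L (transporter y x) (r z) \<odot>\<^bsub>M\<^esub> f z y)"
      by (rule continuous_map_smult[OF _ continuous_map_tensor_apply[OF f y]])
  qed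
  then show "continuous_map X Mtop (\<lambda>z. (r z \<odot>\<^bsub>tensor\<^esub> f z) x)" using x by (simp add: tensor_simps)
qed

lemma tensor_pt_smult_pt_smult:
  assumes c: "c \<in> carrier k" "d \<in> carrier k" and g: "g \<in> carrier G" "h \<in> carrier G"
    and f: "f \<in> carrier tensor"
  shows "pt c g \<odot>\<^bsub>tensor\<^esub> (pt d h \<odot>\<^bsub>tensor\<^esub> f) = (pt c g \<otimes>\<^bsub>KG\<^esub> pt d h) \<odot>\<^bsub>tensor\<^esub> f"
proof -
  have closed: "\<sigma> (inv\<^bsub>G\<^esub> g) x \<in> E" "\<sigma> (inv\<^bsub>G\<^esub> h) (\<sigma> (inv\<^bsub>G\<^esub> g) x) \<in> E" if "x \<in> E" for x
    using that g E.element_image[OF _ _ refl] by auto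
  have "pt c g \<odot>\<^bsub>tensor\<^esub> (pt d h \<odot>\<^bsub>tensor\<^esub> f) = (\<lambda>x\<in>E. pt c g \<odot>\<^bsub>M\<^esub> (pt d h \<odot>\<^bsub>M\<^esub> f (\<sigma> (inv\<^bsub>G\<^esub> h) (\<sigma> (inv\<^bsub>G\<^esub> g) x))))"
    unfolding tensor_pt_smult[OF c(1) g(1) tensor_smult_closed[OF pt_closed[OF c(2) g(2)] f]]
    by (rule restrict_ext) (simp add: tensor_pt_smult[OF c(2) g(2) f] closed)
  also have "\<dots> = (\<lambda>x\<in>E. pt (c \<otimes>\<^bsub>k\<^esub> d) (g \<otimes>\<^bsub>G\<^esub> h) \<odot>\<^bsub>M\<^esub> f (\<sigma> (inv\<^bsub>G\<^esub> (g \<otimes>\<^bsub>G\<^esub> h)) x))"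
    by (rule restrict_ext)
      (use c g f closed tensor_apply_closed in \<open>simp add: pt_smult_smult E.composition_rule
          G.inv_mult_group\<close>)
  also have "\<dots> = (pt c g \<otimes>\<^bsub>KG\<^esub> pt d h) \<odot>\<^bsub>tensor\<^esub> f" using c g f by (simp add: pt_mult tensor_pt_smult)
  finally show ?thesis .
qed

lemma tensor_smult_assoc:
  assumes r: "r \<in> carrier KG" and s: "s \<in> carrier KG" and f: "f \<in> carrier tensor"
  shows "(r \<otimes>\<^bsub>KG\<^esub> s) \<odot>\<^bsub>tensor\<^esub> f = r \<odot>\<^bsub>tensor\<^esub> (s \<odot>\<^bsub>tensor\<^esub> f)"
proof -
  have T: "Hausdorff_space (mtopology tensor)" using profinite_space_tensor
    by (simp add: profinite_space_def)
  have cont: "continuous_map KGtop (mtopology tensor) (\<lambda>r. q r \<odot>\<^bsub>tensor\<^esub> h)"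
    if "continuous_map KGtop KGtop q" "h \<in> carrier tensor" for q h
    by (rule continuous_map_tensor_smult[OF that(1)]) (simp add: that(2) topspace_tensor)
  have id: "continuous_map KGtop KGtop (\<lambda>r. r)" using continuous_map_id[of KGtop] by (simp add: id_def)
  have pt: "(pt c g \<otimes>\<^bsub>KG\<^esub> s) \<odot>\<^bsub>tensor\<^esub> f = pt c g \<odot>\<^bsub>tensor\<^esub> (s \<odot>\<^bsub>tensor\<^esub> f)"
    if cg: "c \<in> carrier k" "g \<in> carrier G" for c g
  proof (rule continuous_maps_KG_eqI[OF T _ _ _ _ _ s, where combine = "add tensor"])
    note p = pt_closed[OF cg]
    show "continuous_map KGtop (mtopology tensor) (\<lambda>s. (pt c g \<otimes>\<^bsub>KG\<^esub> s) \<odot>\<^bsub>tensor\<^esub> f)"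
      by (rule cont[OF continuous_map_KG_mult(1)[OF p] f])
    show "continuous_map KGtop (mtopology tensor) (\<lambda>s. pt c g \<odot>\<^bsub>tensor\<^esub> (s \<odot>\<^bsub>tensor\<^esub> f))"
      by (rule continuous_map_tensor_smult[OF _ cont[OF id f]]) (simp add: p topspace_KGtop)
    show "(pt c g \<otimes>\<^bsub>KG\<^esub> (r \<oplus>\<^bsub>KG\<^esub> s)) \<odot>\<^bsub>tensor\<^esub> f = (pt c g \<otimes>\<^bsub>KG\<^esub> r) \<odot>\<^bsub>tensor\<^esub> f \<oplus>\<^bsub>tensor\<^esub> (pt c g \<otimes>\<^bsub>KG\<^esub> s) \<odot>\<^bsub>tensor\<^esub> f"
      "pt c g \<odot>\<^bsub>tensor\<^esub> ((r \<oplus>\<^bsub>KG\<^esub> s) \<odot>\<^bsub>tensor\<^esub> f)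
        = pt c g \<odot>\<^bsub>tensor\<^esub> (r \<odot>\<^bsub>tensor\<^esub> f) \<oplus>\<^bsub>tensor\<^esub> pt c g \<odot>\<^bsub>tensor\<^esub> (s \<odot>\<^bsub>tensor\<^esub> f)"
      if "r \<in> carrier KG" "s \<in> carrier KG" for r s
      using that p f by (simp_all add: R.r_distr tensor_smult_l_distr tensor_smult_r_distr
          tensor_smult_closed)
  qed (simp add: tensor_pt_smult_pt_smult cg f)
  show ?thesis
  proof (rule continuous_maps_KG_eqI[where A = "\<lambda>r. (r \<otimes>\<^bsub>KG\<^esub> s) \<odot>\<^bsub>tensor\<^esub> f" and combine = "add tensor",
      OF T _ _ _ _ pt r])
    show "continuous_map KGtop (mtopology tensor) (\<lambda>r. (r \<otimes>\<^bsub>KG\<^esub> s) \<odot>\<^bsub>tensor\<^esub> f)"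
      by (rule cont[OF continuous_map_KG_mult(2)[OF s] f])
    show "continuous_map KGtop (mtopology tensor) (\<lambda>r. r \<odot>\<^bsub>tensor\<^esub> (s \<odot>\<^bsub>tensor\<^esub> f))"
      by (rule cont[OF id tensor_smult_closed[OF s f]])
  qed (use s f in \<open>simp_all add: R.l_distr tensor_smult_l_distr tensor_smult_closed\<close>)
qed

lemma profinite_group_module_tensor: "profinite_group_module k G tensor"
proof -
  have one: "\<one>\<^bsub>KG\<^esub> \<odot>\<^bsub>tensor\<^esub> f = f" if f: "f \<in> carrier tensor" for f
  proof (rule tensor_ext[OF tensor_smult_closed[OF R.one_closed f] f])
    show "(\<one>\<^bsub>KG\<^esub> \<odot>\<^bsub>tensor\<^esub> f) x = f x" if x: "x \<in> E" for x
      using x tensor_apply_closed[OF f x] E.id_eq_one[THEN fun_cong, of x]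
      by (simp add: pt_one tensor_pt_smult f pt_one_smult)
  qed
  have "continuous_map (prod_topology KGtop (mtopology tensor)) (mtopology tensor)
      (\<lambda>z. fst z \<odot>\<^bsub>tensor\<^esub> snd z)"
    by (rule continuous_map_tensor_smult[OF continuous_map_fst continuous_map_snd])
  moreover have "continuous_map (prod_topology (mtopology tensor) (mtopology tensor)) (mtopology tensor)
      (\<lambda>z. fst z \<oplus>\<^bsub>tensor\<^esub> snd z)"
  proof (rule continuous_map_into_tensor)
    fix x assume x: "x \<in> E"
    have "continuous_map (prod_topology (mtopology tensor) (mtopology tensor)) Mtop
        (\<lambda>z. fst z x \<oplus>\<^bsub>M\<^esub> snd z x)"
      by (intro continuous_map_add continuous_map_tensor_apply[OF continuous_map_fst x]
          continuous_map_tensor_apply[OF continuous_map_snd x])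
    then show "continuous_map (prod_topology (mtopology tensor) (mtopology tensor)) Mtop
        (\<lambda>z. (fst z \<oplus>\<^bsub>tensor\<^esub> snd z) x)"
      using x by (simp add: tensor_simps)
  qed (auto simp: topspace_tensor intro:
      abelian_group.axioms(1)[OF abelian_group_tensor, THEN abelian_monoid.a_closed])
  ultimately have "profinite_module KG tensor"
    by (intro profinite_module.intro left_module.intro left_module_axioms.intro
        profinite_module_axioms.intro R.ring_axioms abelian_group_tensor tensor_smult_closed
        tensor_smult_l_distr tensor_smult_r_distr tensor_smult_assoc one topspace_tensor
        profinite_space_tensor)
      (simp_all add: case_prod_unfold)
  then show ?thesis by (intro profinite_group_module.intro profinite_group_algebra_axioms)
qed

end

context permutation_tensor
begin

sublocale T: profinite_group_module k G tensor
  by (rule profinite_group_module_tensor)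

sublocale MT: profinite_group_module_pair k G M tensor
  by unfold_locales

sublocale TM: profinite_group_module_pair k G tensor M
  by unfold_locales

definition concentrated :: "'w \<Rightarrow> 'm \<Rightarrow> 'w \<Rightarrow> 'm" where
  "concentrated w u = (\<lambda>x\<in>E. if x = w then u else \<zero>\<^bsub>M\<^esub>)"

lemma concentrated_continuous_additive: "concentrated w \<in> continuous_additive M tensor"
proof -
  have "continuous_map Mtop (mtopology tensor) (concentrated w)"
  proof (rule continuous_map_into_tensor)
    show "continuous_map Mtop Mtop (\<lambda>u. concentrated w u x)" if "x \<in> E" for x
      using that continuous_map_id[of Mtop]
      by (cases "x = w") (simp_all add: concentrated_def id_def topspace_mtopology)
  qed (simp add: concentrated_def tensor_simps topspace_mtopology)
  then show ?thesis
    by (auto simp: continuous_additive_def concentrated_def tensor_simps intro!: restrict_ext)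
qed

lemma concentrated_equivariant:
  assumes w: "w \<in> E"
  shows "MT.equivariant (stabilizer G \<sigma> w) (concentrated w)"
  unfolding MT.equivariant_iff[OF concentrated_continuous_additive E.stabilizer_subset]
proof (intro ballI)
  fix c g u assume c: "c \<in> carrier k" and g: "g \<in> stabilizer G \<sigma> w" and u: "u \<in> carrier M"
  have gG: "g \<in> carrier G" and "\<sigma> g w = w" using g by (auto simp: stabilizer_def)
  then have "\<sigma> (inv\<^bsub>G\<^esub> g) x = w \<longleftrightarrow> x = w" if "x \<in> E" for x
    using E.action_eq_iff[of "inv\<^bsub>G\<^esub> g" w x] that w by auto
  then show "concentrated w (pt c g \<odot>\<^bsub>M\<^esub> u) = pt c g \<odot>\<^bsub>tensor\<^esub> concentrated w u"
    unfolding tensor_pt_smult[OF c gG continuous_additive_closed[OF concentrated_continuous_additive u]]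
    using c gG u E.element_image[OF _ _ refl] pt_closed
    by (auto simp: concentrated_def intro!: restrict_ext)
qed

lemma finsum_concentrated:
  assumes w: "w \<in> E" and u: "u \<in> carrier M"
  shows "(\<Oplus>\<^bsub>M\<^esub>x\<in>E. concentrated w u x) = u"
proof -
  have "(\<Oplus>\<^bsub>M\<^esub>x\<in>E. concentrated w u x) = (\<Oplus>\<^bsub>M\<^esub>x\<in>E. if w = x then u else \<zero>\<^bsub>M\<^esub>)"
    by (rule M.finsum_cong') (use u in \<open>auto simp: concentrated_def\<close>)
  also have "\<dots> = u" by (rule M.finsum_singleton[OF w finite_E]) (use u in auto)
  finally show ?thesis .
qed

lemma summation_continuous_epi:
  assumes "E \<noteq> {}"
  shows "(\<lambda>f. \<Oplus>\<^bsub>M\<^esub>x\<in>E. f x) \<in> continuous_epi KG tensor M"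
proof -
  have "TM.equivariant (carrier G) (\<lambda>f. \<Oplus>\<^bsub>M\<^esub>x\<in>E. f x)"
  proof (rule TM.equivariant_mod_finsum[OF E.group_action_axioms submodule_zero tensor_apply_closed])
    show "{\<zero>\<^bsub>M\<^esub>} +>\<^bsub>M\<^esub> (pt c g \<odot>\<^bsub>tensor\<^esub> f) (\<sigma> g x) = {\<zero>\<^bsub>M\<^esub>} +>\<^bsub>M\<^esub> pt c g \<odot>\<^bsub>M\<^esub> f x"
      if "c \<in> carrier k" "g \<in> carrier G" "x \<in> E" "f \<in> carrier tensor" for c g x f
      using that E.element_image[OF _ _ refl] by (simp add: tensor_pt_smult E.inverse_rule)
  qed
  moreover have "(\<lambda>f. \<Oplus>\<^bsub>M\<^esub>x\<in>E. f x) \<in> continuous_additive tensor M"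
    by (rule finsum_continuous_additive[OF finite_E evaluation_continuous_additive])
  ultimately have hom: "(\<lambda>f. \<Oplus>\<^bsub>M\<^esub>x\<in>E. f x) \<in> continuous_hom KG tensor M"
    by (simp add: TM.continuous_hom_iff_equivariant)
  obtain w where w: "w \<in> E" using assms by blast
  have "u \<in> (\<lambda>f. \<Oplus>\<^bsub>M\<^esub>x\<in>E. f x) ` carrier tensor" if u: "u \<in> carrier M" for u
    using finsum_concentrated[OF w u, symmetric]
      continuous_additive_closed[OF concentrated_continuous_additive u]
    by (rule image_eqI)
  then show ?thesis using continuous_hom_closed[OF hom] hom by (auto simp: continuous_epi_def)
qed

lemma partition_of_unity_if_relatively_projective:
  assumes proj: "relatively_projective k G Q M" and Q: "closed_subgroup Q G"
    and w: "w \<in> E" and stab: "Q \<subseteq> stabilizer G \<sigma> w"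
  shows "\<exists>\<alpha>. equivariant_partition_of_unity E \<sigma> \<alpha>"
proof -
  have "MT.equivariant Q (concentrated w)"
    using concentrated_equivariant[OF w] stab by (auto simp: MT.equivariant_mod_def)
  then have "\<exists>\<rho>\<in>continuous_hom KG M tensor. \<forall>u\<in>carrier M. (\<Oplus>\<^bsub>M\<^esub>x\<in>E. \<rho> u x) = u"
    using w
    by (intro relatively_projective_lift[where \<beta> = "\<lambda>f. \<Oplus>\<^bsub>M\<^esub>x\<in>E. f x" and \<phi> = "\<lambda>u. u"
          and \<psi> = "concentrated w",
        OF proj Q T.profinite_group_module_axioms profinite_group_module_axioms]
        summation_continuous_epi continuous_hom_id concentrated_continuous_additive
          finsum_concentrated) auto
  then obtain \<rho> where \<rho>: "\<rho> \<in> continuous_hom KG M tensor" "\<forall>u\<in>carrier M. (\<Oplus>\<^bsub>M\<^esub>x\<in>E. \<rho> u x) = u"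
    by blast
  have "equivariant_partition_of_unity E \<sigma> (\<lambda>x u. \<rho> u x)"
    unfolding equivariant_partition_of_unity_def
  proof (intro conjI ballI)
    show "(\<lambda>u. \<rho> u x) \<in> continuous_additive M M" if "x \<in> E" for x
      by (rule continuous_additive_compose[OF continuous_hom_imp_continuous_additive[OF \<rho>(1)]
          evaluation_continuous_additive[OF that]])
    show "\<rho> (pt c g \<odot>\<^bsub>M\<^esub> u) (\<sigma> g x) = pt c g \<odot>\<^bsub>M\<^esub> \<rho> u x"
      if "c \<in> carrier k" "g \<in> carrier G" "x \<in> E" "u \<in> carrier M" for c g x u
      using that E.element_image[OF _ _ refl] continuous_hom_closed[OF \<rho>(1)] continuous_hom_smult[OF \<rho>(1)]
      by (simp add: pt_closed tensor_pt_smult E.inverse_rule)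
  qed (use \<rho>(2) in blast)
  then show ?thesis by blast
qed

end

lemma (in profinite_group_module) rcosets_partition_of_unity:
  assumes proj: "relatively_projective k G Q M" and Q: "closed_subgroup Q G"
    and H: "subgroup H G" "openin G.Gtop H" and QH: "Q \<subseteq> H"
  shows "\<exists>\<alpha>. equivariant_partition_of_unity (rcosets\<^bsub>G\<^esub> H) (\<lambda>g. \<lambda>C\<in>rcosets\<^bsub>G\<^esub> H. C #>\<^bsub>G\<^esub> inv\<^bsub>G\<^esub> g) \<alpha>"
proof -
  let ?E = "rcosets\<^bsub>G\<^esub> H" and ?\<sigma> = "\<lambda>g. \<lambda>C\<in>rcosets\<^bsub>G\<^esub> H. C #>\<^bsub>G\<^esub> inv\<^bsub>G\<^esub> g"
  have HG: "H \<subseteq> carrier G" by (rule subgroup.subset[OF H(1)])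
  obtain L where L: "L \<in> ONS" "\<And>g C. g \<in> L \<Longrightarrow> C \<in> ?E \<Longrightarrow> C #>\<^bsub>G\<^esub> inv\<^bsub>G\<^esub> g = C"
    using G.rcosets_action_open_kernel[OF H] by metis
  interpret permutation_tensor k G M ?E ?\<sigma> L
    using L(2) transitive_action.axioms(1)[OF G.rcosets_transitive_action[OF H(1)]]
    by (intro permutation_tensor.intro permutation_tensor_axioms.intro profinite_group_module_axioms
        G.finite_rcosets_open_subgroup[OF H] L(1)) auto
  have "stabilizer G ?\<sigma> H = H"
    using G.stabilizer_rcoset[OF H(1) G.one_closed] G.conjugate_one[OF HG] HG by simp
  then show ?thesis
    using partition_of_unity_if_relatively_projective[OF proj Q
        subgroup.subgroup_in_rcosets[OF H(1) G.is_group]] QH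
    by simp
qed

section \<open>Mackey's theorem for indecomposable modules\<close>

locale indecomposable_profinite_group_module =
  profinite_group_module k G M + indecomposable_profinite_module "completed_group_algebra k G" M
  for k :: "('k, 'a) ring_scheme" and G :: "('g, 'b) top_group_scheme"
    and M :: "(('g, 'k) cga, 'm) top_module"

sublocale profinite_group_module \<subseteq> MM: profinite_group_module_pair k G M M
  by unfold_locales

lemma (in profinite_group_module) finsum_orbit_End:
  assumes E: "group_action G E \<sigma>" "finite E" and \<alpha>: "equivariant_partition_of_unity E \<sigma> \<alpha>" and w: "w \<in> E"
  shows "(\<lambda>u. \<Oplus>\<^bsub>M\<^esub>x\<in>orbit G \<sigma> w. \<alpha> x u) \<in> End"
proof -
  interpret E: group_action G E \<sigma> by fact
  interpret orbit: transitive_action G "orbit G \<sigma> w" "\<lambda>g. \<lambda>x\<in>orbit G \<sigma> w. \<sigma> g x"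
    by (rule E.orbit_transitive_action[OF w])
  note \<alpha> = equivariant_partition_of_unityD[OF \<alpha>]
  note SE = E.orbit_subset[OF w]
  have "MM.equivariant (carrier G) (\<lambda>u. \<Oplus>\<^bsub>M\<^esub>x\<in>orbit G \<sigma> w. \<alpha> x u)"
  proof (rule MM.equivariant_mod_finsum[OF orbit.group_action_axioms submodule_zero])
    show "\<alpha> x u \<in> carrier M" if "x \<in> orbit G \<sigma> w" "u \<in> carrier M" for x u
      using continuous_additive_closed[OF \<alpha>(1)] that SE by blast
  qed (use \<alpha>(2) SE in \<open>auto simp: subset_iff\<close>)
  moreover have "(\<lambda>u. \<Oplus>\<^bsub>M\<^esub>x\<in>orbit G \<sigma> w. \<alpha> x u) \<in> continuous_additive M M"
    using SE by (intro finsum_continuous_additive finite_subset[OF SE E(2)] \<alpha>(1)) blast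
  ultimately show ?thesis by (simp add: MM.continuous_hom_iff_equivariant)
qed

context indecomposable_profinite_group_module
begin

lemma orbit_partition_of_unity:
  assumes E: "group_action G E \<sigma>" "finite E" and \<alpha>: "equivariant_partition_of_unity E \<sigma> \<alpha>"
  shows "\<exists>w\<in>E. \<exists>\<gamma>. equivariant_partition_of_unity (orbit G \<sigma> w) (\<lambda>g. \<lambda>x\<in>orbit G \<sigma> w. \<sigma> g x) \<gamma>"
proof -
  interpret E: group_action G E \<sigma> by fact
  note \<alpha>D = equivariant_partition_of_unityD[OF \<alpha>]
  define \<theta> where "\<theta> S u = (\<Oplus>\<^bsub>M\<^esub>w\<in>S. \<alpha> w u)" for S u
  have End: "\<theta> S \<in> End" if "S \<in> orbits G E \<sigma>" for S
    unfolding \<theta>_def using finsum_orbit_End[OF E \<alpha>] that by (auto simp: orbits_def)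
  have "finite (orbits G E \<sigma>)"
    using E(2) by (simp add: partition.partition_coverture[OF E.orbit_partition] finite_UnionD)
  moreover have "(\<Oplus>\<^bsub>M\<^esub>S\<in>orbits G E \<sigma>. \<theta> S u) = u" if u: "u \<in> carrier M" for u
    using E.finsum_orbits[OF M.abelian_monoid_axioms E(2), of "\<lambda>w. \<alpha> w u"] \<alpha>D(3)[OF u]
      continuous_additive_closed[OF \<alpha>D(1) u] by (simp add: \<theta>_def)
  then have "bij_betw (\<lambda>u. \<Oplus>\<^bsub>M\<^esub>S\<in>orbits G E \<sigma>. \<theta> S u) (carrier M) (carrier M)"
    by (simp add: bij_betw_def inj_on_def)
  ultimately have "\<exists>S\<in>orbits G E \<sigma>. bij_betw (\<theta> S) (carrier M) (carrier M)"
    by (intro End_bij_finsum_summand End)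
  then obtain w where w: "w \<in> E" "bij_betw (\<theta> (orbit G \<sigma> w)) (carrier M) (carrier M)"
    by (auto simp: orbits_def)
  let ?S = "orbit G \<sigma> w"
  have S: "?S \<in> orbits G E \<sigma>" "?S \<subseteq> E"
    using w(1) E.orbit_subset by (auto simp: orbits_def)
  obtain \<eta> where \<eta>: "\<eta> \<in> End" "\<And>u. u \<in> carrier M \<Longrightarrow> \<theta> ?S (\<eta> u) = u"
    by (rule End_inverse[OF End[OF S(1)] w(2)]) blast
  have "equivariant_partition_of_unity ?S (\<lambda>g. \<lambda>x\<in>?S. \<sigma> g x) (\<lambda>w u. \<alpha> w (\<eta> u))"
    unfolding equivariant_partition_of_unity_def
  proof (intro conjI ballI)
    show "(\<lambda>u. \<alpha> w (\<eta> u)) \<in> continuous_additive M M" if "w \<in> ?S" for w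
      by (rule continuous_additive_compose[OF continuous_hom_imp_continuous_additive[OF \<eta>(1)] \<alpha>D(1)])
        (use that S(2) in blast)
    show "\<alpha> ((\<lambda>x\<in>?S. \<sigma> g x) w) (\<eta> (pt c g \<odot>\<^bsub>M\<^esub> u)) = pt c g \<odot>\<^bsub>M\<^esub> \<alpha> w (\<eta> u)"
      if "c \<in> carrier k" "g \<in> carrier G" "w \<in> ?S" "u \<in> carrier M" for c g w u
      using that S(2) by (simp add: continuous_hom_smult[OF \<eta>(1)] continuous_hom_closed[OF \<eta>(1)]
          pt_closed \<alpha>D(2) subset_iff)
  qed (use \<eta>(2) in \<open>simp add: \<theta>_def\<close>)
  then show ?thesis using w(1) by blast
qed

end

context indecomposable_profinite_group_module
begin

lemma relatively_projective_Int_conjugate_open: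
  assumes Q: "relatively_projective k G Q M" "closed_subgroup Q G" "Q \<subseteq> H"
    and R: "relatively_projective k G R M" "closed_subgroup R G" "R \<subseteq> K"
    and H: "subgroup H G" "openin G.Gtop H" and K: "subgroup K G" "openin G.Gtop K"
  shows "\<exists>z\<in>carrier G. relatively_projective k G (H \<inter> G.conjugate z K) M"
proof -
  let ?A = "rcosets\<^bsub>G\<^esub> H" and ?\<sigma> = "\<lambda>g. \<lambda>C\<in>rcosets\<^bsub>G\<^esub> H. C #>\<^bsub>G\<^esub> inv\<^bsub>G\<^esub> g"
    and ?B = "rcosets\<^bsub>G\<^esub> K" and ?\<tau> = "\<lambda>g. \<lambda>C\<in>rcosets\<^bsub>G\<^esub> K. C #>\<^bsub>G\<^esub> inv\<^bsub>G\<^esub> g"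
  let ?E = "?A \<times> ?B" and ?\<upsilon> = "\<lambda>g. \<lambda>p\<in>?A \<times> ?B. (?\<sigma> g (fst p), ?\<tau> g (snd p))"
  note HG = subgroup.subset[OF H(1)] and KG = subgroup.subset[OF K(1)]
  note fin = G.finite_rcosets_open_subgroup[OF H] G.finite_rcosets_open_subgroup[OF K]
  have E: "group_action G ?E ?\<upsilon>" "finite ?E"
    using group_action_Times[OF transitive_action.axioms(1)[OF G.rcosets_transitive_action[OF H(1)]]
        transitive_action.axioms(1)[OF G.rcosets_transitive_action[OF K(1)]]] fin by simp_all
  obtain \<alpha> \<beta> where "equivariant_partition_of_unity ?A ?\<sigma> \<alpha>" "equivariant_partition_of_unity ?B ?\<tau> \<beta>"
    using rcosets_partition_of_unity[OF Q(1,2) H Q(3)] rcosets_partition_of_unity[OF R(1,2) K R(3)]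
    by blast
  from orbit_partition_of_unity[OF E
      equivariant_partition_of_unity_Times[OF fin(1) this(1) fin(2) this(2)]]
  obtain w \<gamma> where w: "w \<in> ?E"
    and \<gamma>: "equivariant_partition_of_unity (orbit G ?\<upsilon> w) (\<lambda>g. \<lambda>p\<in>orbit G ?\<upsilon> w. ?\<upsilon> g p) \<gamma>"
    by blast
  obtain x y where x: "x \<in> carrier G" and y: "y \<in> carrier G" and w_eq: "w = (H #>\<^bsub>G\<^esub> x, K #>\<^bsub>G\<^esub> y)"
    using w by (auto simp: RCOSETS_def)
  let ?S = "stabilizer G (\<lambda>g. \<lambda>p\<in>orbit G ?\<upsilon> w. ?\<upsilon> g p) w"
  have w_orbit: "w \<in> orbit G ?\<upsilon> w" by (rule group_action.orbit_refl[OF E(1) w])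
  have "?S = stabilizer G ?\<sigma> (fst w) \<inter> stabilizer G ?\<tau> (snd w)"
    unfolding stabilizer_restrict[OF w_orbit] by (rule stabilizer_Times[OF w])
  then have S: "?S = G.conjugate (inv\<^bsub>G\<^esub> x) H \<inter> G.conjugate (inv\<^bsub>G\<^esub> y) K"
    by (simp only: w_eq fst_conv snd_conv G.stabilizer_rcoset[OF H(1) x] G.stabilizer_rcoset[OF K(1) y])
  have closed: "closed_subgroup ?S G"
    unfolding S using x y
    by (intro G.closed_subgroup_Int G.closed_subgroup_conjugate G.closed_subgroup_if_open H K) simp_all
  have "relatively_projective k G ?S M"
    by (rule relatively_projective_stabilizer[OF group_action.orbit_transitive_action[OF E(1) w]
        finite_subset[OF group_action.orbit_subset[OF E(1) w] E(2)] w_orbit \<gamma> closed])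
  from relatively_projective_conjugate[OF this closed x]
  have "relatively_projective k G (G.conjugate x (G.conjugate (inv\<^bsub>G\<^esub> x) H \<inter> G.conjugate (inv\<^bsub>G\<^esub> y) K)) M"
    unfolding S .
  also have "G.conjugate x (G.conjugate (inv\<^bsub>G\<^esub> x) H \<inter> G.conjugate (inv\<^bsub>G\<^esub> y) K)
      = H \<inter> G.conjugate (x \<otimes>\<^bsub>G\<^esub> inv\<^bsub>G\<^esub> y) K"
    using G.conjugate_Int[OF x G.conjugate_subset[OF G.inv_closed[OF x] HG]
        G.conjugate_subset[OF G.inv_closed[OF y] KG]]
      G.conjugate_inv(1)[OF x HG] G.conjugate_mult[OF x G.inv_closed[OF y] KG]
    by (simp only:)
  finally show ?thesis using x y by (intro bexI[of _ "x \<otimes>\<^bsub>G\<^esub> inv\<^bsub>G\<^esub> y"]) simp_all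
qed

end

section \<open>Relative projectivity and intersections\<close>

definition approximate_lifts ::
    "('r, 'a) ring_scheme \<Rightarrow> ('r, 'm, 'b) module_scheme \<Rightarrow> ('r, 'v, 'c) module_scheme \<Rightarrow>
      ('v \<Rightarrow> 'w) \<Rightarrow> ('m \<Rightarrow> 'w) \<Rightarrow> 'v set \<Rightarrow> ('m \<Rightarrow> 'v) set" where
  "approximate_lifts R M V \<beta> \<phi> D = {f \<in> carrier M \<rightarrow>\<^sub>E carrier V.
    (\<forall>x\<in>carrier M. \<forall>y\<in>carrier M. f (x \<oplus>\<^bsub>M\<^esub> y) = f x \<oplus>\<^bsub>V\<^esub> f y) \<and>
    (\<forall>x\<in>carrier M. \<beta> (f x) = \<phi> x) \<and>
    (\<forall>r\<in>carrier R. \<forall>x\<in>carrier M. f (r \<odot>\<^bsub>M\<^esub> x) \<ominus>\<^bsub>V\<^esub> r \<odot>\<^bsub>V\<^esub> f x \<in> D)}"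

lemma approximate_lifts_mono: "D \<subseteq> D' \<Longrightarrow> approximate_lifts R M V \<beta> \<phi> D \<subseteq> approximate_lifts R M V \<beta> \<phi> D'"
  unfolding approximate_lifts_def by blast

lemma (in compact_ring_module) closedin_approximate_lifts:
  fixes V :: "('r, 'v, 'c) top_module_scheme" and W :: "('r, 'w, 'd) top_module_scheme"
  assumes V: "compact_ring_module R V" and W: "compact_ring_module R W"
    and \<beta>: "\<beta> \<in> continuous_hom R V W" and \<phi>: "\<phi> \<in> carrier M \<rightarrow> carrier W"
    and D: "closedin (mtopology V) D"
  shows "closedin (product_topology (\<lambda>_. mtopology V) (carrier M)) (approximate_lifts R M V \<beta> \<phi> D)"
proof -
  interpret V: compact_ring_module R V by fact
  interpret W: compact_ring_module R W by fact
  let ?F = "product_topology (\<lambda>_. V.Mtop) (carrier M)"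
  have ev: "continuous_map ?F V.Mtop (\<lambda>f. f x)" if "x \<in> carrier M" for x
    by (rule continuous_map_product_projection[OF that])
  have "closedin ?F {f \<in> topspace ?F. f (x \<oplus>\<^bsub>M\<^esub> y) = f x \<oplus>\<^bsub>V\<^esub> f y}"
    if "x \<in> carrier M" "y \<in> carrier M" for x y
    using that by (intro closedin_continuous_maps_eq[OF V.Hausdorff_M] V.continuous_map_add ev) auto
  moreover have "closedin ?F {f \<in> topspace ?F. \<beta> (f x) = \<phi> x}" if x: "x \<in> carrier M" for x
    using continuous_map_compose[OF ev[OF x] continuous_hom_continuous[OF \<beta>]] \<phi> x
    by (intro closedin_continuous_maps_eq[OF W.Hausdorff_M]) (auto simp: o_def W.topspace_mtopology)
  moreover have "closedin ?F {f \<in> topspace ?F. f (r \<odot>\<^bsub>M\<^esub> x) \<ominus>\<^bsub>V\<^esub> r \<odot>\<^bsub>V\<^esub> f x \<in> D}"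
    if "r \<in> carrier R" "x \<in> carrier M" for r x
    using that
    by (intro closedin_continuous_map_preimage[OF V.continuous_map_minus D]
        V.continuous_map_smult_const ev) auto
  ultimately have "closedin ?F {f \<in> topspace ?F.
      (\<forall>x\<in>carrier M. \<forall>y\<in>carrier M. f (x \<oplus>\<^bsub>M\<^esub> y) = f x \<oplus>\<^bsub>V\<^esub> f y) \<and> (\<forall>x\<in>carrier M. \<beta> (f x) = \<phi> x) \<and>
      (\<forall>r\<in>carrier R. \<forall>x\<in>carrier M. f (r \<odot>\<^bsub>M\<^esub> x) \<ominus>\<^bsub>V\<^esub> r \<odot>\<^bsub>V\<^esub> f x \<in> D)}"
    by (intro closedin_Collect_conj closedin_Collect_ball)
  then show ?thesis by (simp add: approximate_lifts_def V.topspace_mtopology)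
qed

lemma (in fg_profinite_module) exists_lift_if_approximate_lifts:
  fixes V :: "('r, 'v, 'c) top_module_scheme" and W :: "('r, 'w, 'd) top_module_scheme"
  assumes V: "compact_ring_module R V" and W: "compact_ring_module R W"
    and \<beta>: "\<beta> \<in> continuous_hom R V W" and \<phi>: "\<phi> \<in> carrier M \<rightarrow> carrier W"
    and approx: "\<And>D. submodule D R V \<Longrightarrow> openin (mtopology V) D \<Longrightarrow> approximate_lifts R M V \<beta> \<phi> D \<noteq> {}"
  shows "\<exists>f\<in>continuous_hom R M V. \<forall>x\<in>carrier M. \<beta> (f x) = \<phi> x"
proof -
  interpret V: compact_ring_module R V by fact
  let ?F = "product_topology (\<lambda>_. V.Mtop) (carrier M)" and ?lifts = "approximate_lifts R M V \<beta> \<phi>"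
  let ?I = "{D. submodule D R V \<and> openin V.Mtop D}"
  have carrier: "carrier V \<in> ?I"
    using openin_topspace[of V.Mtop] by (simp add: V.topspace_mtopology V.submodule_carrier)
  have "(\<Inter>D\<in>?I. ?lifts D) \<noteq> {}"
  proof (rule compact_space_directed_Inter)
    show "compact_space ?F" by (simp add: compact_space_product_topology V.compact_M)
    show "?I \<noteq> {}" using carrier by blast
    fix D assume D: "D \<in> ?I"
    then show "closedin ?F (?lifts D)" "?lifts D \<noteq> {}"
      using V.closedin_open_submodule approx by (auto intro: closedin_approximate_lifts[OF V W \<beta> \<phi>])
    fix D' assume "D' \<in> ?I"
    then have "D \<inter> D' \<in> ?I" using D by (auto intro: V.submodule_Int)
    then show "\<exists>L\<in>?I. ?lifts L \<subseteq> ?lifts D \<inter> ?lifts D'"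
      by (rule bexI[rotated]) (intro Int_greatest approximate_lifts_mono; blast)
  qed
  then obtain f where Inter: "f \<in> (\<Inter>D\<in>?I. ?lifts D)" by blast
  have f: "f \<in> ?lifts D" if "D \<in> ?I" for D by (rule INT_D[OF Inter that])
  have maps: "f \<in> carrier M \<rightarrow> carrier V"
    and add: "\<And>x y. x \<in> carrier M \<Longrightarrow> y \<in> carrier M \<Longrightarrow> f (x \<oplus>\<^bsub>M\<^esub> y) = f x \<oplus>\<^bsub>V\<^esub> f y"
    and lift: "\<forall>x\<in>carrier M. \<beta> (f x) = \<phi> x"
    using f[OF carrier] by (auto simp: approximate_lifts_def)
  have "f (r \<odot>\<^bsub>M\<^esub> x) = r \<odot>\<^bsub>V\<^esub> f x" if rx: "r \<in> carrier R" "x \<in> carrier M" for r x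
  proof (rule V.eq_if_rcos_eq)
    fix D assume D: "submodule D R V" "openin V.Mtop D"
    interpret D: abelian_subgroup D V by (rule V.submodule_abelian_subgroup[OF D(1)])
    have "f (r \<odot>\<^bsub>M\<^esub> x) \<ominus>\<^bsub>V\<^esub> r \<odot>\<^bsub>V\<^esub> f x \<in> D" using f[of D] D rx by (simp add: approximate_lifts_def)
    then show "D +>\<^bsub>V\<^esub> f (r \<odot>\<^bsub>M\<^esub> x) = D +>\<^bsub>V\<^esub> r \<odot>\<^bsub>V\<^esub> f x"
      using maps rx by (simp add: D.a_rcos_eq_iff Pi_iff)
  qed (use maps rx in auto)
  then have "f \<in> continuous_hom R M V" by (intro linear_imp_continuous[OF V maps add])
  then show ?thesis using lift by blast
qed

context profinite_group_module_pair
begin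

lemma openin_equivariant_mod:
  assumes \<psi>: "\<psi> \<in> continuous_additive U V" and D: "submodule D KG V" "openin V.Mtop D"
  shows "openin G.Gtop {g \<in> topspace G.Gtop. equivariant_mod {g} D \<psi>}"
proof -
  interpret D: abelian_subgroup D V by (rule V.submodule_abelian_subgroup[OF D(1)])
  have mod_iff: "equivariant_mod {g} D \<psi> \<longleftrightarrow>
      (\<forall>c\<in>carrier k. \<forall>u\<in>carrier U. \<psi> (pt c g \<odot>\<^bsub>U\<^esub> u) \<ominus>\<^bsub>V\<^esub> pt c g \<odot>\<^bsub>V\<^esub> \<psi> u \<in> D)"
    if "g \<in> carrier G" for g
    using that continuous_additive_closed[OF \<psi>] by (simp add: equivariant_mod_def D.a_rcos_eq_iff)
  have "openin G.Gtop {g \<in> topspace G.Gtop. \<forall>u\<in>carrier U.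
      \<psi> (pt c (fst (g, u)) \<odot>\<^bsub>U\<^esub> snd (g, u)) \<ominus>\<^bsub>V\<^esub> pt c (fst (g, u)) \<odot>\<^bsub>V\<^esub> \<psi> (snd (g, u)) \<in> D}"
    if c: "c \<in> carrier k" for c
  proof (rule openin_forall_compactin[OF V.continuous_map_minus _ D(2)])
    show "compactin U.Mtop (carrier U)"
      using U.compact_M by (simp add: compact_space_def U.topspace_mtopology)
    let ?X = "prod_topology G.Gtop U.Mtop"
    show "continuous_map ?X V.Mtop (\<lambda>p. \<psi> (pt c (fst p) \<odot>\<^bsub>U\<^esub> snd p))"
      using continuous_map_compose[OF
          U.continuous_map_pt_smult[OF continuous_map_fst continuous_map_snd c]
          continuous_additive_continuous[OF \<psi>]] by (simp add: o_def)
    show "continuous_map ?X V.Mtop (\<lambda>p. pt c (fst p) \<odot>\<^bsub>V\<^esub> \<psi> (snd p))"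
      using continuous_map_compose[OF continuous_map_snd continuous_additive_continuous[OF \<psi>]]
      by (intro V.continuous_map_pt_smult continuous_map_fst c) (simp add: o_def)
  qed
  then have "openin G.Gtop (\<Inter>c\<in>carrier k. {g \<in> topspace G.Gtop. \<forall>u\<in>carrier U.
      \<psi> (pt c g \<odot>\<^bsub>U\<^esub> u) \<ominus>\<^bsub>V\<^esub> pt c g \<odot>\<^bsub>V\<^esub> \<psi> u \<in> D})"
    using k.one_closed by (intro openin_INT2 finite_k) auto
  also have "(\<Inter>c\<in>carrier k. {g \<in> topspace G.Gtop. \<forall>u\<in>carrier U.
      \<psi> (pt c g \<odot>\<^bsub>U\<^esub> u) \<ominus>\<^bsub>V\<^esub> pt c g \<odot>\<^bsub>V\<^esub> \<psi> u \<in> D})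
    = {g \<in> topspace G.Gtop. equivariant_mod {g} D \<psi>}" (is "?I = ?E")
  proof (rule Set.set_eqI)
    show "g \<in> ?I \<longleftrightarrow> g \<in> ?E" for g
      using k.one_closed by (cases "g \<in> carrier G") (auto simp: mod_iff G.topspace_gtopology)
  qed
  finally show ?thesis .
qed

text \<open>A lift equivariant under \<open>\<Inter>\<S>\<close> is equivariant under some member of \<open>\<S>\<close> modulo any given open
  submodule, so that its relative trace is a lift that is \<open>G\<close>-equivariant modulo that submodule.\<close>

lemma equivariant_mod_lift_if_directed:
  fixes W :: "(('g, 'k) cga, 'w) top_module"
  assumes \<S>: "\<S> \<noteq> {}" "\<And>S. S \<in> \<S> \<Longrightarrow> subgroup S G" "\<And>S. S \<in> \<S> \<Longrightarrow> openin G.Gtop S"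
    and directed: "\<And>S T. S \<in> \<S> \<Longrightarrow> T \<in> \<S> \<Longrightarrow> \<exists>L\<in>\<S>. L \<subseteq> S \<inter> T"
    and proj: "\<And>S. S \<in> \<S> \<Longrightarrow> relatively_projective k G S U"
    and W: "profinite_group_module k G W"
    and \<beta>: "\<beta> \<in> continuous_hom KG V W" and \<phi>: "\<phi> \<in> continuous_hom KG U W"
    and \<psi>: "\<psi> \<in> continuous_additive U V" "equivariant (\<Inter>\<S>) \<psi>"
    and lift: "\<And>u. u \<in> carrier U \<Longrightarrow> \<beta> (\<psi> u) = \<phi> u"
    and D: "submodule D KG V" "openin V.Mtop D"
  shows "\<exists>\<rho>\<in>continuous_additive U V. equivariant_mod (carrier G) D \<rho> \<and> (\<forall>u\<in>carrier U. \<beta> (\<rho> u) = \<phi> u)"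
proof -
  have Inter: "\<Inter>\<S> \<subseteq> carrier G" using \<S>(1) subgroup.subset[OF \<S>(2)] by blast
  have "\<Inter>\<S> \<subseteq> {g \<in> topspace G.Gtop. equivariant_mod {g} D \<psi>}"
    using \<psi>(2) Inter unfolding equivariant_iff[OF \<psi>(1) Inter]
    by (auto simp: equivariant_mod_def G.topspace_gtopology)
  then have "\<exists>S\<in>\<S>. S \<subseteq> {g \<in> topspace G.Gtop. equivariant_mod {g} D \<psi>}"
    using compact_space_directed_subset[OF G.compact_Gtop \<S>(1), of "\<lambda>S. S"] directed
      G.closedin_open_subgroup[OF \<S>(2,3)] openin_equivariant_mod[OF \<psi>(1) D] by simp
  then obtain S where S: "S \<in> \<S>" "S \<subseteq> {g \<in> topspace G.Gtop. equivariant_mod {g} D \<psi>}" by blast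
  let ?\<sigma> = "\<lambda>g. \<lambda>C\<in>rcosets\<^bsub>G\<^esub> S. C #>\<^bsub>G\<^esub> inv\<^bsub>G\<^esub> g"
  note S_open = \<S>(2,3)[OF S(1)]
  have SG: "S \<subseteq> carrier G" by (rule subgroup.subset[OF S_open(1)])
  obtain \<alpha> where \<alpha>: "U.equivariant_partition_of_unity (rcosets\<^bsub>G\<^esub> S) ?\<sigma> \<alpha>"
    using U.rcosets_partition_of_unity[OF proj[OF S(1)] G.closed_subgroup_if_open[OF S_open] S_open
      order_refl]
    by blast
  have "stabilizer G ?\<sigma> S = S"
    using G.stabilizer_rcoset[OF S_open(1) G.one_closed] G.conjugate_one[OF SG] SG by simp
  moreover have "equivariant_mod S D \<psi>" using S(2) by (auto simp: equivariant_mod_def)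
  ultimately show ?thesis
    using lift
    by (intro equivariant_lift_if_partition_of_unity[OF G.rcosets_transitive_action[OF S_open(1)]
        G.finite_rcosets_open_subgroup[OF S_open] subgroup.subgroup_in_rcosets[OF S_open(1) G.is_group]
        \<alpha> W \<beta> \<phi> \<psi>(1) _ D(1)]) simp_all
qed

end

locale fg_profinite_group_module =
  profinite_group_module k G M + fg_profinite_module "completed_group_algebra k G" M
  for k :: "('k, 'a) ring_scheme" and G :: "('g, 'b) top_group_scheme"
    and M :: "(('g, 'k) cga, 'm) top_module"

sublocale indecomposable_profinite_group_module \<subseteq> fg_profinite_group_module
  by unfold_locales

lemma (in fg_profinite_group_module) relatively_projective_Inter:
  assumes \<S>: "\<S> \<noteq> {}" "\<And>S. S \<in> \<S> \<Longrightarrow> subgroup S G" "\<And>S. S \<in> \<S> \<Longrightarrow> openin G.Gtop S"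
    and directed: "\<And>S T. S \<in> \<S> \<Longrightarrow> T \<in> \<S> \<Longrightarrow> \<exists>L\<in>\<S>. L \<subseteq> S \<inter> T"
    and proj: "\<And>S. S \<in> \<S> \<Longrightarrow> relatively_projective k G S M"
  shows "relatively_projective k G (\<Inter>\<S>) M"
proof (rule relatively_projectiveI)
  show "closed_subgroup (\<Inter>\<S>) G"
    unfolding closed_subgroup_def
    using \<S> G.closedin_open_subgroup by (auto intro!: G.subgroups_Inter closedin_Inter)
  fix V W :: "(('g, 'k) cga, ('g, 'k, 'm) test_universe) top_module" and \<beta> \<phi> \<psi>
  assume V: "profinite_group_module k G V" and W: "profinite_group_module k G W"
    and \<beta>epi: "\<beta> \<in> continuous_epi KG V W" and \<phi>: "\<phi> \<in> continuous_hom KG M W"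
    and \<psi>: "\<psi> \<in> continuous_additive M V" "profinite_group_module_pair.equivariant k G M V (\<Inter>\<S>) \<psi>"
    and lift: "\<And>u. u \<in> carrier M \<Longrightarrow> \<beta> (\<psi> u) = \<phi> u"
  interpret V: profinite_group_module k G V by fact
  interpret W: profinite_group_module k G W by fact
  interpret MV: profinite_group_module_pair k G M V by unfold_locales
  have \<beta>: "\<beta> \<in> continuous_hom KG V W" using \<beta>epi by (simp add: continuous_epi_def)
  show "\<exists>\<rho>\<in>continuous_hom KG M V. \<forall>u\<in>carrier M. \<beta> (\<rho> u) = \<phi> u"
  proof (rule exists_lift_if_approximate_lifts[OF V.compact_ring_module_axioms
      W.compact_ring_module_axioms \<beta>])
    show "\<phi> \<in> carrier M \<rightarrow> carrier W" using continuous_hom_closed[OF \<phi>] by blast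
    fix D assume D: "submodule D KG V" "openin V.Mtop D"
    interpret D: abelian_subgroup D V by (rule V.submodule_abelian_subgroup[OF D(1)])
    obtain \<rho> where \<rho>: "\<rho> \<in> continuous_additive M V" "MV.equivariant_mod (carrier G) D \<rho>"
      "\<forall>u\<in>carrier M. \<beta> (\<rho> u) = \<phi> u"
      using MV.equivariant_mod_lift_if_directed[OF \<S> directed proj W \<beta> \<phi> \<psi> lift D] by blast
    note closed = continuous_additive_closed[OF \<rho>(1)]
    have "\<rho> (r \<odot>\<^bsub>M\<^esub> u) \<ominus>\<^bsub>V\<^esub> r \<odot>\<^bsub>V\<^esub> \<rho> u \<in> D" if r: "r \<in> carrier KG" and u: "u \<in> carrier M" for r u
      using MV.equivariant_mod_smult[OF \<rho>(1) D(1) V.closedin_open_submodule[OF D] order_refl \<rho>(2)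
          subsetD[OF KG_subset_closed_point_span r] u] r u closed
            by (simp only: D.a_rcos_eq_iff smult_closed V.smult_closed)
    then have "restrict \<rho> (carrier M) \<in> approximate_lifts KG M V \<beta> \<phi> D"
      using \<rho>(3) closed by (simp add: approximate_lifts_def continuous_additive_add[OF \<rho>(1)])
    then show "approximate_lifts KG M V \<beta> \<phi> D \<noteq> {}" by blast
  qed
qed

section \<open>Conjugacy of vertices\<close>

context indecomposable_profinite_group_module
begin

lemma relatively_projective_Int_conjugate:
  assumes Q: "relatively_projective k G Q M" "closed_subgroup Q G"
    and R: "relatively_projective k G R M" "closed_subgroup R G"
  shows "\<exists>z\<in>carrier G. relatively_projective k G (Q \<inter> G.conjugate z R) M"
proof -
  note QG = G.closed_subgroup_subgroup[OF Q(2)] and RG = G.closed_subgroup_subgroup[OF R(2)]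
  let ?S = "\<lambda>N z. (N <#>\<^bsub>G\<^esub> Q) \<inter> G.conjugate z (N <#>\<^bsub>G\<^esub> R)"
  note QN = G.mult_open_normal[OF QG] and RN = G.mult_open_normal[OF RG]
  have S: "subgroup (?S N z) G" "openin G.Gtop (?S N z)" if "N \<in> ONS" "z \<in> carrier G" for N z
    using QN(1,2)[OF that(1)] RN(1,2)[OF that(1)] that(2)
    by (auto intro!: G.subgroups_Inter_pair openin_Int G.openin_conjugate G.subgroup_conjugation_is_surj2)
  have mono: "?S N z \<subseteq> ?S N' z" if "N \<subseteq> N'" for N N' z
    using mono_set_mult[OF that order_refl] by (intro Int_mono G.conjugate_mono)
  have "\<exists>z\<in>carrier G. \<forall>N\<in>ONS. relatively_projective k G (?S N z) M"
  proof (rule G.compact_simultaneous_solution)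
    show "\<exists>z\<in>carrier G. relatively_projective k G (?S N z) M" if "N \<in> ONS" for N
      by (rule relatively_projective_Int_conjugate_open[OF Q QN(3)[OF that] R RN(3)[OF that]
          QN(1,2)[OF that] RN(1,2)[OF that]])
    show "relatively_projective k G (?S N' z) M"
      if "N \<in> ONS" "N' \<in> ONS" "z \<in> carrier G" "N \<subseteq> N'" "relatively_projective k G (?S N z) M" for N N' z
      using that S mono by (intro relatively_projective_mono[OF that(5)] G.closed_subgroup_if_open)
    fix N n z assume N: "N \<in> ONS" and n: "n \<in> N" and z: "z \<in> carrier G"
    have "G.conjugate (n \<otimes>\<^bsub>G\<^esub> z) (N <#>\<^bsub>G\<^esub> R) = G.conjugate z (N <#>\<^bsub>G\<^esub> R)"
      by (rule G.conjugate_normal_mult[OF G.open_normal_normal[OF N] n RN(1,4)[OF N] z])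
    then show "relatively_projective k G (?S N (n \<otimes>\<^bsub>G\<^esub> z)) M \<longleftrightarrow> relatively_projective k G (?S N z) M"
      by simp
  qed
  then obtain z where z: "z \<in> carrier G" and proj: "\<And>N. N \<in> ONS \<Longrightarrow> relatively_projective k G (?S N z) M"
    by blast
  have "relatively_projective k G (\<Inter>N\<in>ONS. ?S N z) M"
  proof (rule relatively_projective_Inter)
    show "(\<lambda>N. ?S N z) ` ONS \<noteq> {}" using G.carrier_open_normal by blast
    fix A B assume "A \<in> (\<lambda>N. ?S N z) ` ONS" "B \<in> (\<lambda>N. ?S N z) ` ONS"
    then obtain N N' where "N \<in> ONS" "N' \<in> ONS" "A = ?S N z" "B = ?S N' z" by blast
    then show "\<exists>C\<in>(\<lambda>N. ?S N z) ` ONS. C \<subseteq> A \<inter> B"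
      using G.open_normal_Int[of N N'] mono[of "N \<inter> N'" N] mono[of "N \<inter> N'" N']
      by (intro bexI[of _ "?S (N \<inter> N') z"]) auto
  qed (use S z proj in auto)
  also have "(\<Inter>N\<in>ONS. ?S N z) = (\<Inter>N\<in>ONS. N <#>\<^bsub>G\<^esub> Q) \<inter> G.conjugate z (\<Inter>N\<in>ONS. N <#>\<^bsub>G\<^esub> R)"
    using G.carrier_open_normal by (subst G.conjugate_INT[OF z _ subgroup.subset[OF RN(1)]]) auto
  finally show ?thesis using z by (auto simp: G.Inter_mult_open_normal Q R)
qed

end

lemma (in profinite_group_module) vertex_conjugate:
  assumes R: "is_vertex k G M R" and z: "z \<in> carrier G"
  shows "is_vertex k G M (G.conjugate z R)"
  unfolding is_vertex_def
proof (intro conjI allI impI notI)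
  have closed: "closed_subgroup R G" and proj: "relatively_projective k G R M"
    and minimal: "\<And>R'. closed_subgroup R' G \<Longrightarrow> R' \<subset> R \<Longrightarrow> \<not> relatively_projective k G R' M"
    using R by (auto simp: is_vertex_def)
  show "closed_subgroup (G.conjugate z R) G" by (rule G.closed_subgroup_conjugate[OF closed z])
  show "relatively_projective k G (G.conjugate z R) M"
    by (rule relatively_projective_conjugate[OF proj closed z])
  fix S assume S: "closed_subgroup S G \<and> S \<subset> G.conjugate z R" and "relatively_projective k G S M"
  then show False
    using minimal[of "G.conjugate (inv\<^bsub>G\<^esub> z) S"] z
      relatively_projective_conjugate[of S "inv\<^bsub>G\<^esub> z"] G.closed_subgroup_conjugate[of S "inv\<^bsub>G\<^esub> z"]
      G.psubset_conjugate[OF z G.closed_subgroup_subset[OF closed], of S] by simp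
qed

lemma vertex_minimal:
  assumes "is_vertex k G U Q" "closed_subgroup H G" "H \<subseteq> Q" "relatively_projective k G H U"
  shows "H = Q"
  using assms by (auto simp: is_vertex_def)

theorem theorem4p6:
  fixes k :: "('k, 'a) ring_scheme"
    and p :: nat
    and G :: "('g, 'b) top_group_scheme"
    and U :: "(('g, 'k) cga, 'u) top_module"
    and Q R :: "'g set"
  assumes "field k" and "finite (carrier k)" and "ring_char k = p"
    and "profinite_group G"
    and "profinite_module (completed_group_algebra k G) U"
    and "finitely_generated_module (completed_group_algebra k G) U"
    and "indecomposable_module (completed_group_algebra k G) U"
    and "is_vertex k G U Q" and "is_vertex k G U R"
  shows "\<exists>x\<in>carrier G. Q = (\<lambda>r. x \<otimes>\<^bsub>G\<^esub> r \<otimes>\<^bsub>G\<^esub> inv\<^bsub>G\<^esub> x) ` R"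
proof -
  interpret profinite_group_module k G U
    by (intro profinite_group_module.intro profinite_group_algebra.intro
        profinite_group_algebra_axioms.intro assms)
  interpret indecomposable_profinite_group_module k G U
    by unfold_locales (rule assms)+
  have Q: "relatively_projective k G Q U" "closed_subgroup Q G"
    and R: "relatively_projective k G R U" "closed_subgroup R G"
    using assms(8,9) by (simp_all add: is_vertex_def)
  obtain x where x: "x \<in> carrier G" "relatively_projective k G (Q \<inter> G.conjugate x R) U"
    using relatively_projective_Int_conjugate[OF Q R] by blast
  have closed: "closed_subgroup (Q \<inter> G.conjugate x R) G"
    by (intro G.closed_subgroup_Int G.closed_subgroup_conjugate Q R x)
  have "Q \<inter> G.conjugate x R = Q"
    by (rule vertex_minimal[OF assms(8) closed Int_lower1 x(2)])
  moreover have "Q \<inter> G.conjugate x R = G.conjugate x R"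
    by (rule vertex_minimal[OF vertex_conjugate[OF assms(9) x(1)] closed Int_lower2 x(2)])
  ultimately show ?thesis using x(1) by (auto simp: G.conjugate_eq_image)
qed

end
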